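(* Let $(I,m)$ be a probability space and let $f\colon \bigcup_{i=1}^n I_i\to I$ be a Markovian expanding map, i.e. a map satisfying conditions (A)–(F) listed in the context, with exponents $\beta,\epsilon>0$ in (F). Let $\mathcal{P}=(\mathcal{P}^k)_{k\ge 0}$ be the dynamical good grid of $f$ defined in the context, let $p\in[1,\infty)$, $q\in[1,\infty]$, $0<s<\beta<1/p$, and let $p'$ be defined by $1/p+1/p'=1$. Let $\Phi$ be the Ruelle–Perron–Frobenius operator of $f$ (see context). Then the essential spectral radius of $\Phi$ acting on $\mathcal{B}^s_{p,q}(I,m,\mathcal{P})$ satisfies $$r_{ess}(\Phi,\mathcal{B}^s_{p,q}(I,m,\mathcal{P}))\leq \Big(\liminf_{j\to\infty}\Big(\sum_{P\in\mathcal{P}^j}|P|^{1+sp'}\Big)^{1/j}\Big)^{1/p'}.$$ In particular $r_{ess}(\Phi,\mathcal{B}^s_{p,q}(I,m,\mathcal{P}))\leq (\inf w)^{-s}<1$, where $w$ is the Jacobian of $f$.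
   Context: Notation: $|A|=m(A)$. For $p=1$ we have $1/p'=0$ and the right-hand side of the displayed inequality is read as $\liminf_{j}(\max_{P\in\mathcal{P}^j}|P|^{s})^{1/j}$. Markovian expanding map. $\{I_1,\dots,I_n\}$, $n\ge2$, are subsets of $I$ and $f\colon\bigcup_i I_i\to I$ satisfies: (A) $I_i\cap I_j=\emptyset$ for $i\neq j$. (B) $m(I_i)>0$ for every $i$ and $m(I\setminus\bigcup_i I_i)=0$. (C) $f(I_i)$ is measurable, $f\colon I_i\to f(I_i)$ is a bijection with measurable inverse $h_i\colon f(I_i)\to I_i$ and Jacobian $w$, i.e. $m(f(A))=\int_A w\,dm$ for every measurable $A\subset I_i$; moreover $\inf w>1$. (D) For every $i$ the set $f(I_i)$ is a union of at least two elements of $\{I_1,\dots,I_n\}$. Define $\mathcal{P}^0=\{I\}$, $\mathcal{P}^1=\{I_1,\dots,I_n\}$ and, for $k\ge1$, $\mathcal{P}^{k+1}=\{h_i(Q): Q\in\mathcal{P}^k,\ Q\subset f(I_i)\}$. (E) (Bowen condition) $\sup_k\sup_{P\in\mathcal{P}^k}\sup_{x,y\in P}\big|\sum_{i=0}^{k-1}\ln w(f^ix)-\sum_{i=0}^{k-1}\ln w(f^iy)\big|<\infty$, and there is $C>0$ with $1/C\le w(x)\le C$ for every $x$. (F) With $d(x,y)=\inf\{|Q|: x,y\in Q\in\bigcup_k\mathcal{P}^k\}$, there is $C$ such that $|w(x)-w(y)|\le C\,d(x,y)^{\beta+\epsilon}$ for all $x,y\in I_i$, $i\le n$. Under these conditions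 $\mathcal{P}=(\mathcal{P}^k)_k$ is a good grid. Good grid. A good grid on a finite measure space $(I,m)$ is a sequence $\mathcal{P}=(\mathcal{P}^k)_{k\ge0}$ of finite families of measurable sets of positive measure such that $\mathcal{P}^0=\{I\}$; each $\mathcal{P}^k$ is a partition of $I$ up to a null set; each element of $\mathcal{P}^{k+1}$ is contained in an element of $\mathcal{P}^k$; there are $0<\lambda_1\le\lambda_2<1$ with $\lambda_1\le|Q|/|P|\le\lambda_2$ whenever $Q\in\mathcal{P}^{k+1}$, $P\in\mathcal{P}^k$, $Q\subset P$; and $\bigcup_k\mathcal{P}^k$ generates the $\sigma$-algebra. Besov space. For $s>0$, $p\in[1,\infty)$, $q\in[1,\infty]$ put $a_Q=|Q|^{s-1/p}1_Q$. $\mathcal{B}^s_{p,q}(I,m,\mathcal{P})$ is the space of $\psi\in L^p(m)$ that can be written $\psi=\sum_k\sum_{Q\in\mathcal{P}^k}c_Qa_Q$ (the series in $k$ converging in $L^p$) with $\big(\sum_k(\sum_{Q\in\mathcal{P}^k}|c_Q|^p)^{q/p}\big)^{1/q}<\infty$ (supremum over $k$ if $q=\infty$); its norm is the infimum of this quantity over all such representations. Transfer operator: $(\Phi\psi)(x)=\sum_{i:\,x\in f(I_i)}\frac{1}{w(h_i(x))}\psi(h_i(x))$. *)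

theory Defs
  imports "HOL-Probability.Probability"
begin

abbreviation branch_inverse :: "(nat \<Rightarrow> 'a set) \<Rightarrow> ('a \<Rightarrow> 'a) \<Rightarrow> nat \<Rightarrow> 'a \<Rightarrow> 'a" where
  "branch_inverse U f i \<equiv> the_inv_into (U i) f"

fun dynamical_grid ::
  "'a measure \<Rightarrow> nat \<Rightarrow> (nat \<Rightarrow> 'a set) \<Rightarrow> ('a \<Rightarrow> 'a) \<Rightarrow> nat \<Rightarrow> 'a set set"
where
  "dynamical_grid M n U f 0 = {space M}"
| "dynamical_grid M n U f (Suc 0) = U ` {1..n}"
| "dynamical_grid M n U f (Suc (Suc k)) =
     {branch_inverse U f i ` Q | i Q.
        i \<in> {1..n} \<and> Q \<in> dynamical_grid M n U f (Suc k) \<and> Q \<subseteq> f ` U i}"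

text \<open>
  The infimum runs over a nonempty set of nonnegative reals when \<open>x\<close> and \<open>y\<close> lie in the
  space and the space itself belongs to the grid, as it does for a dynamical grid.
\<close>

definition grid_dist :: "'a measure \<Rightarrow> (nat \<Rightarrow> 'a set set) \<Rightarrow> 'a \<Rightarrow> 'a \<Rightarrow> real" where
  "grid_dist M P x y = Inf {measure M Q | Q. Q \<in> (\<Union>k. P k) \<and> x \<in> Q \<and> y \<in> Q}"

text \<open>
  The phase space \<open>I\<close> is \<open>space M\<close> and the sets \<open>I\<^sub>1, \<dots>, I\<^sub>n\<close> are \<open>U 1, \<dots>, U n\<close>. The maps \<open>f\<close>
  and \<open>w\<close> are total in HOL, but only their values on the union of the \<open>U i\<close> matter.
  Each branch is assumed measurable in both directions, which is what makes the elements of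
  the dynamical grid measurable sets.
\<close>

locale markovian_expanding_map = prob_space M
  for M :: "'a measure" +
  fixes n :: nat
    and U :: "nat \<Rightarrow> 'a set"
    and f :: "'a \<Rightarrow> 'a"
    and w :: "'a \<Rightarrow> real"
    and \<beta> \<epsilon> :: real
  assumes n_ge_2: "n \<ge> 2"
    and exponents_pos: "\<beta> > 0" "\<epsilon> > 0"
    and A_disjoint: "disjoint_family_on U {1..n}"
    and B_measurable: "\<And>i. i \<in> {1..n} \<Longrightarrow> U i \<in> sets M"
    and B_pos: "\<And>i. i \<in> {1..n} \<Longrightarrow> measure M (U i) > 0"
    and B_cover: "measure M (space M - (\<Union>i\<in>{1..n}. U i)) = 0"
    and C_image: "\<And>i. i \<in> {1..n} \<Longrightarrow> f ` U i \<in> sets M"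
    and C_inj: "\<And>i. i \<in> {1..n} \<Longrightarrow> inj_on f (U i)"
    and C_measurable: "\<And>i. i \<in> {1..n} \<Longrightarrow>
          f \<in> measurable (restrict_space M (U i)) (restrict_space M (f ` U i))"
    and C_inverse_measurable: "\<And>i. i \<in> {1..n} \<Longrightarrow>
          branch_inverse U f i \<in> measurable (restrict_space M (f ` U i)) (restrict_space M (U i))"
    and C_w_measurable: "w \<in> borel_measurable (restrict_space M (\<Union>i\<in>{1..n}. U i))"
    and C_jacobian: "\<And>i A. i \<in> {1..n} \<Longrightarrow> A \<in> sets M \<Longrightarrow> A \<subseteq> U i \<Longrightarrow>
          emeasure M (f ` A) = (\<integral>\<^sup>+x\<in>A. ennreal (w x) \<partial>M)"
    and C_expanding: "(INF x\<in>(\<Union>i\<in>{1..n}. U i). w x) > 1"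
    and D_markov: "\<And>i. i \<in> {1..n} \<Longrightarrow>
          \<exists>J \<subseteq> {1..n}. card J \<ge> 2 \<and> f ` U i = (\<Union>j\<in>J. U j)"
    and E_bowen: "\<exists>K. \<forall>k. \<forall>P \<in> dynamical_grid M n U f k. \<forall>x\<in>P. \<forall>y\<in>P.
          \<bar>(\<Sum>i<k. ln (w ((f ^^ i) x))) - (\<Sum>i<k. ln (w ((f ^^ i) y)))\<bar> \<le> K"
    and E_bounded: "\<exists>C>0. \<forall>x \<in> (\<Union>i\<in>{1..n}. U i). 1 / C \<le> w x \<and> w x \<le> C"
    and F_hoelder: "\<exists>C. \<forall>i\<in>{1..n}. \<forall>x \<in> U i. \<forall>y \<in> U i.
          \<bar>w x - w y\<bar> \<le> C * grid_dist M (dynamical_grid M n U f) x y powr (\<beta> + \<epsilon>)"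

definition transfer_operator ::
  "nat \<Rightarrow> (nat \<Rightarrow> 'a set) \<Rightarrow> ('a \<Rightarrow> 'a) \<Rightarrow> ('a \<Rightarrow> real) \<Rightarrow> ('a \<Rightarrow> complex) \<Rightarrow> 'a \<Rightarrow> complex"
where
  "transfer_operator n U f w \<psi> x =
     (\<Sum>i | i \<in> {1..n} \<and> x \<in> f ` U i.
        complex_of_real (1 / w (branch_inverse U f i x)) * \<psi> (branch_inverse U f i x))"

text \<open>
  Functions are complex valued, and are not identified when they agree almost everywhere:
  the identification is made by the notions that use these spaces.
\<close>

definition Lp_functions :: "'a measure \<Rightarrow> real \<Rightarrow> ('a \<Rightarrow> complex) set" where
  "Lp_functions M p =
     {\<psi> \<in> borel_measurable M. integrable M (\<lambda>x. cmod (\<psi> x) powr p)}"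

definition atom :: "'a measure \<Rightarrow> real \<Rightarrow> real \<Rightarrow> 'a set \<Rightarrow> 'a \<Rightarrow> complex" where
  "atom M s p Q x = complex_of_real (measure M Q powr (s - 1 / p) * indicator Q x)"

definition besov_represents ::
  "'a measure \<Rightarrow> (nat \<Rightarrow> 'a set set) \<Rightarrow> real \<Rightarrow> real \<Rightarrow> (nat \<Rightarrow> 'a set \<Rightarrow> complex)
     \<Rightarrow> ('a \<Rightarrow> complex) \<Rightarrow> bool"
where
  "besov_represents M P s p c \<psi> \<longleftrightarrow>
     (\<lambda>N. \<integral>\<^sup>+x. ennreal (cmod (\<psi> x - (\<Sum>k<N. \<Sum>Q\<in>P k. c k Q * atom M s p Q x)) powr p) \<partial>M)
       \<longlonglongrightarrow> 0"

definition coeff_finite ::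
  "(nat \<Rightarrow> 'a set set) \<Rightarrow> real \<Rightarrow> ereal \<Rightarrow> (nat \<Rightarrow> 'a set \<Rightarrow> complex) \<Rightarrow> bool"
where
  "coeff_finite P p q c \<longleftrightarrow>
     (if q = \<infinity> then bdd_above (range (\<lambda>k. (\<Sum>Q\<in>P k. cmod (c k Q) powr p) powr (1 / p)))
      else summable (\<lambda>k. (\<Sum>Q\<in>P k. cmod (c k Q) powr p) powr (real_of_ereal q / p)))"

definition coeff_norm ::
  "(nat \<Rightarrow> 'a set set) \<Rightarrow> real \<Rightarrow> ereal \<Rightarrow> (nat \<Rightarrow> 'a set \<Rightarrow> complex) \<Rightarrow> real"
where
  "coeff_norm P p q c =
     (if q = \<infinity> then (SUP k. (\<Sum>Q\<in>P k. cmod (c k Q) powr p) powr (1 / p))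
      else (\<Sum>k. (\<Sum>Q\<in>P k. cmod (c k Q) powr p) powr (real_of_ereal q / p))
             powr (1 / real_of_ereal q))"

definition besov_space ::
  "'a measure \<Rightarrow> (nat \<Rightarrow> 'a set set) \<Rightarrow> real \<Rightarrow> real \<Rightarrow> ereal \<Rightarrow> ('a \<Rightarrow> complex) set"
where
  "besov_space M P s p q =
     {\<psi> \<in> Lp_functions M p. \<exists>c. besov_represents M P s p c \<psi> \<and> coeff_finite P p q c}"

definition besov_norm ::
  "'a measure \<Rightarrow> (nat \<Rightarrow> 'a set set) \<Rightarrow> real \<Rightarrow> real \<Rightarrow> ereal \<Rightarrow> ('a \<Rightarrow> complex) \<Rightarrow> real"
where
  "besov_norm M P s p q \<psi> =
     Inf {coeff_norm P p q c | c. besov_represents M P s p c \<psi> \<and> coeff_finite P p q c}"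

text \<open>
  Below, \<open>V\<close> is a space of functions and \<open>N\<close> a norm on it, where functions that agree
  \<open>M\<close>-almost everywhere are the same vector; equality of vectors is therefore always written
  with \<open>AE\<close>.
\<close>

definition bounded_operator_on ::
  "'a measure \<Rightarrow> ('a \<Rightarrow> complex) set \<Rightarrow> (('a \<Rightarrow> complex) \<Rightarrow> real)
     \<Rightarrow> (('a \<Rightarrow> complex) \<Rightarrow> 'a \<Rightarrow> complex) \<Rightarrow> bool"
where
  "bounded_operator_on M V N T \<longleftrightarrow>
     (\<forall>u\<in>V. T u \<in> V) \<and>
     (\<forall>u\<in>V. \<forall>v\<in>V. (AE x in M. u x = v x) \<longrightarrow> (AE x in M. T u x = T v x)) \<and>
     (\<forall>u\<in>V. \<forall>v\<in>V. \<forall>a b. AE x in M. T (\<lambda>y. a * u y + b * v y) x = a * T u x + b * T v x) \<and>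
     (\<exists>C. \<forall>u\<in>V. N (T u) \<le> C * N u)"

text \<open>
  A Fredholm operator is a bounded operator with finite-dimensional kernel and a range of
  finite codimension. (On a Banach space the range is then automatically closed.)
\<close>

definition fredholm_on ::
  "'a measure \<Rightarrow> ('a \<Rightarrow> complex) set \<Rightarrow> (('a \<Rightarrow> complex) \<Rightarrow> real)
     \<Rightarrow> (('a \<Rightarrow> complex) \<Rightarrow> 'a \<Rightarrow> complex) \<Rightarrow> bool"
where
  "fredholm_on M V N T \<longleftrightarrow>
     bounded_operator_on M V N T \<and>
     (\<exists>(d::nat) e. (\<forall>i<d. e i \<in> V) \<and>
        (\<forall>u\<in>V. (AE x in M. T u x = 0) \<longrightarrow>
           (\<exists>c. AE x in M. u x = (\<Sum>i<d. c i * e i x)))) \<and>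
     (\<exists>(d::nat) e. (\<forall>i<d. e i \<in> V) \<and>
        (\<forall>v\<in>V. \<exists>u\<in>V. \<exists>c. AE x in M. v x = T u x + (\<Sum>i<d. c i * e i x)))"

definition essential_spectrum ::
  "'a measure \<Rightarrow> ('a \<Rightarrow> complex) set \<Rightarrow> (('a \<Rightarrow> complex) \<Rightarrow> real)
     \<Rightarrow> (('a \<Rightarrow> complex) \<Rightarrow> 'a \<Rightarrow> complex) \<Rightarrow> complex set"
where
  "essential_spectrum M V N T = {z. \<not> fredholm_on M V N (\<lambda>u x. z * u x - T u x)}"

text \<open>
  The radius is taken in \<open>ennreal\<close>, where the supremum always exists and is \<open>0\<close> for the empty
  set. If \<open>V\<close> is a linear space but \<open>T\<close> is not a bounded operator on it, then the essential
  spectrum is all of \<open>\<complex>\<close> and the radius is \<open>\<infinity>\<close>; so a finite upper bound on the radius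
  includes the assertion that \<open>T\<close> acts boundedly on \<open>V\<close>.
\<close>

definition essential_spectral_radius ::
  "'a measure \<Rightarrow> ('a \<Rightarrow> complex) set \<Rightarrow> (('a \<Rightarrow> complex) \<Rightarrow> real)
     \<Rightarrow> (('a \<Rightarrow> complex) \<Rightarrow> 'a \<Rightarrow> complex) \<Rightarrow> ennreal"
where
  "essential_spectral_radius M V N T = (SUP z\<in>essential_spectrum M V N T. ennreal (cmod z))"

end

(*
  The Besov norm is equivalent to the norm ||psi||_p + ||(o_k(psi))_k||_q, where o_k(psi) is the
  L^p norm of |Q_k(x)|^(-s) (psi - E_k psi)(x), with Q_k(x) the cell of level k containing x and
  E_k the average over the cells of level k. Bounded distortion and the Hoelder condition on w
  show that Phi^j (1 - E_j) has norm at most C tau_j for this norm, with C independent of j: over a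
  cell of level k the j-th iterate of Phi is a sum over the fibre of f^j, the oscillation of each
  term is inherited either from psi on a cell of level k + j or from the weight, and Hoelder's
  inequality on the fibre gives tau_j, a multiple of (sum_P |P|^(1 + s p'))^(1/p') over the cells P
  of level j. Since Phi^j E_j has finite rank, z - Phi is Fredholm as soon as C tau_j < |z|^j for
  one j, by a Neumann series for z^(-j) Phi^j (1 - E_j).
*)
theory Submission
  imports Defs
begin

section \<open>Bounds in Lebesgue and sequence spaces\<close>

text \<open>For a given z a single j is used, and how large it must be is not under control, so no
  constant in front of \<tau> may depend on j. An L^p bound on psi alone does not achieve this:
  \<open>fib_sum_bound\<close> wants psi with the weight |Q_j|^(-s), and inserting that weight by
  hand costs a factor growing with j. Subtracting E_j psi removes the cost, because what is left is
  an oscillation of level j and already carries the weight. For f^j y = x the weight |Q_k(x)|^(-s)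
  is at most a constant times |Q_j(y)|^s |Q_{j+k}(y)|^(-s). The first factor is the gain measured by
  \<tau>, the second belongs to the oscillation of psi at level j + k. The surplus of \<beta> +
  \<epsilon> over s makes the contribution of the varying weight decay geometrically in k, hence
  bounded in l^q for every q. Level 0 is exceptional throughout: the whole space need not lie in an
  image f(U_i), and the fibres over two of its points need not correspond. Functions are not
  identified almost everywhere, so the inverse of 1 - R is replaced by two statements: solvability
  through the series, and vanishing of fixed points of R.\<close>

lemma powr_ge_tangent:
  fixes t m p :: real
  assumes "1 \<le> p" "0 \<le> t" "0 < m"
  shows "m powr p + p * m powr (p - 1) * (t - m) \<le> t powr p"
proof (cases "t = 0")
  case True
  have "m powr p = m powr (p - 1) * m"
    using assms by (simp add: powr_diff)
  moreover have "m powr (p - 1) * m * 1 \<le> m powr (p - 1) * m * p"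
    using assms by (intro mult_left_mono) auto
  ultimately show ?thesis
    using True assms by (simp add: algebra_simps)
next
  case False
  then have t: "t > 0" using assms by simp
  have "t powr p - m powr p \<ge> (p * m powr (p - 1)) * (t - m)"
  proof (rule convex_on_imp_above_tangent[where A = "{0<..}"])
    show "convex_on {0<..} (\<lambda>x::real. x powr p)"
      using assms(1) by (rule powr_convex)
    have "((\<lambda>x::real. x powr p) has_real_derivative p * m powr (p - 1)) (at m)"
      using has_real_derivative_powr[OF assms(3)] .
    then show "((\<lambda>x::real. x powr p) has_real_derivative p * m powr (p - 1)) (at m within {0<..})"
      by (rule has_field_derivative_at_within)
  qed (use assms t in \<open>auto simp: interior_open\<close>)
  then show ?thesis by simp
qed

text \<open>Averaging the tangent inequality at the weighted mean m makes the linear terms cancel.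
  Both Minkowski's inequality and Hoelder's inequality on the fibres are derived from this form of
  Jensen's inequality.\<close>

lemma powr_sum_le_weighted:
  fixes t b :: "'i \<Rightarrow> real" and p :: real
  assumes "1 \<le> p" "finite S" "\<And>i. i \<in> S \<Longrightarrow> 0 \<le> t i" "\<And>i. i \<in> S \<Longrightarrow> 0 \<le> b i"
    and "sum t S = 1"
  shows "(\<Sum>i\<in>S. t i * b i) powr p \<le> (\<Sum>i\<in>S. t i * b i powr p)"
proof -
  define m where "m = (\<Sum>i\<in>S. t i * b i)"
  have m0: "m \<ge> 0" unfolding m_def using assms by (intro sum_nonneg) auto
  show ?thesis
  proof (cases "m = 0")
    case True
    then show ?thesis unfolding m_def[symmetric] using assms by (auto intro!: sum_nonneg)
  next
    case False
    then have m: "m > 0" using m0 by simp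
    have "m powr p = (\<Sum>i\<in>S. t i * (m powr p + p * m powr (p - 1) * (b i - m)))"
    proof -
      have "(\<Sum>i\<in>S. t i * (m powr p + p * m powr (p - 1) * (b i - m)))
        = (\<Sum>i\<in>S. m powr p * t i + p * m powr (p - 1) * (t i * b i) - p * m powr (p - 1) * m * t i)"
        by (intro sum.cong) (auto simp: algebra_simps)
      also have "\<dots> = m powr p * sum t S + p * m powr (p - 1) * m - p * m powr (p - 1) * m * sum t S"
        unfolding sum_subtractf sum.distrib sum_distrib_left[symmetric] m_def by simp
      finally show ?thesis using assms(5) by simp
    qed
    also have "\<dots> \<le> (\<Sum>i\<in>S. t i * b i powr p)"
      using assms m by (intro sum_mono mult_left_mono powr_ge_tangent) auto
    finally show ?thesis unfolding m_def .
  qed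
qed

text \<open>A bound on the norm is kept as an inequality between p-th powers of nonnegative
  integrals. No root of a possibly infinite integral has to be taken, and integrability is a
  consequence instead of a side condition.\<close>

definition Lp_le :: "'a measure \<Rightarrow> real \<Rightarrow> ('a \<Rightarrow> real) \<Rightarrow> real \<Rightarrow> bool" where
  "Lp_le M p g a \<longleftrightarrow> g \<in> borel_measurable M \<and> 0 \<le> a \<and>
     (\<integral>\<^sup>+x. ennreal (\<bar>g x\<bar> powr p) \<partial>M) \<le> ennreal (a powr p)"

lemma Lp_leD:
  assumes "Lp_le M p g a"
  shows "g \<in> borel_measurable M" "0 \<le> a" "(\<integral>\<^sup>+x. ennreal (\<bar>g x\<bar> powr p) \<partial>M) \<le> ennreal (a powr p)"
  using assms by (auto simp: Lp_le_def)

lemma Lp_le_mono: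
  assumes "Lp_le M p g a" "h \<in> borel_measurable M" "AE x in M. \<bar>h x\<bar> \<le> \<bar>g x\<bar>" "a \<le> b" "0 \<le> p"
  shows "Lp_le M p h b"
proof -
  have "(\<integral>\<^sup>+x. ennreal (\<bar>h x\<bar> powr p) \<partial>M) \<le> (\<integral>\<^sup>+x. ennreal (\<bar>g x\<bar> powr p) \<partial>M)"
    using assms(3) by (intro nn_integral_mono_AE) (auto elim!: eventually_mono intro!: ennreal_leI powr_mono2 assms(5))
  also have "\<dots> \<le> ennreal (a powr p)"
    using assms by (simp add: Lp_le_def)
  also have "\<dots> \<le> ennreal (b powr p)"
    using Lp_leD(2)[OF assms(1)] assms(4,5) by (intro ennreal_leI powr_mono2)
  finally show ?thesis using assms by (auto simp: Lp_le_def)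
qed

lemma Lp_le_cmult:
  assumes "Lp_le M p g a"
  shows "Lp_le M p (\<lambda>x. c * g x) (\<bar>c\<bar> * a)"
proof -
  have [measurable]: "g \<in> borel_measurable M" and a: "0 \<le> a" using assms by (auto simp: Lp_le_def)
  have "(\<integral>\<^sup>+x. ennreal (\<bar>c * g x\<bar> powr p) \<partial>M) = (\<integral>\<^sup>+x. ennreal (\<bar>c\<bar> powr p) * ennreal (\<bar>g x\<bar> powr p) \<partial>M)"
    by (intro nn_integral_cong) (simp add: abs_mult powr_mult ennreal_mult)
  also have "\<dots> = ennreal (\<bar>c\<bar> powr p) * (\<integral>\<^sup>+x. ennreal (\<bar>g x\<bar> powr p) \<partial>M)"
    by (intro nn_integral_cmult) auto
  also have "\<dots> \<le> ennreal (\<bar>c\<bar> powr p) * ennreal (a powr p)"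
    using assms by (intro mult_left_mono) (auto simp: Lp_le_def)
  also have "\<dots> = ennreal ((\<bar>c\<bar> * a) powr p)"
    using a by (simp add: powr_mult ennreal_mult)
  finally show ?thesis using a by (auto simp: Lp_le_def)
qed

lemma Lp_le_closed:
  assumes "\<And>e. e > 0 \<Longrightarrow> Lp_le M p g (a + e)" "0 \<le> a" "0 < p"
  shows "Lp_le M p g a"
proof -
  have "g \<in> borel_measurable M" using assms(1)[of 1] by (auto simp: Lp_le_def)
  moreover have "(\<integral>\<^sup>+x. ennreal (\<bar>g x\<bar> powr p) \<partial>M) \<le> ennreal (a powr p)"
  proof (rule LIMSEQ_le_const)
    have "(\<lambda>n. a + 1 / real (Suc n)) \<longlonglongrightarrow> a + 0"
      by (intro tendsto_intros LIMSEQ_inverse_real_of_nat[unfolded inverse_eq_divide])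
    then have "(\<lambda>n. (a + 1 / real (Suc n)) powr p) \<longlonglongrightarrow> a powr p"
      using assms by (intro tendsto_powr2 tendsto_const) (auto intro!: always_eventually add_nonneg_nonneg)
    then show "(\<lambda>n. ennreal ((a + 1 / real (Suc n)) powr p)) \<longlonglongrightarrow> ennreal (a powr p)"
      by (rule tendsto_ennrealI)
    show "\<exists>N. \<forall>n\<ge>N. (\<integral>\<^sup>+x. ennreal (\<bar>g x\<bar> powr p) \<partial>M) \<le> ennreal ((a + 1 / real (Suc n)) powr p)"
      using assms(1) by (auto simp: Lp_le_def)
  qed
  ultimately show ?thesis using assms by (auto simp: Lp_le_def)
qed

text \<open>Minkowski's inequality by convexity: with both functions normalised, t^p is convex along
  the weights a / (a + b) and b / (a + b). The conclusion is stated for the sum of absolute values,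
  so that monotonicity covers every function dominated by it.\<close>

lemma Lp_le_add:
  assumes g: "Lp_le M p g a" and h: "Lp_le M p h b" and p: "1 \<le> p"
  shows "Lp_le M p (\<lambda>x. \<bar>g x\<bar> + \<bar>h x\<bar>) (a + b)"
proof (rule Lp_le_closed)
  have [measurable]: "g \<in> borel_measurable M" "h \<in> borel_measurable M" and ab: "0 \<le> a" "0 \<le> b"
    using g h by (auto simp: Lp_le_def)
  show "0 \<le> a + b" "0 < p" using ab p by auto
  fix e :: real assume e: "e > 0"
  \<comment> \<open>The bounds are divided by below and may be zero; half of the slack e goes to
    each, and \<open>Lp_le_closed\<close> removes it.\<close>
  define a' b' where "a' = a + e/2" and "b' = b + e/2"
  have pos: "a' > 0" "b' > 0" using ab e by (auto simp: a'_def b'_def)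
  have le: "a \<le> a'" "b \<le> b'" using e by (auto simp: a'_def b'_def)
  define s where "s = a' + b'"
  have s: "s > 0" using pos by (simp add: s_def)
  \<comment> \<open>These are the coefficients that convexity yields for x / a' and y / b' after
    multiplication by s^p; once the integrals are inserted they add up to exactly s^p.\<close>
  define \<alpha> \<gamma> where "\<alpha> = s powr p * (a' / s) / a' powr p" and "\<gamma> = s powr p * (b' / s) / b' powr p"
  have nn: "\<alpha> \<ge> 0" "\<gamma> \<ge> 0" using pos s by (auto simp: \<alpha>_def \<gamma>_def)
  have pw: "(x + y) powr p \<le> \<alpha> * x powr p + \<gamma> * y powr p" if "x \<ge> 0" "y \<ge> 0" for x y :: real
  proof -
    have "((x + y) / s) powr p \<le> a' / s * (x / a') powr p + b' / s * (y / b') powr p"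
    proof -
      define t where "t = (\<lambda>i::bool. if i then a' / s else b' / s)"
      define c where "c = (\<lambda>i::bool. if i then x / a' else y / b')"
      have "(\<Sum>i\<in>UNIV. t i * c i) powr p \<le> (\<Sum>i\<in>UNIV. t i * c i powr p)"
        using p pos s that by (intro powr_sum_le_weighted)
          (auto simp: t_def c_def UNIV_bool s_def add_divide_distrib[symmetric])
      then show ?thesis using pos s by (simp add: t_def c_def UNIV_bool add_divide_distrib add.commute)
    qed
    then have "s powr p * ((x + y) / s) powr p \<le> s powr p * (a' / s * (x / a') powr p + b' / s * (y / b') powr p)"
      by (intro mult_left_mono) auto
    moreover have "s powr p * ((x + y) / s) powr p = (x + y) powr p"
      using s that by (simp add: powr_mult[symmetric])
    moreover have "(x / a') powr p = x powr p / a' powr p" "(y / b') powr p = y powr p / b' powr p"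
      using pos that by (auto simp: powr_divide)
    ultimately show ?thesis by (simp add: \<alpha>_def \<gamma>_def algebra_simps)
  qed
  have "(\<integral>\<^sup>+x. ennreal (\<bar>\<bar>g x\<bar> + \<bar>h x\<bar>\<bar> powr p) \<partial>M)
     \<le> (\<integral>\<^sup>+x. ennreal \<alpha> * ennreal (\<bar>g x\<bar> powr p) + ennreal \<gamma> * ennreal (\<bar>h x\<bar> powr p) \<partial>M)"
  proof (rule nn_integral_mono)
    fix x
    have "ennreal (\<bar>\<bar>g x\<bar> + \<bar>h x\<bar>\<bar> powr p) \<le> ennreal (\<alpha> * \<bar>g x\<bar> powr p + \<gamma> * \<bar>h x\<bar> powr p)"
      using pw[of "\<bar>g x\<bar>" "\<bar>h x\<bar>"] by (intro ennreal_leI) simp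
    then show "ennreal (\<bar>\<bar>g x\<bar> + \<bar>h x\<bar>\<bar> powr p)
        \<le> ennreal \<alpha> * ennreal (\<bar>g x\<bar> powr p) + ennreal \<gamma> * ennreal (\<bar>h x\<bar> powr p)"
      using nn by (simp add: ennreal_mult)
  qed
  also have "\<dots> = ennreal \<alpha> * (\<integral>\<^sup>+x. ennreal (\<bar>g x\<bar> powr p) \<partial>M) + ennreal \<gamma> * (\<integral>\<^sup>+x. ennreal (\<bar>h x\<bar> powr p) \<partial>M)"
    by (subst nn_integral_add) (auto simp: nn_integral_cmult)
  also have "\<dots> \<le> ennreal \<alpha> * ennreal (a' powr p) + ennreal \<gamma> * ennreal (b' powr p)"
    using Lp_leD(3)[OF Lp_le_mono[OF g _ _ le(1)]] Lp_leD(3)[OF Lp_le_mono[OF h _ _ le(2)]] p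
    by (intro add_mono mult_left_mono) auto
  also have "\<dots> = ennreal (\<alpha> * a' powr p + \<gamma> * b' powr p)"
    using nn by (simp add: ennreal_mult)
  also have "\<alpha> * a' powr p + \<gamma> * b' powr p = s powr p * ((a' + b') / s)"
    using pos by (simp add: \<alpha>_def \<gamma>_def algebra_simps add_divide_distrib)
  also have "\<dots> = (a + b + e) powr p"
    using s by (simp add: s_def[symmetric]) (simp add: s_def a'_def b'_def algebra_simps)
  finally show "Lp_le M p (\<lambda>x. \<bar>g x\<bar> + \<bar>h x\<bar>) (a + b + e)"
    using ab e by (auto simp: Lp_le_def)
qed

lemma Lp_le_zero: "Lp_le M p (\<lambda>x. 0) 0"
  by (simp add: Lp_le_def)

text \<open>This is Fatou's lemma, so almost everywhere convergence suffices and no dominating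
  function is asked for.\<close>

lemma Lp_le_lim:
  assumes "\<And>N::nat. Lp_le M p (g N) a" "AE x in M. (\<lambda>N. g N x) \<longlonglongrightarrow> h x" "h \<in> borel_measurable M" "0 < p"
  shows "Lp_le M p h a"
proof -
  have [measurable]: "g N \<in> borel_measurable M" for N using assms(1)[of N] by (auto simp: Lp_le_def)
  have "(\<integral>\<^sup>+x. ennreal (\<bar>h x\<bar> powr p) \<partial>M) = (\<integral>\<^sup>+x. liminf (\<lambda>N. ennreal (\<bar>g N x\<bar> powr p)) \<partial>M)"
  proof (rule nn_integral_cong_AE)
    show "AE x in M. ennreal (\<bar>h x\<bar> powr p) = liminf (\<lambda>N. ennreal (\<bar>g N x\<bar> powr p))"
      using assms(2)
    proof eventually_elim
      case (elim x)
      then have "(\<lambda>N. \<bar>g N x\<bar> powr p) \<longlonglongrightarrow> \<bar>h x\<bar> powr p"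
        using assms(4) by (intro tendsto_powr2 tendsto_rabs tendsto_const) auto
      then show ?case by (intro lim_imp_Liminf[symmetric] tendsto_ennrealI) auto
    qed
  qed
  also have "\<dots> \<le> liminf (\<lambda>N. \<integral>\<^sup>+x. ennreal (\<bar>g N x\<bar> powr p) \<partial>M)"
    by (rule nn_integral_liminf) auto
  also have "\<dots> \<le> liminf (\<lambda>N::nat. ennreal (a powr p))"
    using assms(1) by (intro Liminf_mono) (auto simp: Lp_le_def)
  also have "\<dots> = ennreal (a powr p)" by (simp add: Liminf_const)
  finally show ?thesis using assms(1)[of 0] assms(3) by (auto simp: Lp_le_def)
qed

lemma Lp_le_0_AE:
  assumes "Lp_le M p g 0" "0 < p"
  shows "AE x in M. g x = 0"
proof -
  have [measurable]: "g \<in> borel_measurable M" using assms by (auto simp: Lp_le_def)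
  have "(\<integral>\<^sup>+x. ennreal (\<bar>g x\<bar> powr p) \<partial>M) = 0" using assms by (auto simp: Lp_le_def)
  then have "AE x in M. ennreal (\<bar>g x\<bar> powr p) = 0"
    by (subst (asm) nn_integral_0_iff_AE) auto
  then show ?thesis by eventually_elim (use assms in \<open>auto simp: ennreal_eq_0_iff\<close>)
qed

text \<open>Bounding all partial sums replaces summability of the series, so the finite exponents
  and the supremum case share one predicate without convergence hypotheses.\<close>

definition lq_le :: "ereal \<Rightarrow> (nat \<Rightarrow> real) \<Rightarrow> real \<Rightarrow> bool" where
  "lq_le q a A \<longleftrightarrow> (\<forall>k. 0 \<le> a k) \<and> 0 \<le> A \<and>
     (if q = \<infinity> then \<forall>k. a k \<le> A
      else \<forall>n. (\<Sum>k<n. a k powr real_of_ereal q) \<le> A powr real_of_ereal q)"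

lemma lq_le_nonneg:
  assumes "lq_le q a A" shows "0 \<le> a k" "0 \<le> A"
  using assms by (auto simp: lq_le_def)

lemma real_of_ereal_ge_1:
  assumes "1 \<le> q" "q \<noteq> \<infinity>" shows "1 \<le> real_of_ereal q"
  using assms by (cases q) (auto simp: one_ereal_def)

lemma lq_le_single:
  assumes "lq_le q a A" "1 \<le> q" shows "a k \<le> A"
proof (cases "q = \<infinity>")
  case True
  then show ?thesis using assms by (auto simp: lq_le_def)
next
  case False
  then have r: "real_of_ereal q \<ge> 1" using assms real_of_ereal_ge_1 by blast
  have "a k powr real_of_ereal q \<le> (\<Sum>i<Suc k. a i powr real_of_ereal q)"
    by (intro member_le_sum) auto
  also have "\<dots> \<le> A powr real_of_ereal q" using assms False by (simp add: lq_le_def del: sum.lessThan_Suc)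
  finally show ?thesis using r assms lq_le_nonneg[OF assms(1)]
    by (metis less_le_trans linorder_not_less powr_less_mono2 zero_less_one)
qed

lemma lq_le_mono:
  assumes "lq_le q a A" "\<And>k. 0 \<le> b k" "\<And>k. b k \<le> a k" "A \<le> B" "1 \<le> q"
  shows "lq_le q b B"
proof (cases "q = \<infinity>")
  case True
  then show ?thesis using assms by (force simp: lq_le_def intro: order_trans)
next
  case False
  then have r: "real_of_ereal q \<ge> 1" using assms real_of_ereal_ge_1 by blast
  have "(\<Sum>k<n. b k powr real_of_ereal q) \<le> B powr real_of_ereal q" for n
  proof -
    have "(\<Sum>k<n. b k powr real_of_ereal q) \<le> (\<Sum>k<n. a k powr real_of_ereal q)"
      using assms r by (intro sum_mono powr_mono2) auto
    also have "\<dots> \<le> A powr real_of_ereal q" using assms False by (simp add: lq_le_def)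
    also have "\<dots> \<le> B powr real_of_ereal q" using assms r by (intro powr_mono2) (auto simp: lq_le_def)
    finally show ?thesis .
  qed
  then show ?thesis using assms False by (auto simp: lq_le_def)
qed

text \<open>Counting measure on initial segments makes Minkowski's inequality and homogeneity for
  sequences special cases of those for functions.\<close>

lemma lq_le_iff_Lp_le:
  assumes "1 \<le> q" "q \<noteq> \<infinity>"
  shows "lq_le q a A \<longleftrightarrow> (\<forall>k. 0 \<le> a k) \<and> 0 \<le> A \<and> (\<forall>n. Lp_le (count_space {..<n}) (real_of_ereal q) a A)"
  using assms
  by (auto simp: lq_le_def Lp_le_def nn_integral_count_space_finite sum_ennreal intro: ennreal_leI)

lemma lq_le_add:
  assumes "lq_le q a A" "lq_le q b B" "1 \<le> q"
  shows "lq_le q (\<lambda>k. a k + b k) (A + B)"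
proof (cases "q = \<infinity>")
  case True
  then show ?thesis using assms by (auto simp: lq_le_def intro!: add_mono)
next
  case False
  have "Lp_le (count_space {..<n}) (real_of_ereal q) (\<lambda>k. \<bar>a k\<bar> + \<bar>b k\<bar>) (A + B)" for n
    using assms False real_of_ereal_ge_1[OF assms(3) False]
    by (intro Lp_le_add) (auto simp: lq_le_iff_Lp_le)
  then show ?thesis
    using assms(1,2) lq_le_iff_Lp_le[OF assms(3) False] lq_le_nonneg[OF assms(1)] lq_le_nonneg[OF assms(2)] by auto
qed

lemma lq_le_cmult:
  assumes "lq_le q a A" "0 \<le> c" "1 \<le> q"
  shows "lq_le q (\<lambda>k. c * a k) (c * A)"
proof (cases "q = \<infinity>")
  case True
  then show ?thesis using assms by (auto simp: lq_le_def intro!: mult_left_mono)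
next
  case False
  have "Lp_le (count_space {..<n}) (real_of_ereal q) (\<lambda>k. c * a k) (\<bar>c\<bar> * A)" for n
    using assms False by (intro Lp_le_cmult) (auto simp: lq_le_iff_Lp_le)
  then show ?thesis
    using assms lq_le_iff_Lp_le[OF assms(3) False] by auto
qed

lemma lq_le_zero: "lq_le q (\<lambda>k. 0) 0"
  by (auto simp: lq_le_def)

lemma lq_le_sum:
  assumes "finite S" "\<And>i. i \<in> S \<Longrightarrow> lq_le q (a i) (A i)" "1 \<le> q"
  shows "lq_le q (\<lambda>k. \<Sum>i\<in>S. a i k) (\<Sum>i\<in>S. A i)"
  using assms(1,2) by (induction S) (auto simp: lq_le_zero intro!: lq_le_add assms(3))

lemma lq_le_lim:
  assumes "\<And>N::nat. lq_le q (a N) A" "\<And>k. (\<lambda>N. a N k) \<longlonglongrightarrow> b k" "1 \<le> q"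
  shows "lq_le q b A"
proof -
  have b: "0 \<le> b k" for k
    using assms(1,2) by (intro LIMSEQ_le_const[OF assms(2)]) (auto simp: lq_le_def)
  show ?thesis
  proof (cases "q = \<infinity>")
    case True
    then have "b k \<le> A" for k
      using assms(1) by (intro LIMSEQ_le_const2[OF assms(2)]) (auto simp: lq_le_def)
    then show ?thesis using b True assms(1)[of 0] by (auto simp: lq_le_def)
  next
    case False
    have r: "real_of_ereal q \<ge> 1" using assms real_of_ereal_ge_1 False by blast
    have "(\<Sum>k<n. b k powr real_of_ereal q) \<le> A powr real_of_ereal q" for n
    proof (rule LIMSEQ_le_const2)
      show "(\<lambda>N. \<Sum>k<n. a N k powr real_of_ereal q) \<longlonglongrightarrow> (\<Sum>k<n. b k powr real_of_ereal q)"
        using r lq_le_nonneg[OF assms(1)]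
        by (intro tendsto_sum tendsto_powr2 assms(2) tendsto_const always_eventually) auto
    qed (use assms(1) False in \<open>auto simp: lq_le_def\<close>)
    then show ?thesis using b False assms(1)[of 0] by (auto simp: lq_le_def)
  qed
qed

lemma lq_le_shift:
  assumes "lq_le q a A" "1 \<le> q"
  shows "lq_le q (\<lambda>k. a (k + j)) A"
proof (cases "q = \<infinity>")
  case True
  then show ?thesis using assms by (auto simp: lq_le_def)
next
  case False
  have "(\<Sum>k<n. a (k + j) powr real_of_ereal q) \<le> A powr real_of_ereal q" for n
  proof -
    have "(\<Sum>k<n. a (k + j) powr real_of_ereal q) = (\<Sum>k\<in>(\<lambda>k. k + j) ` {..<n}. a k powr real_of_ereal q)"
      by (subst sum.reindex) auto
    also have "\<dots> \<le> (\<Sum>k<n+j. a k powr real_of_ereal q)" by (intro sum_mono2) auto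
    also have "\<dots> \<le> A powr real_of_ereal q" using assms False by (auto simp: lq_le_def)
    finally show ?thesis .
  qed
  then show ?thesis using assms False by (auto simp: lq_le_def)
qed

lemma lq_le_delta:
  assumes "0 \<le> c" "1 \<le> q"
  shows "lq_le q (\<lambda>k. if k = m then c else 0) c"
proof -
  have "(\<Sum>k<n. (if k = m then c else 0) powr r) \<le> c powr r" for n and r :: real
  proof -
    have "(\<Sum>k<n. (if k = m then c else 0) powr r) = (\<Sum>k<n. if k = m then c powr r else 0)"
      by (intro sum.cong) auto
    then show ?thesis by (simp add: sum.delta)
  qed
  then show ?thesis using assms by (auto simp: lq_le_def)
qed

text \<open>Each entry is at most the bound of its sequence, which gives convergence entry by entry;
  the bound itself passes from the finite sums to the limit.\<close>

lemma lq_le_suminf: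
  assumes "\<And>m::nat. lq_le q (a m) (A m)" "summable A" "1 \<le> q"
  shows "lq_le q (\<lambda>k. \<Sum>m. a m k) (\<Sum>m. A m)" "summable (\<lambda>m. a m k)"
proof -
  have nn: "0 \<le> a m k" "0 \<le> A m" for m k using lq_le_nonneg[OF assms(1)] by auto
  show sm: "summable (\<lambda>m. a m k)" for k
    using assms lq_le_single[OF assms(1,3)] nn
    by (intro summable_comparison_test[OF _ assms(2)] exI[of _ 0]) auto
  show "lq_le q (\<lambda>k. \<Sum>m. a m k) (\<Sum>m. A m)"
  proof (rule lq_le_lim[OF _ _ assms(3)])
    show "lq_le q (\<lambda>k. \<Sum>m<N. a m k) (\<Sum>m. A m)" for N
      by (rule lq_le_mono[OF lq_le_sum[of "{..<N}" q a A]])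
        (auto intro!: assms sum_nonneg nn sum_le_suminf)
    show "(\<lambda>N. \<Sum>m<N. a m k) \<longlonglongrightarrow> (\<Sum>m. a m k)" for k
      using sm summable_LIMSEQ by blast
  qed
qed

text \<open>A discrete Hardy inequality: the sequence is a sum of left shifts, a shift does not
  increase the norm, and the i-th one is damped by \<theta>^i. It controls the tails of an atomic
  series.\<close>

lemma lq_le_geometric_shifts:
  assumes "lq_le q a A" "0 \<le> \<theta>" "\<theta> < 1" "1 \<le> q"
  shows "lq_le q (\<lambda>k. \<Sum>i. \<theta> ^ i * a (k + i)) (A / (1 - \<theta>))" "summable (\<lambda>i. \<theta> ^ i * a (k + i))"
proof -
  have l: "lq_le q (\<lambda>k. \<theta> ^ i * a (k + i)) (\<theta> ^ i * A)" for i
    using assms by (intro lq_le_cmult lq_le_shift) auto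
  have s: "summable (\<lambda>i. \<theta> ^ i * A)" using assms by (intro summable_mult2 summable_geometric) auto
  have "(\<Sum>i. \<theta> ^ i * A) = A / (1 - \<theta>)"
    using assms by (subst suminf_mult2[symmetric]) (auto simp: suminf_geometric summable_geometric)
  then show "lq_le q (\<lambda>k. \<Sum>i. \<theta> ^ i * a (k + i)) (A / (1 - \<theta>))"
    using lq_le_suminf(1)[OF l s assms(4)] by simp
  show "summable (\<lambda>i. \<theta> ^ i * a (k + i))" by (rule lq_le_suminf(2)[OF l s assms(4)])
qed

text \<open>Decomposing into multiples of unit sequences gives a bound that is the same for all q,
  including infinity.\<close>

lemma lq_le_geometric:
  assumes "0 \<le> \<theta>" "\<theta> < 1" "1 \<le> q"
  shows "lq_le q (\<lambda>k. \<theta> ^ k) (1 / (1 - \<theta>))"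
proof -
  have l: "lq_le q (\<lambda>k. \<theta> ^ m * (if k = m then 1 else 0)) (\<theta> ^ m * 1)" for m
    by (rule lq_le_cmult[OF lq_le_delta]) (use assms in auto)
  have "lq_le q (\<lambda>k. \<Sum>m. \<theta> ^ m * (if k = m then 1 else 0)) (\<Sum>m. \<theta> ^ m * 1)"
    by (rule lq_le_suminf(1)[OF l]) (use assms in \<open>auto intro!: summable_geometric\<close>)
  moreover have "(\<Sum>m. \<theta> ^ m * (if k = m then 1 else 0)) = \<theta> ^ k" for k
  proof -
    have "(\<lambda>m. if m = k then \<theta> ^ m else 0) sums \<theta> ^ k" by (rule sums_single)
    moreover have "(\<lambda>m. if m = k then \<theta> ^ m else 0) = (\<lambda>m. \<theta> ^ m * (if k = m then 1 else 0))" by auto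
    ultimately show ?thesis by (simp add: sums_iff)
  qed
  ultimately show ?thesis using assms by (simp add: suminf_geometric)
qed

lemma lq_le_cons:
  assumes "lq_le q a A"
  shows "lq_le q (\<lambda>k. case k of 0 \<Rightarrow> 0 | Suc m \<Rightarrow> a m) A"
proof -
  have "(\<Sum>k<n. (case k of 0 \<Rightarrow> 0 | Suc m \<Rightarrow> a m) powr r) \<le> (\<Sum>k<n. a k powr r)" for n and r :: real
  proof (cases n)
    case (Suc l)
    have "(\<Sum>k<Suc l. (case k of 0 \<Rightarrow> 0 | Suc m \<Rightarrow> a m) powr r) = (\<Sum>k<l. a k powr r)"
      by (simp add: sum.lessThan_Suc_shift del: sum.lessThan_Suc)
    then show ?thesis using Suc by simp
  qed simp
  note le = order_trans[OF this]
  have "(case k of 0 \<Rightarrow> 0 | Suc m \<Rightarrow> a m) \<le> A" if "q = \<infinity>" for k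
    using assms that by (auto simp: lq_le_def split: nat.split)
  then show ?thesis using assms le unfolding lq_le_def by (auto split: nat.split)
qed

text \<open>A lower limit controls only infinitely many j, which is enough because the Fredholm
  property follows from one good j.\<close>

lemma exponent_less_of_liminf_less:
  fixes t :: "nat \<Rightarrow> real"
  assumes "liminf (\<lambda>j. ennreal (t j powr (1 / real j))) < ennreal y" "\<And>j. 0 \<le> t j"
  obtains r where "0 \<le> r" "r < y" "\<exists>\<^sub>F j in sequentially. t j \<le> r ^ j"
proof -
  \<comment> \<open>A value strictly in between is taken so that r stays strictly below y.\<close>
  obtain e where e: "liminf (\<lambda>j. ennreal (t j powr (1 / real j))) < e" "e < ennreal y"
    using dense[OF assms(1)] by blast
  obtain r where r: "0 \<le> r" "e = ennreal r"
    using e(2) by (cases e) auto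
  have "\<exists>\<^sub>F j in sequentially. ennreal (t j powr (1 / real j)) < e"
  proof (rule ccontr)
    assume "\<not> ?thesis"
    then have "eventually (\<lambda>j. e \<le> ennreal (t j powr (1 / real j))) sequentially"
      by (simp add: not_frequently not_less)
    then have "e \<le> liminf (\<lambda>j. ennreal (t j powr (1 / real j)))" by (rule Liminf_bounded)
    then show False using e(1) by simp
  qed
  moreover have "eventually (\<lambda>j. 0 < j) sequentially" by (rule eventually_gt_at_top)
  ultimately have "\<exists>\<^sub>F j in sequentially. ennreal (t j powr (1 / real j)) < e \<and> 0 < j"
    by (rule frequently_eventually_frequently)
  then have "\<exists>\<^sub>F j in sequentially. t j \<le> r ^ j"
  proof (rule frequently_elim1)
    fix j assume j: "ennreal (t j powr (1 / real j)) < e \<and> 0 < j"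
    then have "t j powr (1 / real j) \<le> r" using r by (simp add: ennreal_less_iff)
    then have "(t j powr (1 / real j)) ^ j \<le> r ^ j" by (intro power_mono) auto
    moreover have "(t j powr (1 / real j)) ^ j = t j"
    proof (cases "t j = 0")
      case False
      then have "0 < t j" using assms(2)[of j] by simp
      moreover from this have "(t j powr (1 / real j)) ^ j = (t j powr (1 / real j)) powr real j"
        by (simp add: powr_realpow)
      ultimately show ?thesis using j by (simp add: powr_powr)
    qed (use j in auto)
    ultimately show "t j \<le> r ^ j" by simp
  qed
  moreover have "r < y" using e(2) r by (simp add: ennreal_less_iff)
  ultimately show thesis using that r(1) by blast
qed

section \<open>Cylinders and fibres of a Markovian expanding map\<close>

context markovian_expanding_map
begin

abbreviation grid :: "nat \<Rightarrow> 'a set set" where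
  "grid \<equiv> dynamical_grid M n U f"

abbreviation h :: "nat \<Rightarrow> 'a \<Rightarrow> 'a" where
  "h i \<equiv> branch_inverse U f i"

definition D :: "'a set" where
  "D = (\<Union>i\<in>{1..n}. U i)"

definition infw :: real where
  "infw = (INF x\<in>D. w x)"

definition contr :: real where
  "contr = 1 / infw"

lemma D_I: "i \<in> {1..n} \<Longrightarrow> x \<in> U i \<Longrightarrow> x \<in> D"
  by (auto simp: D_def)

lemma D_E: "x \<in> D \<Longrightarrow> (\<And>i. i \<in> {1..n} \<Longrightarrow> x \<in> U i \<Longrightarrow> thesis) \<Longrightarrow> thesis"
  by (auto simp: D_def)

lemma sets_D [measurable]: "D \<in> sets M"
  unfolding D_def using B_measurable by auto

lemma D_subset: "D \<subseteq> space M"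
  using sets_D by (rule sets.sets_into_space)

lemma AE_D: "AE x in M. x \<in> D"
proof (rule AE_I)
  show "{x \<in> space M. x \<notin> D} \<subseteq> space M - D" by auto
  show "emeasure M (space M - D) = 0"
    using B_cover by (simp add: D_def emeasure_eq_measure)
qed simp

lemma U_nonempty: "i \<in> {1..n} \<Longrightarrow> U i \<noteq> {}"
  using B_pos by fastforce

lemma D_nonempty: "D \<noteq> {}"
  using U_nonempty[of 1] n_ge_2 by (auto simp: D_def)

lemma U_unique: "i \<in> {1..n} \<Longrightarrow> j \<in> {1..n} \<Longrightarrow> x \<in> U i \<Longrightarrow> x \<in> U j \<Longrightarrow> i = j"
  using A_disjoint unfolding disjoint_family_on_def by blast

lemma U_transfer: "i \<in> {1..n} \<Longrightarrow> l \<in> {1..n} \<Longrightarrow> x \<in> U i \<Longrightarrow> x \<in> U l \<Longrightarrow> y \<in> U l \<Longrightarrow> y \<in> U i"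
  using U_unique by metis

lemma infw_gt_1: "infw > 1"
  using C_expanding by (simp add: infw_def D_def)

lemma infw_le_w: "x \<in> D \<Longrightarrow> infw \<le> w x"
proof -
  obtain C where "C > 0" "\<forall>x\<in>D. 1 / C \<le> w x" using E_bounded by (auto simp: D_def)
  then have "bdd_below (w ` D)" by (auto intro!: bdd_belowI)
  then show "x \<in> D \<Longrightarrow> infw \<le> w x" unfolding infw_def by (rule cINF_lower)
qed

lemma w_gt_1: "x \<in> D \<Longrightarrow> 1 < w x"
  using infw_le_w[of x] infw_gt_1 by simp

lemma contr_bounds: "0 < contr" "contr < 1"
  using infw_gt_1 by (auto simp: contr_def)

text \<open>By (D) the image f(U_i) is exactly a union of sets U_j, not merely up to a null set.
  Hence all iterates are defined at every point of \<open>D\<close>, and arguments along orbits can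
  be pointwise.\<close>

lemma f_in_D: "x \<in> D \<Longrightarrow> f x \<in> D"
proof (elim D_E)
  fix i assume i: "i \<in> {1..n}" "x \<in> U i"
  then obtain J where "J \<subseteq> {1..n}" "f ` U i = (\<Union>j\<in>J. U j)" using D_markov by blast
  then show "f x \<in> D" using i(2) by (force simp: D_def)
qed

lemma iter_in_D: "x \<in> D \<Longrightarrow> (f ^^ k) x \<in> D"
  by (induction k) (auto intro: f_in_D)

text \<open>The image is a union of whole sets U_j and these are disjoint, so one point of U_l in
  the image brings all of U_l with it.\<close>

lemma markov_image:
  assumes "i \<in> {1..n}" "l \<in> {1..n}" "x \<in> U i" "f x \<in> U l"
  shows "U l \<subseteq> f ` U i"
proof -
  obtain J where J: "J \<subseteq> {1..n}" "f ` U i = (\<Union>j\<in>J. U j)" using D_markov[OF assms(1)] by blast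
  then obtain j where "j \<in> J" "f x \<in> U j" using assms(3) by blast
  then show ?thesis using U_unique[of j l "f x"] J assms by blast
qed

lemma h_in: "i \<in> {1..n} \<Longrightarrow> x \<in> f ` U i \<Longrightarrow> h i x \<in> U i"
  by (rule the_inv_into_into[OF C_inj]) auto

lemma f_h: "i \<in> {1..n} \<Longrightarrow> x \<in> f ` U i \<Longrightarrow> f (h i x) = x"
  by (rule f_the_inv_into_f[OF C_inj])

lemma h_f: "i \<in> {1..n} \<Longrightarrow> x \<in> U i \<Longrightarrow> h i (f x) = x"
  by (rule the_inv_into_f_f[OF C_inj])

text \<open>Equality of itineraries of length k. With cells described as classes of this relation,
  refinement and the action of f become shifts of the time index, and the recursion of the grid is
  needed only in \<open>grid_eq\<close>, for finiteness and for level 1.\<close>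

definition same :: "nat \<Rightarrow> 'a \<Rightarrow> 'a \<Rightarrow> bool" where
  "same k x y \<longleftrightarrow> (\<forall>i<k. \<exists>l\<in>{1..n}. (f ^^ i) x \<in> U l \<and> (f ^^ i) y \<in> U l)"

text \<open>
  For \<open>x\<close> in \<open>D\<close> the set \<open>cyl k x\<close> is the element of the grid of level \<open>k\<close> containing \<open>x\<close>;
  it is contained in \<open>D\<close> only for \<open>k \<ge> 1\<close>, since \<open>cyl 0 x\<close> is the whole space.
\<close>

definition cyl :: "nat \<Rightarrow> 'a \<Rightarrow> 'a set" where
  "cyl k x = {y \<in> space M. same k x y}"

definition cyl_meas :: "nat \<Rightarrow> 'a \<Rightarrow> real" where
  "cyl_meas k x = measure M (cyl k x)"

lemma same_refl: "x \<in> D \<Longrightarrow> same k x x"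
  using iter_in_D[of x] unfolding same_def D_def by blast

lemma same_sym: "same k x y \<Longrightarrow> same k y x"
  unfolding same_def by blast

lemma same_trans: "same k x y \<Longrightarrow> same k y z \<Longrightarrow> same k x z"
  unfolding same_def using U_unique by blast

lemma same_0 [simp]: "same 0 x y"
  by (simp add: same_def)

lemma same_1: "same (Suc 0) x y \<longleftrightarrow> (\<exists>l\<in>{1..n}. x \<in> U l \<and> y \<in> U l)"
  by (simp add: same_def)

lemma same_add: "same (j + k) x y \<longleftrightarrow> same j x y \<and> same k ((f ^^ j) x) ((f ^^ j) y)"
proof -
  have "same (j + k) x y" if a: "same j x y" and b: "same k ((f ^^ j) x) ((f ^^ j) y)"
    unfolding same_def
  proof (intro allI impI)
    fix i assume i: "i < j + k"
    show "\<exists>l\<in>{1..n}. (f ^^ i) x \<in> U l \<and> (f ^^ i) y \<in> U l"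
    proof (cases "i < j")
      case True
      then show ?thesis using a by (simp add: same_def)
    next
      case False
      then have "(f ^^ i) z = (f ^^ (i - j)) ((f ^^ j) z)" for z
        by (metis comp_apply funpow_add le_add_diff_inverse2 linorder_not_less)
      then show ?thesis using b i False by (auto simp: same_def)
    qed
  qed
  moreover have "same k ((f ^^ j) x) ((f ^^ j) y)" if a: "same (j + k) x y"
    unfolding same_def
  proof (intro allI impI)
    fix i assume "i < k"
    then have "i + j < j + k" by simp
    then have "\<exists>l\<in>{1..n}. (f ^^ (i + j)) x \<in> U l \<and> (f ^^ (i + j)) y \<in> U l"
      using a unfolding same_def by blast
    then show "\<exists>l\<in>{1..n}. (f ^^ i) ((f ^^ j) x) \<in> U l \<and> (f ^^ i) ((f ^^ j) y) \<in> U l"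
      by (simp add: funpow_add)
  qed
  ultimately show ?thesis by (auto simp: same_def)
qed

lemma same_Suc: "same (Suc k) x y \<longleftrightarrow> same (Suc 0) x y \<and> same k (f x) (f y)"
  using same_add[of "Suc 0" k x y] by simp

lemma same_mono: "same k x y \<Longrightarrow> j \<le> k \<Longrightarrow> same j x y"
  by (auto simp: same_def)

lemma same_in_D: "same k x y \<Longrightarrow> 1 \<le> k \<Longrightarrow> y \<in> D"
  unfolding same_def D_def by (auto dest!: spec[of _ 0])

lemma cyl_self: "x \<in> D \<Longrightarrow> x \<in> cyl k x"
  using same_refl D_subset by (auto simp: cyl_def)

lemma cyl_0: "cyl 0 x = space M"
  by (simp add: cyl_def)

lemma cyl_1: "i \<in> {1..n} \<Longrightarrow> x \<in> U i \<Longrightarrow> cyl (Suc 0) x = U i"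
  using U_transfer D_subset D_I unfolding cyl_def same_1 by blast

lemma cyl_eq: "same k x y \<Longrightarrow> cyl k x = cyl k y"
  unfolding cyl_def using same_trans same_sym by blast

lemma cyl_subset: "x \<in> D \<Longrightarrow> j \<le> k \<Longrightarrow> cyl k x \<subseteq> cyl j x"
  by (auto simp: cyl_def intro: same_mono)

lemma cyl_Suc:
  assumes "i \<in> {1..n}" "x \<in> U i"
  shows "cyl (Suc k) x = {y \<in> U i. f y \<in> cyl k (f x)}"
proof -
  have "y \<in> U i" if "same (Suc 0) x y" for y using that U_transfer assms unfolding same_1 by blast
  moreover have "y \<in> U i \<Longrightarrow> y \<in> D \<and> f y \<in> D" for y using assms D_I f_in_D by blast
  moreover have "y \<in> U i \<Longrightarrow> same (Suc 0) x y" for y using assms by (auto simp: same_1)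
  ultimately show ?thesis unfolding cyl_def same_Suc[of k x] using D_subset by blast
qed

lemma cyl_Suc_image:
  assumes "i \<in> {1..n}" "x \<in> U i"
  shows "f ` cyl (Suc k) x = cyl k (f x) \<inter> f ` U i"
    and "cyl (Suc k) x = h i ` (cyl k (f x) \<inter> f ` U i)"
proof -
  show a: "f ` cyl (Suc k) x = cyl k (f x) \<inter> f ` U i" unfolding cyl_Suc[OF assms] by auto
  have "h i ` (f ` cyl (Suc k) x) = cyl (Suc k) x"
  proof -
    have "y \<in> cyl (Suc k) x \<Longrightarrow> h i (f y) = y" for y
      using cyl_Suc[OF assms] h_f[OF assms(1)] by auto
    then show ?thesis by (force simp: image_image)
  qed
  then show "cyl (Suc k) x = h i ` (cyl k (f x) \<inter> f ` U i)" by (simp add: a)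
qed

text \<open>The Markov property enters through the first symbol of f x, so the level must be
  positive; the cell of level 0 is the whole space, which an image need not contain.\<close>

lemma cyl_image_subset:
  assumes "i \<in> {1..n}" "x \<in> U i"
  shows "cyl (Suc k) (f x) \<subseteq> f ` U i"
proof -
  obtain l where l: "l \<in> {1..n}" "f x \<in> U l" using f_in_D D_I assms by (blast elim: D_E)
  then have "cyl (Suc k) (f x) \<subseteq> U l" using cyl_Suc by auto
  then show ?thesis using markov_image[OF assms(1) l(1) assms(2) l(2)] by auto
qed

text \<open>Pulling a cell back along the branch h_i prepends the symbol i to its itinerary. The
  restriction to cells inside f(U_i) loses nothing, because a cell of positive level that meets the
  image lies in it.\<close>

lemma grid_eq: "grid k = cyl k ` D"
proof (cases k)
  case 0
  then show ?thesis using D_nonempty by (auto simp: cyl_0)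
next
  case (Suc j)
  have "grid (Suc j) = cyl (Suc j) ` D"
  proof (induction j)
    case 0
    have "U i \<in> cyl (Suc 0) ` D" if "i \<in> {1..n}" for i
      using U_nonempty[OF that] cyl_1[OF that] D_I[OF that] by (metis ex_in_conv image_eqI)
    then show ?case using cyl_1 by (auto elim!: D_E)
  next
    case (Suc j)
    have "A \<in> cyl (Suc (Suc j)) ` D"
      if A: "i \<in> {1..n}" "z \<in> D" "cyl (Suc j) z \<subseteq> f ` U i" "A = h i ` cyl (Suc j) z" for A i z
    proof -
      have z: "z \<in> f ` U i" using cyl_self A by blast
      define x where "x = h i z"
      have x: "x \<in> U i" "f x = z" using h_in f_h A(1) z by (auto simp: x_def)
      have "cyl (Suc (Suc j)) x = A"
        using cyl_Suc_image(2)[OF A(1) x(1), of "Suc j"] A x by (simp add: Int_absorb2)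
      then show ?thesis using D_I[OF A(1) x(1)] by auto
    qed
    moreover have "\<exists>i Q. cyl (Suc (Suc j)) x = h i ` Q \<and> i \<in> {1..n} \<and> Q \<in> grid (Suc j) \<and> Q \<subseteq> f ` U i"
      if x: "x \<in> D" for x
    proof -
      obtain i where i: "i \<in> {1..n}" "x \<in> U i" using x by (rule D_E)
      have "cyl (Suc j) (f x) \<subseteq> f ` U i" using cyl_image_subset[OF i] .
      then show ?thesis
        using cyl_Suc_image(2)[OF i, of "Suc j"] i f_in_D[OF x] Suc
        by (intro exI[of _ i] exI[of _ "cyl (Suc j) (f x)"]) (auto simp: Int_absorb2)
    qed
    ultimately show ?case unfolding dynamical_grid.simps(3) unfolding Suc by blast
  qed
  then show ?thesis using Suc by simp
qed

lemma finite_grid: "finite (grid k)"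
proof (cases k)
  case (Suc j)
  have "finite (grid (Suc j))"
  proof (induction j)
    case (Suc j)
    have "grid (Suc (Suc j)) \<subseteq> (\<lambda>(i, Q). h i ` Q) ` ({1..n} \<times> grid (Suc j))" by auto
    then show ?case using Suc by (meson finite_SigmaI finite_atLeastAtMost finite_imageI finite_subset)
  qed simp
  then show ?thesis using Suc by simp
qed simp

lemma grid_cyl: "x \<in> D \<Longrightarrow> cyl k x \<in> grid k"
  by (simp add: grid_eq)

lemma grid_member: "Q \<in> grid k \<Longrightarrow> x \<in> Q \<Longrightarrow> x \<in> D \<Longrightarrow> cyl k x = Q"
  by (auto simp: grid_eq cyl_def intro!: cyl_eq[unfolded cyl_def, symmetric])

section \<open>Measurability, contraction and positive measure of the cells\<close>

lemma sets_preimage: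
  assumes "i \<in> {1..n}" "A \<in> sets M"
  shows "{y \<in> U i. f y \<in> A} \<in> sets M"
proof -
  have "A \<inter> f ` U i \<in> sets (restrict_space M (f ` U i))"
    using assms C_image by (auto simp: sets_restrict_space)
  from measurable_sets[OF C_measurable[OF assms(1)] this]
  have "f -` (A \<inter> f ` U i) \<inter> U i \<in> sets (restrict_space M (U i))"
    using B_measurable[OF assms(1), THEN sets.sets_into_space]
    by (simp add: space_restrict_space Int_absorb2 Int_absorb1)
  then have "f -` (A \<inter> f ` U i) \<inter> U i \<in> sets M"
    using B_measurable[OF assms(1)] by (subst (asm) sets_restrict_space_iff) auto
  moreover have "f -` (A \<inter> f ` U i) \<inter> U i = {y \<in> U i. f y \<in> A}" by auto
  ultimately show ?thesis by simp
qed

lemma sets_cyl [measurable]: "x \<in> D \<Longrightarrow> cyl k x \<in> sets M"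
proof (induction k arbitrary: x)
  case (Suc k)
  from Suc.prems obtain i where i: "i \<in> {1..n}" "x \<in> U i" by (rule D_E)
  show ?case unfolding cyl_Suc[OF i] using sets_preimage[OF i(1) Suc.IH[OF f_in_D[OF Suc.prems]]] .
qed (simp add: cyl_0)

lemma sets_grid: "Q \<in> grid k \<Longrightarrow> Q \<in> sets M"
  using sets_cyl by (auto simp: grid_eq)

lemma w_measurable:
  assumes "A \<subseteq> D" shows "w \<in> borel_measurable (restrict_space M A)"
  using C_w_measurable unfolding D_def[symmetric] by (rule measurable_restrict_mono) (rule assms)

lemma expansion:
  assumes "i \<in> {1..n}" "A \<in> sets M" "A \<subseteq> U i"
  shows "ennreal infw * emeasure M A \<le> emeasure M (f ` A)"
proof -
  have "ennreal infw * emeasure M A = (\<integral>\<^sup>+x. ennreal infw * indicator A x \<partial>M)"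
    using assms by (simp add: nn_integral_cmult_indicator)
  also have "\<dots> \<le> (\<integral>\<^sup>+x. ennreal (w x) * indicator A x \<partial>M)"
    using assms infw_le_w D_I by (intro nn_integral_mono) (auto split: split_indicator intro!: ennreal_leI)
  finally show ?thesis using C_jacobian[OF assms] by simp
qed

lemma cyl_meas_Suc_le:
  assumes "x \<in> D" shows "cyl_meas (Suc k) x \<le> contr * cyl_meas k (f x)"
proof -
  obtain i where i: "i \<in> {1..n}" "x \<in> U i" using assms by (rule D_E)
  have "ennreal infw * emeasure M (cyl (Suc k) x) \<le> emeasure M (f ` cyl (Suc k) x)"
    using cyl_Suc[OF i] by (intro expansion[OF i(1)] sets_cyl assms) auto
  also have "\<dots> \<le> emeasure M (cyl k (f x))"
    using cyl_Suc_image(1)[OF i] sets_cyl f_in_D assms by (intro emeasure_mono) auto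
  finally have "infw * cyl_meas (Suc k) x \<le> cyl_meas k (f x)"
    using infw_gt_1 by (simp add: emeasure_eq_measure cyl_meas_def ennreal_mult[symmetric])
  then show ?thesis using infw_gt_1 by (simp add: contr_def field_simps)
qed

lemma cyl_meas_nonneg [simp]: "0 \<le> cyl_meas k x"
  by (simp add: cyl_meas_def)

lemma cyl_meas_le_1: "cyl_meas k x \<le> 1"
  by (simp add: cyl_meas_def)

lemma cyl_meas_contract:
  assumes "x \<in> D" shows "cyl_meas (j + k) x \<le> contr ^ j * cyl_meas k ((f ^^ j) x)"
  using assms
proof (induction j arbitrary: x)
  case (Suc j)
  have "cyl_meas (Suc j + k) x \<le> contr * cyl_meas (j + k) (f x)"
    using cyl_meas_Suc_le[OF Suc.prems] by simp
  also have "\<dots> \<le> contr * (contr ^ j * cyl_meas k ((f ^^ j) (f x)))"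
    using Suc contr_bounds f_in_D by (intro mult_left_mono) auto
  finally show ?case by (simp add: funpow_swap1)
qed simp

lemma cyl_meas_le_power: "x \<in> D \<Longrightarrow> cyl_meas k x \<le> contr ^ k"
  using cyl_meas_contract[of x k 0] prob_space by (simp add: cyl_meas_def cyl_0)

text \<open>If a cell were null, the Jacobian formula would make its image null, yet the image is a
  full cell of the previous level.\<close>

lemma cyl_meas_pos: "x \<in> D \<Longrightarrow> 0 < cyl_meas k x"
proof (induction k arbitrary: x)
  case 0
  then show ?case using prob_space by (simp add: cyl_meas_def cyl_0)
next
  case (Suc k)
  from Suc.prems obtain i where i: "i \<in> {1..n}" "x \<in> U i" by (rule D_E)
  show ?case
  \<comment> \<open>For k = 0 the image is only f(U_i) and not the cell of level 0; here
    \<open>B_pos\<close> decides directly.\<close>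
  proof (cases k)
    case 0
    then show ?thesis using cyl_1[OF i] B_pos[OF i(1)] by (simp add: cyl_meas_def)
  next
    case (Suc l)
    have im: "f ` cyl (Suc k) x = cyl k (f x)"
      using cyl_Suc_image(1)[OF i] cyl_image_subset[OF i] Suc by blast
    have "cyl_meas (Suc k) x \<noteq> 0"
    proof
      assume "cyl_meas (Suc k) x = 0"
      then have "emeasure M (cyl (Suc k) x) = 0" by (simp add: cyl_meas_def emeasure_eq_measure)
      then have "AE x' in M. x' \<notin> cyl (Suc k) x"
        using sets_cyl[OF Suc.prems] by (intro AE_not_in) auto
      then have "(\<integral>\<^sup>+x'. ennreal (w x') * indicator (cyl (Suc k) x) x' \<partial>M) = (\<integral>\<^sup>+x'. 0 \<partial>M)"
        by (intro nn_integral_cong_AE) (auto elim!: eventually_mono)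
      then have "emeasure M (cyl k (f x)) = 0"
        using C_jacobian[OF i(1) sets_cyl[OF Suc.prems], of "Suc k"] cyl_Suc[OF i] im by auto
      then show False using Suc.IH[OF f_in_D[OF Suc.prems]] by (simp add: cyl_meas_def emeasure_eq_measure)
    qed
    then show ?thesis by (simp add: order_less_le)
  qed
qed

lemma cyl_meas_mono: "x \<in> D \<Longrightarrow> j \<le> k \<Longrightarrow> cyl_meas k x \<le> cyl_meas j x"
  unfolding cyl_meas_def by (intro finite_measure_mono cyl_subset sets_cyl)

definition minU :: real where
  "minU = Min ((\<lambda>i. measure M (U i)) ` {1..n})"

lemma minU_pos: "0 < minU"
  unfolding minU_def using n_ge_2 B_pos by (subst Min_gr_iff) auto

lemma minU_le: "x \<in> D \<Longrightarrow> minU \<le> cyl_meas (Suc 0) x"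
  unfolding minU_def cyl_meas_def by (auto elim!: D_E simp: cyl_1)

subsection \<open>Sums over the fibres of the iterates\<close>

text \<open>The fibre of the j-th iterate is used as a finite set of points, which avoids indexing
  the inverse branches of f^j by words and tracking their domains.\<close>

definition fib :: "nat \<Rightarrow> 'a \<Rightarrow> 'a set" where
  "fib j x = {y \<in> D. (f ^^ j) y = x}"

definition G :: "nat \<Rightarrow> 'a \<Rightarrow> real" where
  "G j y = (\<Prod>i<j. 1 / w ((f ^^ i) y))"

text \<open>The value type is left open so that one computation of iterates serves both the complex
  transfer operator and its counterpart on nonnegative extended functions, where integrals need no
  integrability.\<close>

definition branch_sum :: "('a \<Rightarrow> 'b::comm_semiring_1) \<Rightarrow> ('a \<Rightarrow> 'b) \<Rightarrow> 'a \<Rightarrow> 'b" where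
  "branch_sum c H x = (\<Sum>i | i \<in> {1..n} \<and> x \<in> f ` U i. c (h i x) * H (h i x))"

lemma fib_1_eq: "fib (Suc 0) x = (\<lambda>i. h i x) ` {i \<in> {1..n}. x \<in> f ` U i}"
proof (intro set_eqI iffI)
  fix y assume "y \<in> fib (Suc 0) x"
  then have y: "y \<in> D" "f y = x" by (auto simp: fib_def)
  then obtain i where i: "i \<in> {1..n}" "y \<in> U i" by (auto elim: D_E)
  then have "y = h i x" "x \<in> f ` U i" using y h_f by auto
  then show "y \<in> (\<lambda>i. h i x) ` {i \<in> {1..n}. x \<in> f ` U i}" using i by blast
next
  fix y assume "y \<in> (\<lambda>i. h i x) ` {i \<in> {1..n}. x \<in> f ` U i}"
  then show "y \<in> fib (Suc 0) x" using h_in f_h D_I by (auto simp: fib_def)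
qed

lemma branch_sum_fib: "branch_sum c H x = (\<Sum>y\<in>fib (Suc 0) x. c y * H y)"
proof -
  have "inj_on (\<lambda>i. h i x) {i \<in> {1..n}. x \<in> f ` U i}"
    by (rule inj_onI) (metis (no_types, lifting) U_unique h_in mem_Collect_eq)
  then show ?thesis unfolding branch_sum_def fib_1_eq by (subst sum.reindex) auto
qed

lemma fib_0: "fib 0 x = (if x \<in> D then {x} else {})"
  by (auto simp: fib_def)

lemma fib_outside: "x \<notin> D \<Longrightarrow> fib j x = {}"
  using iter_in_D by (auto simp: fib_def)

lemma fib_Suc: "fib (Suc j) x = (\<Union>z\<in>fib j x. fib (Suc 0) z)"
  using f_in_D by (auto simp: fib_def funpow_swap1)

lemma finite_fib: "finite (fib j x)"
proof (induction j)
  case 0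
  then show ?case by (simp add: fib_0)
next
  case (Suc j)
  have "finite (fib (Suc 0) z)" for z unfolding fib_1_eq by simp
  then show ?case using Suc unfolding fib_Suc[of j] by blast
qed

lemma sum_fib_Suc: "(\<Sum>y\<in>fib (Suc j) x. g y) = (\<Sum>z\<in>fib j x. \<Sum>y\<in>fib (Suc 0) z. g y)"
  unfolding fib_Suc[of j]
proof (rule sum.UNION_disjoint)
  show "\<forall>z\<in>fib j x. \<forall>z'\<in>fib j x. z \<noteq> z' \<longrightarrow> fib (Suc 0) z \<inter> fib (Suc 0) z' = {}"
    by (auto simp: fib_def)
qed (use finite_fib in blast)+

text \<open>The hypothesis on x concerns j = 0: outside \<open>D\<close> the fibre is empty while
  the zeroth iterate is H itself. The induction generalises H because the new factor is applied
  innermost.\<close>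

lemma branch_sum_pow:
  assumes "x \<in> D"
  shows "(branch_sum c ^^ j) H x = (\<Sum>y\<in>fib j x. (\<Prod>i<j. c ((f ^^ i) y)) * H y)"
proof (induction j arbitrary: H)
  case 0
  then show ?case using assms by (simp add: fib_0)
next
  case (Suc j)
  have "(branch_sum c ^^ Suc j) H x = (branch_sum c ^^ j) (branch_sum c H) x"
    by (simp add: funpow_swap1)
  also have "\<dots> = (\<Sum>z\<in>fib j x. (\<Prod>i<j. c ((f ^^ i) z)) * (\<Sum>y\<in>fib (Suc 0) z. c y * H y))"
    by (simp add: Suc branch_sum_fib)
  also have "\<dots> = (\<Sum>z\<in>fib j x. \<Sum>y\<in>fib (Suc 0) z. (\<Prod>i<Suc j. c ((f ^^ i) y)) * H y)"
  proof (intro sum.cong refl)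
    fix z
    have "(\<Prod>i<j. c ((f ^^ i) z)) * (c y * H y) = (\<Prod>i<Suc j. c ((f ^^ i) y)) * H y"
      if "y \<in> fib (Suc 0) z" for y
      using that by (simp add: fib_def prod.lessThan_Suc_shift funpow_swap1 mult_ac del: prod.lessThan_Suc)
    then show "(\<Prod>i<j. c ((f ^^ i) z)) * (\<Sum>y\<in>fib (Suc 0) z. c y * H y) =
        (\<Sum>y\<in>fib (Suc 0) z. (\<Prod>i<Suc j. c ((f ^^ i) y)) * H y)"
      by (simp add: sum_distrib_left del: prod.lessThan_Suc)
  qed
  finally show ?case by (subst sum_fib_Suc)
qed

lemma transfer_eq_branch_sum:
  "transfer_operator n U f w = branch_sum (\<lambda>y. complex_of_real (1 / w y))"
  by (intro ext) (simp add: transfer_operator_def branch_sum_def)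

lemma transfer_pow:
  assumes "x \<in> D"
  shows "(transfer_operator n U f w ^^ j) \<psi> x = (\<Sum>y\<in>fib j x. complex_of_real (G j y) * \<psi> y)"
  unfolding transfer_eq_branch_sum branch_sum_pow[OF assms] G_def by simp

lemma G_pos: "y \<in> D \<Longrightarrow> 0 < G j y"
  unfolding G_def using iter_in_D w_gt_1 by (intro prod_pos) (force simp: less_trans[OF zero_less_one])

lemma branch_sum_measurable:
  fixes H :: "'a \<Rightarrow> 'b::{comm_semiring_1, second_countable_topology, topological_comm_monoid_add}"
  assumes "\<And>A. A \<subseteq> D \<Longrightarrow> A \<in> sets M \<Longrightarrow> (\<lambda>y. c y * H y) \<in> borel_measurable (restrict_space M A)"
  shows "branch_sum c H \<in> borel_measurable M"
proof -
  have "(\<lambda>x. if x \<in> f ` U i then c (h i x) * H (h i x) else 0) \<in> borel_measurable M"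
    if i: "i \<in> {1..n}" for i
  proof (subst measurable_If_restrict_space_iff)
    have U: "U i \<subseteq> D" "U i \<in> sets M" using i D_I B_measurable by auto
    from measurable_compose[OF C_inverse_measurable[OF i] assms[OF U]]
    show "(\<lambda>x. c (h i x) * H (h i x)) \<in> borel_measurable (restrict_space M {x. x \<in> f ` U i}) \<and>
        (\<lambda>x. 0) \<in> borel_measurable (restrict_space M {x. x \<notin> f ` U i})" by simp
    show "{x \<in> space M. x \<in> f ` U i} \<in> sets M"
      using C_image[OF i] by (simp add: sets.sets_into_space Collect_conj_eq Int_absorb1)
  qed
  then have "(\<lambda>x. \<Sum>i\<in>{1..n}. if x \<in> f ` U i then c (h i x) * H (h i x) else 0) \<in> borel_measurable M"
    by (intro borel_measurable_sum)
  moreover have "branch_sum c H x = (\<Sum>i\<in>{1..n}. if x \<in> f ` U i then c (h i x) * H (h i x) else 0)" for x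
    using sum.inter_filter[of "{1..n}" "\<lambda>i. c (h i x) * H (h i x)" "\<lambda>i. x \<in> f ` U i"]
    unfolding branch_sum_def by simp
  ultimately show ?thesis by presburger
qed

text \<open>The Jacobian condition is given on sets. It says that f carries the measure w dm on U_i
  to the restriction of m to f(U_i), and the change of variables is then the integral formula for an
  image measure.\<close>

lemma nn_integral_branch:
  assumes i: "i \<in> {1..n}" and K: "K \<in> borel_measurable (restrict_space M (f ` U i))"
  shows "(\<integral>\<^sup>+x. K x * indicator (f ` U i) x \<partial>M) = (\<integral>\<^sup>+y. ennreal (w y) * K (f y) * indicator (U i) y \<partial>M)"
proof -
  let ?R = "restrict_space M (U i)" and ?S = "restrict_space M (f ` U i)"
  have sU: "U i \<in> sets M" and sf: "f ` U i \<in> sets M" using B_measurable C_image i by auto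
  have wm: "(\<lambda>x. ennreal (w x)) \<in> borel_measurable ?R"
    using w_measurable[of "U i"] i D_I by (intro measurable_compose[OF _ measurable_ennreal]) auto
  define N where "N = density ?R (\<lambda>x. ennreal (w x))"
  have fm: "f \<in> measurable N ?S" using C_measurable[OF i] by (simp add: N_def)
  have fm': "f \<in> measurable ?R ?S" using C_measurable[OF i] .
  have eq: "distr N ?S f = ?S"
  proof (rule measure_eqI)
    fix A assume "A \<in> sets (distr N ?S f)"
    then have A: "A \<in> sets ?S" by simp
    then have A': "A \<in> sets M" "A \<subseteq> f ` U i" using sf by (auto simp: sets_restrict_space_iff)
    have pre: "f -` A \<inter> U i = {y \<in> U i. f y \<in> A}" by auto
    have spR: "space ?R = U i" using sU by (simp add: space_restrict_space Int_absorb2 sets.sets_into_space)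
    have preR: "f -` A \<inter> U i \<in> sets ?R" using measurable_sets[OF fm' A] spR by simp
    have "emeasure (distr N ?S f) A = emeasure N (f -` A \<inter> U i)"
      using emeasure_distr[OF fm A] spR by (simp add: N_def)
    also have "\<dots> = (\<integral>\<^sup>+x. ennreal (w x) * indicator (f -` A \<inter> U i) x \<partial>?R)"
      unfolding N_def by (rule emeasure_density[OF wm preR])
    also have "\<dots> = (\<integral>\<^sup>+x. ennreal (w x) * indicator (f -` A \<inter> U i) x * indicator (U i) x \<partial>M)"
      using sU by (intro nn_integral_restrict_space) simp
    also have "\<dots> = (\<integral>\<^sup>+x. ennreal (w x) * indicator (f -` A \<inter> U i) x \<partial>M)"
      by (intro nn_integral_cong) (auto split: split_indicator)
    also have "\<dots> = emeasure M (f ` (f -` A \<inter> U i))"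
      using sets_preimage[OF i A'(1)] pre by (intro C_jacobian[OF i, symmetric]) auto
    also have "f ` (f -` A \<inter> U i) = A" using A'(2) by auto
    finally show "emeasure (distr N ?S f) A = emeasure ?S A"
      using A' sf by (simp add: emeasure_restrict_space)
  qed simp
  have "(\<integral>\<^sup>+x. K x * indicator (f ` U i) x \<partial>M) = (\<integral>\<^sup>+x. K x \<partial>?S)"
    using sf by (intro nn_integral_restrict_space[symmetric]) simp
  also have "\<dots> = (\<integral>\<^sup>+x. K x \<partial>distr N ?S f)" using eq by simp
  also have "\<dots> = (\<integral>\<^sup>+y. K (f y) \<partial>N)" using K by (intro nn_integral_distr[OF fm]) simp
  also have "\<dots> = (\<integral>\<^sup>+y. ennreal (w y) * K (f y) \<partial>?R)"
    unfolding N_def using wm measurable_compose[OF fm' K] by (rule nn_integral_density)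
  also have "\<dots> = (\<integral>\<^sup>+y. ennreal (w y) * K (f y) * indicator (U i) y \<partial>M)"
    using sU by (intro nn_integral_restrict_space) simp
  finally show ?thesis .
qed

lemma inverse_w_measurable:
  assumes "A \<subseteq> D"
  shows "(\<lambda>y. 1 / w y) \<in> borel_measurable (restrict_space M A)"
  using w_measurable[OF assms] by measurable

text \<open>The factor 1 / w cancels the Jacobian, so the i-th branch contributes the integral of H
  over U_i, and these sets fill the space up to a null set.\<close>

lemma branch_sum_nn:
  fixes H :: "'a \<Rightarrow> ennreal"
  assumes [measurable]: "H \<in> borel_measurable M"
  shows "branch_sum (\<lambda>y. ennreal (1 / w y)) H \<in> borel_measurable M" (is "?thesis1")
    and "(\<integral>\<^sup>+x. branch_sum (\<lambda>y. ennreal (1 / w y)) H x \<partial>M) = (\<integral>\<^sup>+x. H x \<partial>M)" (is "?thesis2")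
proof -
  have m: "(\<lambda>y. ennreal (1 / w y) * H y) \<in> borel_measurable (restrict_space M A)"
    if "A \<subseteq> D" for A
    using inverse_w_measurable[OF that] measurable_restrict_space1[OF assms] by measurable
  show ?thesis1 using m by (rule branch_sum_measurable)
  define K where "K = (\<lambda>i x. ennreal (1 / w (h i x)) * H (h i x))"
  have Km: "K i \<in> borel_measurable (restrict_space M (f ` U i))" if i: "i \<in> {1..n}" for i
  proof -
    have "U i \<subseteq> D" using i D_I by auto
    from measurable_compose[OF C_inverse_measurable[OF i] m[OF this]] show ?thesis by (simp add: K_def)
  qed
  have Km': "(\<lambda>x. K i x * indicator (f ` U i) x) \<in> borel_measurable M" if i: "i \<in> {1..n}" for i
    using Km[OF i] C_image[OF i] by (subst (asm) borel_measurable_restrict_space_iff_ennreal) auto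
  have "(\<integral>\<^sup>+x. branch_sum (\<lambda>y. ennreal (1 / w y)) H x \<partial>M)
      = (\<integral>\<^sup>+x. (\<Sum>i\<in>{1..n}. K i x * indicator (f ` U i) x) \<partial>M)"
  proof (intro nn_integral_cong)
    fix x
    have "(\<Sum>i | i \<in> {1..n} \<and> x \<in> f ` U i. K i x) = (\<Sum>i\<in>{1..n}. if x \<in> f ` U i then K i x else 0)"
      using sum.inter_filter[of "{1..n}" "\<lambda>i. K i x" "\<lambda>i. x \<in> f ` U i"] by simp
    also have "\<dots> = (\<Sum>i\<in>{1..n}. K i x * indicator (f ` U i) x)"
      by (intro sum.cong) auto
    finally show "branch_sum (\<lambda>y. ennreal (1 / w y)) H x = (\<Sum>i\<in>{1..n}. K i x * indicator (f ` U i) x)"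
      by (simp add: branch_sum_def K_def)
  qed
  also have "\<dots> = (\<Sum>i\<in>{1..n}. \<integral>\<^sup>+x. K i x * indicator (f ` U i) x \<partial>M)"
    using Km' by (rule nn_integral_sum)
  also have "\<dots> = (\<Sum>i\<in>{1..n}. \<integral>\<^sup>+x. H x * indicator (U i) x \<partial>M)"
  proof (intro sum.cong refl)
    fix i assume i: "i \<in> {1..n}"
    have "ennreal (w y) * K i (f y) * indicator (U i) y = H y * indicator (U i) y" for y
    proof (cases "y \<in> U i")
      case True
      have "w y > 1" using True i D_I w_gt_1 by blast
      then have "ennreal (w y) * (ennreal (1 / w y) * H y) = H y"
        by (simp add: mult.assoc[symmetric] ennreal_mult[symmetric])
      then show ?thesis using True h_f[OF i True] by (simp add: K_def)
    qed simp
    then show "(\<integral>\<^sup>+x. K i x * indicator (f ` U i) x \<partial>M) = (\<integral>\<^sup>+x. H x * indicator (U i) x \<partial>M)"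
      using nn_integral_branch[OF i Km[OF i]] by simp
  qed
  also have "\<dots> = (\<integral>\<^sup>+x. (\<Sum>i\<in>{1..n}. H x * indicator (U i) x) \<partial>M)"
    using B_measurable by (intro nn_integral_sum[symmetric]) auto
  also have "\<dots> = (\<integral>\<^sup>+x. H x \<partial>M)"
  proof (intro nn_integral_cong_AE)
    show "AE x in M. (\<Sum>i\<in>{1..n}. H x * indicator (U i) x) = H x"
      using AE_D
    proof eventually_elim
      case (elim x)
      then obtain l where l: "l \<in> {1..n}" "x \<in> U l" by (rule D_E)
      have "(\<Sum>i\<in>{1..n}. H x * indicator (U i) x) = (\<Sum>i\<in>{1..n}. if i = l then H x else 0)"
      proof (intro sum.cong refl)
        fix i assume "i \<in> {1..n}"
        then show "H x * indicator (U i) x = (if i = l then H x else 0)"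
          using U_unique[OF _ l(1) _ l(2), of i] l(2) by (cases "i = l") (auto simp: indicator_def)
      qed
      then show ?case using l by simp
    qed
  qed
  finally show ?thesis2 .
qed

text \<open>This identity turns estimates on single fibres into L^p estimates without any loss,
  whatever j is.\<close>

lemma fib_sum_nn:
  fixes H :: "'a \<Rightarrow> ennreal"
  assumes H: "H \<in> borel_measurable M"
  shows "(\<lambda>x. \<Sum>y\<in>fib j x. ennreal (G j y) * H y) \<in> borel_measurable M"
    and "(\<integral>\<^sup>+x. (\<Sum>y\<in>fib j x. ennreal (G j y) * H y) \<partial>M) = (\<integral>\<^sup>+x. H x \<partial>M)"
proof -
  let ?L = "branch_sum (\<lambda>y. ennreal (1 / w y))"
  have m: "(?L ^^ j) H \<in> borel_measurable M \<and> (\<integral>\<^sup>+x. (?L ^^ j) H x \<partial>M) = (\<integral>\<^sup>+x. H x \<partial>M)"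
    by (induction j) (use H branch_sum_nn in auto)
  have g: "ennreal (G j y) = (\<Prod>i<j. ennreal (1 / w ((f ^^ i) y)))" if "y \<in> D" for y
    unfolding G_def using iter_in_D[OF that] w_gt_1
    by (intro prod_ennreal[symmetric]) (force intro: less_imp_le less_trans[OF zero_less_one])
  have eq: "(\<Sum>y\<in>fib j x. ennreal (G j y) * H y) = indicator D x * (?L ^^ j) H x" for x
  proof (cases "x \<in> D")
    case True
    have "(\<Sum>y\<in>fib j x. ennreal (G j y) * H y) = (\<Sum>y\<in>fib j x. (\<Prod>i<j. ennreal (1 / w ((f ^^ i) y))) * H y)"
      by (intro sum.cong refl) (auto simp: fib_def g)
    then show ?thesis using True by (simp add: branch_sum_pow)
  qed (simp add: fib_outside)
  show "(\<lambda>x. \<Sum>y\<in>fib j x. ennreal (G j y) * H y) \<in> borel_measurable M"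
    unfolding eq using m by (intro borel_measurable_times_ennreal borel_measurable_indicator) auto
  have "(\<integral>\<^sup>+x. indicator D x * (?L ^^ j) H x \<partial>M) = (\<integral>\<^sup>+x. (?L ^^ j) H x \<partial>M)"
    by (intro nn_integral_cong_AE eventually_mono[OF AE_D]) simp
  then show "(\<integral>\<^sup>+x. (\<Sum>y\<in>fib j x. ennreal (G j y) * H y) \<partial>M) = (\<integral>\<^sup>+x. H x \<partial>M)"
    unfolding eq using m by simp
qed

text \<open>For a null set N the fibre sums of G_j times the indicator of N integrate to m(N) = 0.
  Since G_j is positive on \<open>D\<close>, almost every fibre misses N altogether. Thus the
  operator respects equality and convergence almost everywhere.\<close>

lemma AE_fib:
  assumes "AE y in M. Q y"
  shows "AE x in M. \<forall>y\<in>fib j x. Q y"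
proof -
  from AE_E[OF assms] obtain N where N: "{y \<in> space M. \<not> Q y} \<subseteq> N" "emeasure M N = 0" "N \<in> sets M" by blast
  have [measurable]: "N \<in> sets M" by (rule N)
  have H: "indicator N \<in> borel_measurable M" by simp
  have "(\<integral>\<^sup>+x. (\<Sum>y\<in>fib j x. ennreal (G j y) * indicator N y) \<partial>M) = 0"
    unfolding fib_sum_nn(2)[OF H] using N by simp
  then have "AE x in M. (\<Sum>y\<in>fib j x. ennreal (G j y) * indicator N y) = 0"
    using fib_sum_nn(1)[OF H] by (subst (asm) nn_integral_0_iff_AE)
  then show ?thesis
  proof eventually_elim
    case (elim x)
    show ?case
    proof
      fix y assume y: "y \<in> fib j x"
      then have yD: "y \<in> D" by (simp add: fib_def)
      have "\<forall>y\<in>fib j x. ennreal (G j y) * indicator N y = (0 :: ennreal)"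
        using elim by (subst (asm) sum_eq_0_iff) (rule finite_fib)
      then have "ennreal (G j y) * indicator N y = (0 :: ennreal)" using y by blast
      then have "y \<notin> N" using G_pos[OF yD, of j] by (auto simp: ennreal_eq_0_iff indicator_def)
      then show "Q y" using N(1) yD D_subset by auto
    qed
  qed
qed

lemma transfer_pow_measurable:
  assumes "\<psi> \<in> borel_measurable M"
  shows "(transfer_operator n U f w ^^ j) \<psi> \<in> borel_measurable M"
proof (induction j)
  case (Suc j)
  have "(\<lambda>y. complex_of_real (1 / w y) * (transfer_operator n U f w ^^ j) \<psi> y)
      \<in> borel_measurable (restrict_space M A)" if "A \<subseteq> D" for A
    using inverse_w_measurable[OF that] measurable_restrict_space1[OF Suc] by measurable
  then have "branch_sum (\<lambda>y. complex_of_real (1 / w y)) ((transfer_operator n U f w ^^ j) \<psi>)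
      \<in> borel_measurable M"
    by (rule branch_sum_measurable)
  then show ?case by (simp add: transfer_eq_branch_sum)
qed (use assms in simp)

subsection \<open>Distortion\<close>

text \<open>The inverse branches followed by the orbit of y are applied to x'. Each is defined there
  because an image containing one point of U_l contains all of U_l; sharing the first symbol with
  f^j y is enough to start.\<close>

lemma lift_fibre:
  assumes "y \<in> D" "same (Suc 0) ((f ^^ j) y) x'"
  shows "\<exists>y'\<in>D. same j y y' \<and> (f ^^ j) y' = x'"
  using assms
proof (induction j arbitrary: y)
  case 0
  then show ?case using same_in_D by auto
next
  case (Suc j)
  have "f y \<in> D" "same (Suc 0) ((f ^^ j) (f y)) x'"
    using Suc.prems f_in_D by (auto simp: funpow_swap1)
  from Suc.IH[OF this] obtain z' where z': "z' \<in> D" "same j (f y) z'" "(f ^^ j) z' = x'" by blast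
  \<comment> \<open>The symbol at time j is needed for j = 0: otherwise f y and z' would not be
    known to lie in a common U_l.\<close>
  have "same (j + Suc 0) (f y) z'"
    using z' Suc.prems(2) by (subst same_add) (simp add: funpow_swap1)
  then have "same (Suc 0) (f y) z'" by (rule same_mono) simp
  then obtain l where l: "l \<in> {1..n}" "f y \<in> U l" "z' \<in> U l" by (auto simp: same_1)
  obtain i where i: "i \<in> {1..n}" "y \<in> U i" using Suc.prems(1) by (rule D_E)
  have z'f: "z' \<in> f ` U i" using markov_image[OF i(1) l(1) i(2) l(2)] l(3) by blast
  have "same (Suc j) y (h i z')"
    using i h_in[OF i(1) z'f] f_h[OF i(1) z'f] z' unfolding same_Suc[of j] same_1 by auto
  moreover have "(f ^^ Suc j) (h i z') = x'"
    using f_h[OF i(1) z'f] z' by (simp add: funpow_swap1)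
  ultimately show ?case using D_I[OF i(1) h_in[OF i(1) z'f]] by blast
qed

lemma same_fibre_unique:
  assumes "y \<in> D" "y' \<in> D" "same j y y'" "(f ^^ j) y = (f ^^ j) y'"
  shows "y = y'"
  using assms
proof (induction j arbitrary: y y')
  case (Suc j)
  have s: "same (Suc 0) y y'" "same j (f y) (f y')" using Suc.prems(3) same_Suc[of j] by blast+
  have "(f ^^ j) (f y) = (f ^^ j) (f y')" using Suc.prems(4) unfolding funpow_Suc_right comp_apply .
  then have "f y = f y'" by (rule Suc.IH[OF f_in_D[OF Suc.prems(1)] f_in_D[OF Suc.prems(2)] s(2)])
  moreover obtain l where "l \<in> {1..n}" "y \<in> U l" "y' \<in> U l" using s by (auto simp: same_1)
  ultimately show ?case using C_inj by (meson inj_onD)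
qed simp

lemma G_exp: "y \<in> D \<Longrightarrow> G j y = exp (- (\<Sum>i<j. ln (w ((f ^^ i) y))))"
proof -
  assume y: "y \<in> D"
  have "w ((f ^^ i) y) > 0" for i using w_gt_1[OF iter_in_D[OF y]] by (simp add: less_trans[OF zero_less_one])
  then have "1 / w ((f ^^ i) y) = exp (- ln (w ((f ^^ i) y)))" for i
    by (simp add: exp_minus inverse_eq_divide)
  then show ?thesis unfolding G_def by (simp add: exp_sum sum_negf[symmetric])
qed

lemma bowen: "\<exists>K\<ge>1. \<forall>j y y'. y \<in> D \<longrightarrow> y' \<in> D \<longrightarrow> same j y y' \<longrightarrow> G j y \<le> K * G j y'"
proof -
  obtain K where "\<forall>k. \<forall>P\<in>grid k. \<forall>x\<in>P. \<forall>y\<in>P.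
      \<bar>(\<Sum>i<k. ln (w ((f ^^ i) x))) - (\<Sum>i<k. ln (w ((f ^^ i) y)))\<bar> \<le> K"
    using E_bowen ..
  note K = this[rule_format]
  have "G j y \<le> exp \<bar>K\<bar> * G j y'" if y: "y \<in> D" "y' \<in> D" "same j y y'" for j y y'
  proof -
    have "\<bar>(\<Sum>i<j. ln (w ((f ^^ i) y))) - (\<Sum>i<j. ln (w ((f ^^ i) y')))\<bar> \<le> K"
      using y D_subset by (intro K[OF grid_cyl[OF y(1)] cyl_self[OF y(1)]]) (auto simp: cyl_def)
    then have "- (\<Sum>i<j. ln (w ((f ^^ i) y))) \<le> \<bar>K\<bar> + (- (\<Sum>i<j. ln (w ((f ^^ i) y'))))" by linarith
    then show ?thesis using y by (simp add: G_exp exp_add[symmetric])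
  qed
  then show ?thesis by (intro exI[of _ "exp \<bar>K\<bar>"]) auto
qed

text \<open>The measure of the cell of level j + k at y is the integral over x of the fibre sums of
  G_j restricted to that cell. A fibre meets the cell in at most one point, f^j maps the cell into
  the cell of level k at f^j y, and onto it if k is positive, while by the Bowen condition G_j
  varies on it by a bounded factor only.\<close>

lemma cyl_comparable_ex:
  "\<exists>C\<ge>1. \<forall>j k. \<forall>y\<in>D. cyl_meas (j + k) y \<le> C * (G j y * cyl_meas k ((f ^^ j) y)) \<and>
     G j y * cyl_meas k ((f ^^ j) y) \<le> C * cyl_meas (j + k) y"
proof -
  obtain K where K: "K \<ge> 1" "\<And>j y y'. y \<in> D \<Longrightarrow> y' \<in> D \<Longrightarrow> same j y y' \<Longrightarrow> G j y \<le> K * G j y'"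
    using bowen by blast
  have int: "ennreal (cyl_meas k y) = (\<integral>\<^sup>+x. (\<Sum>z\<in>fib j x. ennreal (G j z) * indicator (cyl k y) z) \<partial>M)"
    if "y \<in> D" for j k y
    using sets_cyl[OF that] by (subst fib_sum_nn(2)) (auto simp: cyl_meas_def emeasure_eq_measure)
  have up: "cyl_meas (j + k) y \<le> K * (G j y * cyl_meas k ((f ^^ j) y))" if y: "y \<in> D" for j k y
  proof -
    let ?z = "(f ^^ j) y"
    have [measurable]: "cyl k ?z \<in> sets M" using y iter_in_D by auto
    have "ennreal (cyl_meas (j + k) y) \<le> (\<integral>\<^sup>+x. ennreal (K * G j y) * indicator (cyl k ?z) x \<partial>M)"
      unfolding int[OF y, of "j + k" j]
    proof (intro nn_integral_mono)
      fix x
      show "(\<Sum>z\<in>fib j x. ennreal (G j z) * indicator (cyl (j + k) y) z) \<le> ennreal (K * G j y) * indicator (cyl k ?z) x"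
      proof (cases "\<exists>z\<in>fib j x. z \<in> cyl (j + k) y")
        case True
        then obtain z where z: "z \<in> D" "(f ^^ j) z = x" "same j y z" "same k ?z x"
          by (auto simp: fib_def cyl_def same_add)
        have "z' = z" if "z' \<in> fib j x" "z' \<in> cyl (j + k) y" for z'
        proof (rule same_fibre_unique)
          have "same j y z'" using that by (simp add: cyl_def same_add)
          then show "same j z' z" using z(3) same_trans same_sym by blast
        qed (use that z in \<open>auto simp: fib_def\<close>)
        then have "(\<Sum>z\<in>fib j x. ennreal (G j z) * indicator (cyl (j + k) y) z) \<le> (\<Sum>z'\<in>fib j x. if z' = z then ennreal (G j z) else 0)"
        proof (intro sum_mono)
          fix z' assume "z' \<in> fib j x"
          then show "ennreal (G j z') * indicator (cyl (j + k) y) z' \<le> (if z' = z then ennreal (G j z) else 0)"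
            using \<open>\<And>z'. z' \<in> fib j x \<Longrightarrow> z' \<in> cyl (j + k) y \<Longrightarrow> z' = z\<close>[of z']
            by (cases "z' \<in> cyl (j + k) y") auto
        qed
        also have "\<dots> \<le> ennreal (G j z)" by (simp add: finite_fib)
        also have "\<dots> \<le> ennreal (K * G j y)" using K(2)[OF z(1) y same_sym[OF z(3)]] by (intro ennreal_leI)
        finally show ?thesis
          using z D_subset iter_in_D[OF z(1), of j] by (auto simp: cyl_def split: split_indicator)
      next
        case False
        then have "(\<Sum>z\<in>fib j x. ennreal (G j z) * indicator (cyl (j + k) y) z) = 0"
          by (intro sum.neutral) auto
        then show ?thesis by simp
      qed
    qed
    also have "\<dots> = ennreal (K * G j y * cyl_meas k ?z)"
      using K G_pos[OF y, of j] by (simp add: nn_integral_cmult_indicator cyl_meas_def emeasure_eq_measure ennreal_mult)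
    finally show ?thesis
      using K G_pos[OF y, of j] by (simp add: ennreal_le_iff mult.assoc)
  qed
  \<comment> \<open>Surjectivity onto the image cell comes from \<open>lift_fibre\<close>, which
    needs a common first symbol, hence the positive level.\<close>
  have low: "G j y * cyl_meas (Suc k) ((f ^^ j) y) \<le> K * cyl_meas (j + Suc k) y" if y: "y \<in> D" for j k y
  proof -
    let ?z = "(f ^^ j) y"
    have z: "?z \<in> D" using y iter_in_D by auto
    then have [measurable]: "cyl (Suc k) ?z \<in> sets M" by auto
    have "ennreal (G j y / K * cyl_meas (Suc k) ?z) = ennreal (G j y / K) * ennreal (cyl_meas (Suc k) ?z)"
      using K G_pos[OF y, of j] by (intro ennreal_mult) auto
    also have "\<dots> = (\<integral>\<^sup>+x. ennreal (G j y / K) * indicator (cyl (Suc k) ?z) x \<partial>M)"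
      by (simp add: nn_integral_cmult_indicator cyl_meas_def emeasure_eq_measure)
    also have "\<dots> \<le> ennreal (cyl_meas (j + Suc k) y)"
      unfolding int[OF y, of "j + Suc k" j]
    proof (intro nn_integral_mono)
      fix x
      show "ennreal (G j y / K) * indicator (cyl (Suc k) ?z) x \<le> (\<Sum>z\<in>fib j x. ennreal (G j z) * indicator (cyl (j + Suc k) y) z)"
      proof (cases "x \<in> cyl (Suc k) ?z")
        case True
        then have s: "same (Suc k) ?z x" by (simp add: cyl_def)
        then have "same (Suc 0) ?z x" by (rule same_mono) simp
        from lift_fibre[OF y this] obtain y' where y': "y' \<in> D" "same j y y'" "(f ^^ j) y' = x" by blast
        have "G j y / K \<le> G j y'" using K(2)[OF y y'(1,2)] K(1) by (simp add: field_simps)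
        then have "ennreal (G j y / K) * indicator (cyl (Suc k) ?z) x \<le> ennreal (G j y')"
          using True by (simp add: ennreal_leI)
        also have "\<dots> = ennreal (G j y') * indicator (cyl (j + Suc k) y) y'"
          using y' s D_subset same_add[of j "Suc k" y y'] by (auto simp: cyl_def indicator_def)
        also have "\<dots> \<le> (\<Sum>z\<in>fib j x. ennreal (G j z) * indicator (cyl (j + Suc k) y) z)"
          using y' by (intro member_le_sum finite_fib) (auto simp: fib_def)
        finally show ?thesis .
      qed simp
    qed
    finally show ?thesis using K(1) by (simp add: ennreal_le_iff field_simps)
  qed
  \<comment> \<open>For level 0 the whole space is replaced by the cell of level 1 at f^j y, whose
    measure is at least \<open>minU\<close>; this enlarges the constant from K to K /
    \<open>minU\<close>.\<close>
  have low0: "G j y \<le> K / minU * cyl_meas j y" if y: "y \<in> D" for j y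
  proof -
    have "G j y * minU \<le> G j y * cyl_meas (Suc 0) ((f ^^ j) y)"
      using G_pos[OF y, of j] minU_le iter_in_D[OF y] by (intro mult_left_mono) auto
    also have "\<dots> \<le> K * cyl_meas (j + Suc 0) y" by (rule low[OF y])
    also have "\<dots> \<le> K * cyl_meas j y" using K cyl_meas_mono[OF y] by (intro mult_left_mono) auto
    finally show ?thesis using minU_pos by (simp add: field_simps)
  qed
  have mU: "minU \<le> 1" using D_nonempty minU_le cyl_meas_le_1 order_trans by blast
  then have KK: "K \<le> K / minU" using minU_pos K by (simp add: field_simps)
  have "cyl_meas (j + k) y \<le> K / minU * (G j y * cyl_meas k ((f ^^ j) y))" if "y \<in> D" for j k y
    using up[OF that, of j k] mult_right_mono[OF KK, of "G j y * cyl_meas k ((f ^^ j) y)"] G_pos[OF that, of j] by simp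
  moreover have "G j y * cyl_meas k ((f ^^ j) y) \<le> K / minU * cyl_meas (j + k) y" if "y \<in> D" for j k y
  proof (cases k)
    case 0
    then show ?thesis using low0[OF that, of j] prob_space by (simp add: cyl_meas_def cyl_0)
  next
    case (Suc l)
    then show ?thesis using low[OF that, of j l] mult_right_mono[OF KK, of "cyl_meas (j + k) y"] by simp
  qed
  ultimately show ?thesis using K KK by (intro exI[of _ "K / minU"]) auto
qed

text \<open>Choice gives the distortion constant a name, so that \<open>decayC\<close> and
  \<open>growC\<close> are definitions in which visibly neither j nor k occurs.\<close>

definition distC :: real where
  "distC = (SOME C. C \<ge> 1 \<and> (\<forall>j k. \<forall>y\<in>D. cyl_meas (j + k) y \<le> C * (G j y * cyl_meas k ((f ^^ j) y)) \<and>
     G j y * cyl_meas k ((f ^^ j) y) \<le> C * cyl_meas (j + k) y))"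

lemma distC: "distC \<ge> 1"
    "y \<in> D \<Longrightarrow> cyl_meas (j + k) y \<le> distC * (G j y * cyl_meas k ((f ^^ j) y))"
    "y \<in> D \<Longrightarrow> G j y * cyl_meas k ((f ^^ j) y) \<le> distC * cyl_meas (j + k) y"
  using someI_ex[OF cyl_comparable_ex] unfolding distC_def[symmetric] by blast+

lemma cyl_meas_0: "cyl_meas 0 x = 1"
  using prob_space by (simp add: cyl_meas_def cyl_0)

lemma G_le: "y \<in> D \<Longrightarrow> G j y \<le> distC * cyl_meas j y"
  using distC(3)[of y j 0] by (simp add: cyl_meas_0)

lemma cyl_meas_le_G: "y \<in> D \<Longrightarrow> cyl_meas j y \<le> distC * G j y"
  using distC(2)[of y j 0] by (simp add: cyl_meas_0)

text \<open>One factor \<open>distC\<close> compares the cell with G_j times the later cell, the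
  other replaces G_j by the measure of the cell of level j.\<close>

lemma cyl_meas_add_le:
  assumes "y \<in> D"
  shows "cyl_meas (j + k) y \<le> distC\<^sup>2 * (cyl_meas j y * cyl_meas k ((f ^^ j) y))"
proof -
  have "cyl_meas (j + k) y \<le> distC * (G j y * cyl_meas k ((f ^^ j) y))" by (rule distC(2)[OF assms])
  also have "\<dots> \<le> distC * (distC * cyl_meas j y * cyl_meas k ((f ^^ j) y))"
    using distC(1) G_le[OF assms] by (intro mult_left_mono mult_right_mono) auto
  finally show ?thesis by (simp add: power2_eq_square mult_ac)
qed

lemma cyl_meas_add_ge:
  assumes "y \<in> D"
  shows "cyl_meas j y * cyl_meas k ((f ^^ j) y) \<le> distC\<^sup>2 * cyl_meas (j + k) y"
proof -
  have "cyl_meas j y * cyl_meas k ((f ^^ j) y) \<le> distC * G j y * cyl_meas k ((f ^^ j) y)"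
    using cyl_meas_le_G[OF assms] by (intro mult_right_mono) auto
  also have "\<dots> \<le> distC * (distC * cyl_meas (j + k) y)"
    using distC(1) distC(3)[OF assms] by (simp add: mult.assoc mult_left_mono)
  finally show ?thesis by (simp add: power2_eq_square mult_ac)
qed

text \<open>Expansion alone gives decay when symbols are added in front of an itinerary. Refining a
  fixed cell adds them at the end, and bounded distortion transfers the decay rate to that
  side.\<close>

lemma cyl_meas_shrink:
  assumes "y \<in> D"
  shows "cyl_meas (k + i) y \<le> distC\<^sup>2 * contr ^ i * cyl_meas k y"
proof -
  have "cyl_meas (k + i) y \<le> distC\<^sup>2 * (cyl_meas k y * cyl_meas i ((f ^^ k) y))"
    by (rule cyl_meas_add_le[OF assms])
  also have "\<dots> \<le> distC\<^sup>2 * (cyl_meas k y * contr ^ i)"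
    using cyl_meas_le_power iter_in_D[OF assms] by (intro mult_left_mono) auto
  finally show ?thesis by (simp add: mult_ac)
qed

text \<open>A child occupies at least the fraction \<open>minU\<close> / \<open>distC\<close>^2 of
  its parent, the lower constant of a good grid. It bounds the price of moving a weighted estimate
  one level deeper.\<close>

lemma cyl_meas_Suc_ge:
  assumes "y \<in> D"
  shows "minU * cyl_meas k y \<le> distC\<^sup>2 * cyl_meas (Suc k) y"
proof -
  have "minU * cyl_meas k y \<le> cyl_meas k y * cyl_meas (Suc 0) ((f ^^ k) y)"
    using minU_le iter_in_D[OF assms] by (subst mult.commute) (intro mult_left_mono, auto)
  also have "\<dots> \<le> distC\<^sup>2 * cyl_meas (k + Suc 0) y" by (rule cyl_meas_add_ge[OF assms])
  finally show ?thesis by simp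
qed

lemma grid_dist_le:
  assumes "same k x y" "x \<in> D" "y \<in> D"
  shows "0 \<le> grid_dist M grid x y" "grid_dist M grid x y \<le> cyl_meas k x"
proof -
  let ?S = "{measure M Q |Q. Q \<in> (\<Union>k. grid k) \<and> x \<in> Q \<and> y \<in> Q}"
  have "cyl k x \<in> (\<Union>k. grid k)" "x \<in> cyl k x" "y \<in> cyl k x"
    using assms grid_cyl cyl_self D_subset by (auto simp: cyl_def)
  then have mem: "cyl_meas k x \<in> ?S" unfolding cyl_meas_def by blast
  have "bdd_below ?S" by (rule bdd_belowI[of _ 0]) auto
  then show "grid_dist M grid x y \<le> cyl_meas k x" unfolding grid_dist_def using mem by (intro cInf_lower)
  show "0 \<le> grid_dist M grid x y" unfolding grid_dist_def using mem by (intro cInf_greatest) auto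
qed

text \<open>The logarithm of G_j is a sum along the orbit. At time i < j the two orbits still share
  a cell of level (j - i) + (k + 1), whose measure is at most contr^(j - i) times that of the final
  cell, so condition (F) produces a geometric series with a sum independent of j.\<close>

lemma G_hoelder_ex:
  "\<exists>C\<ge>0. \<forall>j k. \<forall>y\<in>D. \<forall>y'\<in>D. same (j + Suc k) y y' \<longrightarrow>
     \<bar>G j y - G j y'\<bar> \<le> C * G j y * cyl_meas (Suc k) ((f ^^ j) y) powr (\<beta> + \<epsilon>)"
proof -
  define \<delta> where "\<delta> = \<beta> + \<epsilon>"
  have \<delta>: "\<delta> > 0" using exponents_pos by (simp add: \<delta>_def)
  obtain C0 where "\<forall>i\<in>{1..n}. \<forall>x\<in>U i. \<forall>y\<in>U i.
      \<bar>w x - w y\<bar> \<le> C0 * grid_dist M grid x y powr \<delta>"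
    using F_hoelder unfolding \<delta>_def ..
  note C0 = this[rule_format]
  obtain K where K: "K \<ge> 1" "\<And>j y y'. y \<in> D \<Longrightarrow> y' \<in> D \<Longrightarrow> same j y y' \<Longrightarrow> G j y \<le> K * G j y'"
    using bowen by blast
  define \<kappa> where "\<kappa> = contr powr \<delta>"
  have \<kappa>: "0 < \<kappa>" "\<kappa> < 1"
    using contr_bounds \<delta> powr_less_mono2[of \<delta> contr 1] by (auto simp: \<kappa>_def)
  have one: "\<bar>ln (w x) - ln (w y)\<bar> \<le> \<bar>C0\<bar> * cyl_meas (Suc k) x powr \<delta>"
    if xy: "x \<in> D" "y \<in> D" "same (Suc k) x y" for x y k
  proof -
    obtain l where l: "l \<in> {1..n}" "x \<in> U l" "y \<in> U l" using same_mono[OF xy(3), of "Suc 0"] by (auto simp: same_1)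
    \<comment> \<open>The logarithm is 1-Lipschitz beyond 1, and w exceeds 1 on
      \<open>D\<close>.\<close>
    have lip: "ln a - ln b \<le> \<bar>a - b\<bar>" if "a > 1" "b > 1" for a b :: real
    proof -
      have "ln a - ln b = ln (a / b)" using that by (simp add: ln_div)
      also have "\<dots> \<le> a / b - 1" using that by (intro ln_le_minus_one) auto
      also have "\<dots> = (a - b) / b" using that by (simp add: field_simps)
      also have "\<dots> \<le> \<bar>a - b\<bar> / b" using that by (intro divide_right_mono) auto
      also have "\<dots> \<le> \<bar>a - b\<bar>" using that mult_left_mono[of 1 b "\<bar>a - b\<bar>"] by (simp add: divide_le_eq)
      finally show ?thesis .
    qed
    have "\<bar>ln (w x) - ln (w y)\<bar> \<le> \<bar>w x - w y\<bar>"
      using lip[OF w_gt_1[OF xy(1)] w_gt_1[OF xy(2)]] lip[OF w_gt_1[OF xy(2)] w_gt_1[OF xy(1)]] by linarith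
    also have "\<dots> \<le> C0 * grid_dist M grid x y powr \<delta>" by (rule C0[OF l])
    also have "\<dots> \<le> \<bar>C0\<bar> * cyl_meas (Suc k) x powr \<delta>"
      using grid_dist_le[OF xy(3,1,2)] \<delta> by (intro mult_mono powr_mono2) auto
    finally show ?thesis .
  qed
  define C where "C = \<bar>C0\<bar> / (1 - \<kappa>)"
  have C: "C \<ge> 0" using \<kappa> by (simp add: C_def)
  have "\<bar>G j y - G j y'\<bar> \<le> C * K * G j y * cyl_meas (Suc k) ((f ^^ j) y) powr \<delta>"
    if y: "y \<in> D" "y' \<in> D" "same (j + Suc k) y y'" for j k y y'
  proof -
    let ?q = "cyl_meas (Suc k) ((f ^^ j) y)"
    define a b where "a = - (\<Sum>i<j. ln (w ((f ^^ i) y)))" and "b = - (\<Sum>i<j. ln (w ((f ^^ i) y')))"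
    have "\<bar>a - b\<bar> = \<bar>\<Sum>i<j. ln (w ((f ^^ i) y')) - ln (w ((f ^^ i) y))\<bar>"
      by (simp add: a_def b_def sum_subtractf)
    also have "\<dots> \<le> (\<Sum>i<j. \<bar>ln (w ((f ^^ i) y')) - ln (w ((f ^^ i) y))\<bar>)" by (rule sum_abs)
    also have "\<dots> \<le> (\<Sum>i<j. \<bar>C0\<bar> * (\<kappa> ^ (j - Suc i) * ?q powr \<delta>))"
    proof (intro sum_mono)
      fix i assume "i \<in> {..<j}"
      then have i: "i < j" by simp
      let ?z = "(f ^^ i) y"
      have eq: "j + Suc k = i + Suc ((j - Suc i) + Suc k)" using i by simp
      have s: "same (Suc ((j - Suc i) + Suc k)) ?z ((f ^^ i) y')"
        using y(3) unfolding eq by (subst (asm) same_add) simp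
      have "\<bar>ln (w ((f ^^ i) y')) - ln (w ?z)\<bar> \<le> \<bar>C0\<bar> * cyl_meas (Suc ((j - Suc i) + Suc k)) ?z powr \<delta>"
        using one[OF iter_in_D[OF y(1)] iter_in_D[OF y(2)] s] by (simp add: abs_minus_commute)
      also have "\<dots> \<le> \<bar>C0\<bar> * (contr ^ (j - i) * ?q) powr \<delta>"
      proof (intro mult_left_mono powr_mono2)
        have "(f ^^ (j - i)) ?z = (f ^^ j) y"
          using i by (metis comp_apply funpow_add le_add_diff_inverse2 less_imp_le_nat)
        moreover have "Suc ((j - Suc i) + Suc k) = (j - i) + Suc k" using i by simp
        ultimately show "cyl_meas (Suc ((j - Suc i) + Suc k)) ?z \<le> contr ^ (j - i) * ?q"
          using cyl_meas_contract[OF iter_in_D[OF y(1)], of "j - i" "Suc k" i] by metis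
      qed (use \<delta> in auto)
      also have "\<dots> = \<bar>C0\<bar> * (\<kappa> ^ (j - i) * ?q powr \<delta>)"
        using contr_bounds by (simp add: powr_mult \<kappa>_def powr_realpow[symmetric] powr_powr mult.commute)
      \<comment> \<open>One power of \<kappa> is given away so that the exponents run exactly from j
        - 1 down to 0 and the sum can be reversed.\<close>
      also have "\<dots> \<le> \<bar>C0\<bar> * (\<kappa> ^ (j - Suc i) * ?q powr \<delta>)"
        using \<kappa> i by (intro mult_left_mono mult_right_mono power_decreasing) auto
      finally show "\<bar>ln (w ((f ^^ i) y')) - ln (w ?z)\<bar> \<le> \<bar>C0\<bar> * (\<kappa> ^ (j - Suc i) * ?q powr \<delta>)" .
    qed
    also have "\<dots> = \<bar>C0\<bar> * ?q powr \<delta> * (\<Sum>i<j. \<kappa> ^ (j - Suc i))"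
      unfolding sum_distrib_left by (intro sum.cong) (auto simp: mult_ac)
    also have "(\<Sum>i<j. \<kappa> ^ (j - Suc i)) = (\<Sum>i<j. \<kappa> ^ i)" by (rule sum.nat_diff_reindex)
    also have "\<bar>C0\<bar> * ?q powr \<delta> * (\<Sum>i<j. \<kappa> ^ i) \<le> \<bar>C0\<bar> * ?q powr \<delta> * (1 / (1 - \<kappa>))"
    proof (intro mult_left_mono)
      have "(\<Sum>i<j. \<kappa> ^ i) \<le> (\<Sum>i. \<kappa> ^ i)" using \<kappa> by (intro sum_le_suminf summable_geometric) auto
      then show "(\<Sum>i<j. \<kappa> ^ i) \<le> 1 / (1 - \<kappa>)" using \<kappa> by (simp add: suminf_geometric)
    qed simp
    finally have ab: "\<bar>a - b\<bar> \<le> C * ?q powr \<delta>" by (simp add: C_def mult.commute)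
    \<comment> \<open>Applied both ways this bounds the difference of exponentials by the difference
      of exponents times the larger exponential, which the Bowen constant K reduces to a multiple of
      G_j(y).\<close>
    have ex: "exp u - exp v \<le> \<bar>u - v\<bar> * exp u" for u v :: real
    proof -
      have "1 + (v - u) \<le> exp (v - u)" by (rule exp_ge_add_one_self)
      then have "(1 + (v - u)) * exp u \<le> exp (v - u) * exp u" by (intro mult_right_mono) auto
      then have "exp u - exp v \<le> (u - v) * exp u" by (simp add: exp_diff algebra_simps)
      also have "\<dots> \<le> \<bar>u - v\<bar> * exp u" by (intro mult_right_mono) auto
      finally show ?thesis .
    qed
    have sj: "same j y y'" using y(3) by (rule same_mono) simp
    have Ga: "G j y = exp a" "G j y' = exp b" using y by (auto simp: G_exp a_def b_def)
    have "exp b \<le> K * exp a" using K(2)[OF y(2,1) same_sym[OF sj]] Ga by simp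
    moreover have "exp a \<le> K * exp a" using K(1) by simp
    moreover have "\<bar>a - b\<bar> * exp b \<le> \<bar>a - b\<bar> * (K * exp a)" "\<bar>a - b\<bar> * exp a \<le> \<bar>a - b\<bar> * (K * exp a)"
      using calculation by (auto intro!: mult_left_mono)
    ultimately have "\<bar>exp a - exp b\<bar> \<le> \<bar>a - b\<bar> * (K * exp a)"
      using ex[of a b] ex[of b a] by (simp add: abs_minus_commute abs_le_iff)
    also have "\<dots> \<le> C * ?q powr \<delta> * (K * exp a)" using ab K by (intro mult_right_mono) auto
    finally show ?thesis using Ga by (simp add: mult_ac)
  qed
  then show ?thesis using C K unfolding \<delta>_def by (intro exI[of _ "C * K"]) auto
qed

definition holdC :: real where
  "holdC = (SOME C. C \<ge> 0 \<and> (\<forall>j k. \<forall>y\<in>D. \<forall>y'\<in>D. same (j + Suc k) y y' \<longrightarrow>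
     \<bar>G j y - G j y'\<bar> \<le> C * G j y * cyl_meas (Suc k) ((f ^^ j) y) powr (\<beta> + \<epsilon>)))"

lemma holdC: "holdC \<ge> 0"
    "y \<in> D \<Longrightarrow> y' \<in> D \<Longrightarrow> same (j + Suc k) y y' \<Longrightarrow>
     \<bar>G j y - G j y'\<bar> \<le> holdC * G j y * cyl_meas (Suc k) ((f ^^ j) y) powr (\<beta> + \<epsilon>)"
  using someI_ex[OF G_hoelder_ex] unfolding holdC_def[symmetric] by blast+

text \<open>Two points of one fibre that lie in the same cell of level j coincide, so the fibre
  selects distinct cells and its sum is part of the sum over the grid.\<close>

lemma sum_fib_cyl_meas_le:
  "(\<Sum>y\<in>fib j x. cyl_meas j y powr a) \<le> (\<Sum>Q\<in>grid j. measure M Q powr a)"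
proof -
  have inj: "inj_on (cyl j) (fib j x)"
  proof (rule inj_onI)
    fix y y' assume y: "y \<in> fib j x" "y' \<in> fib j x" and eq: "cyl j y = cyl j y'"
    have "y' \<in> cyl j y" using eq cyl_self y by (auto simp: fib_def)
    then show "y = y'" using y by (intro same_fibre_unique[of y y' j]) (auto simp: fib_def cyl_def)
  qed
  have "(\<Sum>y\<in>fib j x. cyl_meas j y powr a) = (\<Sum>Q\<in>cyl j ` fib j x. measure M Q powr a)"
    using inj by (simp add: sum.reindex cyl_meas_def)
  also have "\<dots> \<le> (\<Sum>Q\<in>grid j. measure M Q powr a)"
    using grid_cyl by (intro sum_mono2 finite_grid) (auto simp: fib_def)
  finally show ?thesis .
qed

text \<open>Lifting is possible in both directions, and uniqueness within a fibre makes the two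
  lifts inverse to each other.\<close>

lemma sum_fib_same:
  fixes g :: "'a \<Rightarrow> 'b::comm_monoid_add"
  assumes "same (Suc 0) x x'"
  obtains b where "bij_betw b (fib j x) (fib j x')" "\<And>y. y \<in> fib j x \<Longrightarrow> same j y (b y)"
proof -
  have "\<exists>y'\<in>fib j x'. same j y y'" if "y \<in> fib j x" for y
    using lift_fibre[of y j x'] that assms by (auto simp: fib_def)
  then obtain b where b: "\<And>y. y \<in> fib j x \<Longrightarrow> b y \<in> fib j x' \<and> same j y (b y)" by metis
  have "\<exists>y'\<in>fib j x. same j y y'" if "y \<in> fib j x'" for y
    using lift_fibre[of y j x] that same_sym[OF assms] by (auto simp: fib_def)
  then obtain c where c: "\<And>y. y \<in> fib j x' \<Longrightarrow> c y \<in> fib j x \<and> same j y (c y)" by metis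
  have u: "y = y'" if "y \<in> fib j z" "y' \<in> fib j z" "same j y y'" for y y' z
    using that by (intro same_fibre_unique[of y y' j]) (auto simp: fib_def)
  have "bij_betw b (fib j x) (fib j x')"
  proof (rule bij_betwI)
    show "b \<in> fib j x \<rightarrow> fib j x'" "c \<in> fib j x' \<rightarrow> fib j x" using b c by auto
    show "c (b y) = y" if "y \<in> fib j x" for y
      using u[of y x "c (b y)"] b[OF that] c[of "b y"] that same_trans by metis
    show "b (c y) = y" if "y \<in> fib j x'" for y
      using u[of y x' "b (c y)"] c[OF that] b[of "c y"] that same_trans by metis
  qed
  then show thesis using b that by blast
qed

end

section \<open>Weighted oscillation\<close>

text \<open>The tangent inequality at the mean over Q is integrated over Q. A zero mean or an
  infinite right-hand side is trivial and is split off, so that the rest takes place among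
  integrable functions.\<close>

lemma (in prob_space) jensen_powr_set:
  fixes g :: "'a \<Rightarrow> real"
  assumes p: "1 \<le> p" and [measurable]: "g \<in> borel_measurable M" "Q \<in> sets M"
    and g0: "\<And>x. 0 \<le> g x" and Q: "0 < measure M Q"
    and int: "integrable M (\<lambda>x. indicator Q x * g x)"
  shows "ennreal (measure M Q * ((\<integral>x. indicator Q x * g x \<partial>M) / measure M Q) powr p)
     \<le> (\<integral>\<^sup>+x. indicator Q x * ennreal (g x powr p) \<partial>M)"
proof -
  define m where "m = (\<integral>x. indicator Q x * g x \<partial>M) / measure M Q"
  have m0: "m \<ge> 0" unfolding m_def using g0 Q by (intro divide_nonneg_pos integral_nonneg_AE) auto
  have eq: "(\<integral>\<^sup>+x. indicator Q x * ennreal (g x powr p) \<partial>M) = (\<integral>\<^sup>+x. ennreal (indicator Q x * g x powr p) \<partial>M)"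
    by (intro nn_integral_cong) (auto split: split_indicator)
  show ?thesis
  proof (cases "m = 0 \<or> (\<integral>\<^sup>+x. ennreal (indicator Q x * g x powr p) \<partial>M) = \<infinity>")
    case True
    then show ?thesis unfolding m_def[symmetric] eq using p by auto
  next
    case False
    then have m: "m > 0" using m0 by simp
    have int': "integrable M (\<lambda>x. indicator Q x * g x powr p)"
      using False by (intro integrableI_bounded) (auto simp: less_top)
    have intQ: "integrable M (\<lambda>x. indicator Q x :: real)" by (simp add: integrable_indicator_iff emeasure_eq_measure)
    have "measure M Q * m powr p = (\<integral>x. (m powr p - p * m powr (p - 1) * m) * indicator Q x
        + p * m powr (p - 1) * (indicator Q x * g x) \<partial>M)"
    proof -
      have "(\<integral>x. indicator Q x * g x \<partial>M) = m * measure M Q" using Q by (simp add: m_def)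
      then have "(\<integral>x. (m powr p - p * m powr (p - 1) * m) * indicator Q x
          + p * m powr (p - 1) * (indicator Q x * g x) \<partial>M)
        = (m powr p - p * m powr (p - 1) * m) * measure M Q + p * m powr (p - 1) * (m * measure M Q)"
        using int intQ by simp
      then show ?thesis by (simp add: algebra_simps)
    qed
    also have "\<dots> \<le> (\<integral>x. indicator Q x * g x powr p \<partial>M)"
    proof (intro integral_mono int')
      show "integrable M (\<lambda>x. (m powr p - p * m powr (p - 1) * m) * indicator Q x
        + p * m powr (p - 1) * (indicator Q x * g x))" using int intQ by auto
      fix x
      show "(m powr p - p * m powr (p - 1) * m) * indicator Q x + p * m powr (p - 1) * (indicator Q x * g x)
         \<le> indicator Q x * g x powr p"
        using powr_ge_tangent[OF p g0 m, of x] by (auto split: split_indicator simp: algebra_simps)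
    qed
    finally have "ennreal (measure M Q * m powr p) \<le> ennreal (\<integral>x. indicator Q x * g x powr p \<partial>M)"
      by (rule ennreal_leI)
    then show ?thesis unfolding m_def[symmetric] eq
      by (subst nn_integral_eq_integral[OF int']) auto
  qed
qed

lemma (in prob_space) Lp_le_nn_integral:
  assumes "Lp_le M p g a" "1 \<le> p"
  shows "(\<integral>\<^sup>+x. ennreal \<bar>g x\<bar> \<partial>M) \<le> ennreal a" "integrable M g"
proof -
  have [measurable]: "g \<in> borel_measurable M" and a: "0 \<le> a" using assms by (auto simp: Lp_le_def)
  \<comment> \<open>A crude bound that only secures integrability; Jensen's inequality on the whole
    space then gives the constant 1.\<close>
  have "\<bar>g x\<bar> \<le> 1 + \<bar>g x\<bar> powr p" for x
  proof (cases "\<bar>g x\<bar> \<le> 1")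
    case False
    then have "\<bar>g x\<bar> powr 1 \<le> \<bar>g x\<bar> powr p" using assms(2) by (intro powr_mono) auto
    then show ?thesis using False by simp
  qed (simp add: add_increasing2)
  then have "(\<integral>\<^sup>+x. ennreal \<bar>g x\<bar> \<partial>M) \<le> (\<integral>\<^sup>+x. 1 + ennreal (\<bar>g x\<bar> powr p) \<partial>M)"
    by (intro nn_integral_mono) (auto simp: ennreal_1[symmetric] ennreal_plus[symmetric] simp del: ennreal_1 ennreal_plus intro!: ennreal_leI)
  also have "\<dots> = 1 + (\<integral>\<^sup>+x. ennreal (\<bar>g x\<bar> powr p) \<partial>M)"
    by (subst nn_integral_add) (auto simp: emeasure_space_1)
  also have "\<dots> \<le> 1 + ennreal (a powr p)" using Lp_leD(3)[OF assms(1)] by (intro add_left_mono)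
  also have "\<dots> < \<infinity>" by simp
  finally have fin: "(\<integral>\<^sup>+x. ennreal \<bar>g x\<bar> \<partial>M) < \<infinity>" .
  then show int: "integrable M g" by (intro integrableI_bounded) auto
  have "ennreal ((\<integral>x. \<bar>g x\<bar> \<partial>M) powr p) \<le> (\<integral>\<^sup>+x. ennreal (\<bar>g x\<bar> powr p) \<partial>M)"
  proof -
    have 1: "(\<integral>x. indicator (space M) x * \<bar>g x\<bar> \<partial>M) = (\<integral>x. \<bar>g x\<bar> \<partial>M)"
      by (intro Bochner_Integration.integral_cong) auto
    have 2: "(\<integral>\<^sup>+x. indicator (space M) x * ennreal (\<bar>g x\<bar> powr p) \<partial>M) = (\<integral>\<^sup>+x. ennreal (\<bar>g x\<bar> powr p) \<partial>M)"
      by (intro nn_integral_cong) auto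
    have 3: "integrable M (\<lambda>x. indicator (space M) x * \<bar>g x\<bar>)"
      using integrable_mult_indicator[OF sets.top integrable_abs[OF int]] by simp
    show ?thesis
      using jensen_powr_set[OF assms(2), of "\<lambda>x. \<bar>g x\<bar>" "space M"] 3 unfolding 1 2 by (simp add: prob_space)
  qed
  also have "\<dots> \<le> ennreal (a powr p)" using Lp_leD(3)[OF assms(1)] .
  finally have "(\<integral>x. \<bar>g x\<bar> \<partial>M) powr p \<le> a powr p" by (simp add: ennreal_le_iff)
  then have "(\<integral>x. \<bar>g x\<bar> \<partial>M) \<le> a"
    using a assms(2) powr_less_mono2[of p a "\<integral>x. \<bar>g x\<bar> \<partial>M"] by (meson linorder_not_less less_le_trans zero_less_one)
  then show "(\<integral>\<^sup>+x. ennreal \<bar>g x\<bar> \<partial>M) \<le> ennreal a"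
    using int by (subst nn_integral_eq_integral) (auto intro: ennreal_leI)
qed

locale besov_map = markovian_expanding_map M n U f w \<beta> \<epsilon>
  for M :: "'a measure" and n U f w \<beta> \<epsilon> +
  fixes s p :: real and q :: ereal
  assumes p_ge_1: "1 \<le> p" and q_ge_1: "1 \<le> q" and s_pos: "0 < s" and s_less: "s < \<beta>"
begin

definition cell_sum :: "nat \<Rightarrow> ('a set \<Rightarrow> complex) \<Rightarrow> 'a \<Rightarrow> complex" where
  "cell_sum k v x = (\<Sum>Q\<in>grid k. indicator Q x * v Q)"

definition avg :: "('a \<Rightarrow> complex) \<Rightarrow> 'a set \<Rightarrow> complex" where
  "avg \<psi> Q = (\<integral>x. indicator Q x * \<psi> x \<partial>M) / of_real (measure M Q)"

definition cexp :: "nat \<Rightarrow> ('a \<Rightarrow> complex) \<Rightarrow> 'a \<Rightarrow> complex" where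
  "cexp k \<psi> = cell_sum k (avg \<psi>)"

text \<open>
  Norms are replaced by statements ``the norm is at most \<open>a\<close>'', so that no finiteness has to be
  assumed: \<open>wn k g a\<close> bounds the \<open>L\<^sup>p\<close> norm of \<open>\<bar>Q\<^sub>k(x)\<bar>\<^sup>-\<^sup>s g(x)\<close>, where \<open>Q\<^sub>k(x)\<close> is the cell of
  level \<open>k\<close> containing \<open>x\<close>, and below \<open>Bes \<psi> A\<close> bounds the norm that is equivalent to the Besov norm.
\<close>

definition wn :: "nat \<Rightarrow> ('a \<Rightarrow> complex) \<Rightarrow> real \<Rightarrow> bool" where
  "wn k g a \<longleftrightarrow> g \<in> borel_measurable M \<and> Lp_le M p (\<lambda>x. cyl_meas k x powr (- s) * cmod (g x)) a"

lemma sum_grid_indicator: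
  fixes v :: "'a set \<Rightarrow> 'b::comm_semiring_1"
  assumes "x \<in> D" shows "(\<Sum>Q\<in>grid k. indicator Q x * v Q) = v (cyl k x)"
proof -
  have "(\<Sum>Q\<in>grid k. indicator Q x * v Q) = (\<Sum>Q\<in>grid k. if Q = cyl k x then v Q else 0)"
  proof (intro sum.cong refl)
    fix Q assume "Q \<in> grid k"
    then show "indicator Q x * v Q = (if Q = cyl k x then v Q else 0)"
      using grid_member[of Q k x] assms cyl_self[OF assms, of k] by (cases "x \<in> Q") auto
  qed
  then show ?thesis using finite_grid grid_cyl[OF assms] by simp
qed

lemma cell_sum_eq: "x \<in> D \<Longrightarrow> cell_sum k v x = v (cyl k x)"
  unfolding cell_sum_def by (rule sum_grid_indicator)

lemma cell_sum_measurable [measurable]: "cell_sum k v \<in> borel_measurable M"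
proof -
  have "(\<lambda>x. indicator Q x * v Q) \<in> borel_measurable M" if "Q \<in> grid k" for Q
    using sets_grid[OF that] by measurable
  then show ?thesis unfolding cell_sum_def[abs_def] by (intro borel_measurable_sum)
qed

lemma cexp_measurable [measurable]: "cexp k \<psi> \<in> borel_measurable M"
  unfolding cexp_def by (rule cell_sum_measurable)

lemma cyl_meas_measurable [measurable]: "cyl_meas k \<in> borel_measurable M"
proof -
  have "cyl_meas k x = (\<Sum>Q\<in>grid k. indicator Q x * measure M Q)" if "x \<in> space M" for x
  proof (cases "x \<in> D")
    case True
    then show ?thesis by (simp add: sum_grid_indicator cyl_meas_def)
  next
    case False
    show ?thesis
    proof (cases k)
      case 0
      then show ?thesis using that by (simp add: cyl_meas_0 prob_space)
    next
      case (Suc l)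
      \<comment> \<open>Outside \<open>D\<close> no cell of positive level contains x and
        \<open>cyl_meas\<close> is 0 there. The finite sum therefore agrees with it at every point
        of the space, as measurability demands.\<close>
      have "cyl k x = {}" using False Suc same_in_D[OF same_sym] by (force simp: cyl_def)
      moreover have "x \<notin> Q" if "Q \<in> grid k" for Q
        using that False Suc same_in_D by (auto simp: grid_eq cyl_def)
      ultimately show ?thesis by (auto simp: cyl_meas_def intro!: sum.neutral[symmetric])
    qed
  qed
  moreover have "(\<lambda>x. indicator Q x * measure M Q) \<in> borel_measurable M" if "Q \<in> grid k" for Q
    using sets_grid[OF that] by measurable
  then have "(\<lambda>x. \<Sum>Q\<in>grid k. indicator Q x * measure M Q) \<in> borel_measurable M"
    by (intro borel_measurable_sum)
  ultimately show ?thesis by (subst measurable_cong)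
qed

lemma nn_integral_grid:
  assumes [measurable]: "F \<in> borel_measurable M"
  shows "(\<integral>\<^sup>+x. F x \<partial>M) = (\<Sum>Q\<in>grid k. \<integral>\<^sup>+x. indicator Q x * F x \<partial>M)"
proof -
  have m: "(\<lambda>x. indicator Q x * F x) \<in> borel_measurable M" if "Q \<in> grid k" for Q
    using sets_grid[OF that] by measurable
  have "(\<integral>\<^sup>+x. F x \<partial>M) = (\<integral>\<^sup>+x. (\<Sum>Q\<in>grid k. indicator Q x * F x) \<partial>M)"
    by (intro nn_integral_cong_AE eventually_mono[OF AE_D]) (simp add: sum_grid_indicator)
  also have "\<dots> = (\<Sum>Q\<in>grid k. \<integral>\<^sup>+x. indicator Q x * F x \<partial>M)"
    by (rule nn_integral_sum[OF m])
  finally show ?thesis .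
qed

lemma wn_measurable: "wn k g a \<Longrightarrow> g \<in> borel_measurable M"
  by (simp add: wn_def)

lemma wn_nonneg: "wn k g a \<Longrightarrow> 0 \<le> a"
  by (simp add: wn_def Lp_le_def)

lemma wn_0: "wn 0 g a \<longleftrightarrow> g \<in> borel_measurable M \<and> Lp_le M p (\<lambda>x. cmod (g x)) a"
  by (simp add: wn_def cyl_meas_0)

lemma wn_mono:
  assumes "wn k g a" "r \<in> borel_measurable M" "\<And>x. x \<in> D \<Longrightarrow> cmod (r x) \<le> cmod (g x)" "a \<le> b"
  shows "wn k r b"
proof -
  have [measurable]: "r \<in> borel_measurable M" by (rule assms)
  have "Lp_le M p (\<lambda>x. cyl_meas k x powr (- s) * cmod (r x)) b"
  proof (rule Lp_le_mono)
    show "Lp_le M p (\<lambda>x. cyl_meas k x powr (- s) * cmod (g x)) a" using assms(1) by (simp add: wn_def)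
    show "AE x in M. \<bar>cyl_meas k x powr (- s) * cmod (r x)\<bar> \<le> \<bar>cyl_meas k x powr (- s) * cmod (g x)\<bar>"
      by (rule eventually_mono[OF AE_D]) (simp add: assms(3) mult_left_mono)
  qed (use p_ge_1 assms in auto)
  then show ?thesis by (simp add: wn_def)
qed

lemma wn_cong_AE:
  assumes "wn k g a" "r \<in> borel_measurable M" "AE x in M. r x = g x"
  shows "wn k r a"
proof -
  have [measurable]: "r \<in> borel_measurable M" by (rule assms)
  have "Lp_le M p (\<lambda>x. cyl_meas k x powr (- s) * cmod (r x)) a"
    using assms(1) unfolding wn_def
    by (rule Lp_le_mono[OF conjunct2]) (use assms(3) p_ge_1 in \<open>auto elim: eventually_mono\<close>)
  then show ?thesis by (simp add: wn_def)
qed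

lemma wn_add_le:
  assumes "wn k g a" "wn k h' b" "r \<in> borel_measurable M"
    "\<And>x. x \<in> D \<Longrightarrow> cmod (r x) \<le> cmod (g x) + cmod (h' x)"
  shows "wn k r (a + b)"
proof -
  have [measurable]: "r \<in> borel_measurable M" by (rule assms)
  have "Lp_le M p (\<lambda>x. cyl_meas k x powr (- s) * cmod (r x)) (a + b)"
  proof (rule Lp_le_mono)
    show "Lp_le M p (\<lambda>x. \<bar>cyl_meas k x powr (- s) * cmod (g x)\<bar> + \<bar>cyl_meas k x powr (- s) * cmod (h' x)\<bar>) (a + b)"
      using assms p_ge_1 by (intro Lp_le_add) (auto simp: wn_def)
    show "AE x in M. \<bar>cyl_meas k x powr (- s) * cmod (r x)\<bar>
        \<le> \<bar>\<bar>cyl_meas k x powr (- s) * cmod (g x)\<bar> + \<bar>cyl_meas k x powr (- s) * cmod (h' x)\<bar>\<bar>"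
    proof (rule eventually_mono[OF AE_D])
      fix x assume "x \<in> D"
      then have "cyl_meas k x powr (- s) * cmod (r x) \<le> cyl_meas k x powr (- s) * (cmod (g x) + cmod (h' x))"
        by (intro mult_left_mono assms(4)) auto
      then show "\<bar>cyl_meas k x powr (- s) * cmod (r x)\<bar>
        \<le> \<bar>\<bar>cyl_meas k x powr (- s) * cmod (g x)\<bar> + \<bar>cyl_meas k x powr (- s) * cmod (h' x)\<bar>\<bar>"
        by (simp add: abs_mult distrib_left)
    qed
  qed (use p_ge_1 in auto)
  then show ?thesis by (simp add: wn_def)
qed

lemma wn_add: "wn k g a \<Longrightarrow> wn k h' b \<Longrightarrow> wn k (\<lambda>x. g x + h' x) (a + b)"
  by (rule wn_add_le) (auto simp: wn_def norm_triangle_ineq intro: borel_measurable_add)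

lemma wn_cmult:
  assumes "wn k g a" shows "wn k (\<lambda>x. c * g x) (cmod c * a)"
proof -
  have [measurable]: "g \<in> borel_measurable M" using assms by (rule wn_measurable)
  have "Lp_le M p (\<lambda>x. cmod c * (cyl_meas k x powr (- s) * cmod (g x))) (\<bar>cmod c\<bar> * a)"
    using assms by (intro Lp_le_cmult) (simp add: wn_def)
  then show ?thesis by (simp add: wn_def norm_mult mult_ac)
qed

lemma wn_level:
  assumes "wn m g a" "0 \<le> c" "\<And>x. x \<in> D \<Longrightarrow> cyl_meas k x powr (- s) \<le> c * cyl_meas m x powr (- s)"
  shows "wn k g (c * a)"
proof -
  have [measurable]: "g \<in> borel_measurable M" using assms(1) by (rule wn_measurable)
  have "Lp_le M p (\<lambda>x. cyl_meas k x powr (- s) * cmod (g x)) (\<bar>c\<bar> * a)"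
  proof (rule Lp_le_mono[OF Lp_le_cmult])
    show "Lp_le M p (\<lambda>x. cyl_meas m x powr (- s) * cmod (g x)) a" using assms by (simp add: wn_def)
    show "AE x in M. \<bar>cyl_meas k x powr (- s) * cmod (g x)\<bar> \<le> \<bar>c * (cyl_meas m x powr (- s) * cmod (g x))\<bar>"
    proof (rule eventually_mono[OF AE_D])
      fix x assume "x \<in> D"
      from mult_right_mono[OF assms(3)[OF this], of "cmod (g x)"] assms(2)
      show "\<bar>cyl_meas k x powr (- s) * cmod (g x)\<bar> \<le> \<bar>c * (cyl_meas m x powr (- s) * cmod (g x))\<bar>"
        by (simp add: abs_mult mult.assoc)
    qed
  qed (use p_ge_1 in auto)
  then show ?thesis using assms(2) by (simp add: wn_def)
qed

text \<open>All three are s-th powers of ratios of cell measures, taken because the weights are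
  |Q|^(-s): \<open>decayC\<close> is the distortion loss, \<theta> = (inf w)^(-s) the gain per level
  when an estimate is used at a coarser level, and \<open>growC\<close> the price of one finer
  level.\<close>

definition decayC :: real where "decayC = (distC\<^sup>2) powr s"
definition \<theta> :: real where "\<theta> = contr powr s"
definition growC :: real where "growC = (distC\<^sup>2 / minU) powr s"

lemma decayC: "1 \<le> decayC"
proof -
  have "1 \<le> distC\<^sup>2" using distC(1) by simp
  then show ?thesis unfolding decayC_def using s_pos by (intro ge_one_powr_ge_zero) auto
qed

lemma theta: "0 < \<theta>" "\<theta> < 1"
  using contr_bounds s_pos powr_less_mono2[of s contr 1] by (auto simp: \<theta>_def)

lemma growC: "0 < growC"
  using distC(1) minU_pos by (auto simp: growC_def)

lemma powr_neg_le:
  assumes "0 < a" "0 < b" "0 < c" "a \<le> c * b"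
  shows "b powr (- s) \<le> c powr s * a powr (- s)"
proof -
  have "(c * b) powr (- s) \<le> a powr (- s)"
    using assms s_pos by (intro powr_mono2') auto
  then have "c powr s * (c powr (- s) * b powr (- s)) \<le> c powr s * a powr (- s)"
    using assms by (intro mult_left_mono) (auto simp: powr_mult)
  moreover have "c powr s * c powr (- s) = 1" using assms by (simp add: powr_minus)
  ultimately show ?thesis by (simp add: mult.assoc[symmetric])
qed

lemma contr_power_powr: "(contr ^ i) powr r = (contr powr r) ^ i"
proof -
  have "(contr ^ i) powr r = (contr powr real i) powr r" using contr_bounds by (simp add: powr_realpow)
  also have "\<dots> = (contr powr r) powr real i" by (simp add: powr_powr mult.commute)
  also have "\<dots> = (contr powr r) ^ i" using contr_bounds by (simp add: powr_realpow)
  finally show ?thesis .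
qed

text \<open>Cells of a coarser level are larger and their weights smaller, by a factor \<theta> for
  each level up to distortion.\<close>

lemma wn_coarser:
  assumes "wn (k + i) g a" shows "wn k g (decayC * \<theta> ^ i * a)"
proof (rule wn_level[OF assms])
  fix x assume x: "x \<in> D"
  have "cyl_meas k x powr (- s) \<le> (distC\<^sup>2 * contr ^ i) powr s * cyl_meas (k + i) x powr (- s)"
    using cyl_meas_shrink[OF x] cyl_meas_pos[OF x] contr_bounds distC(1)
    by (intro powr_neg_le) auto
  also have "(distC\<^sup>2 * contr ^ i) powr s = decayC * \<theta> ^ i"
    using contr_bounds distC(1) by (simp add: powr_mult decayC_def contr_power_powr \<theta>_def)
  finally show "cyl_meas k x powr (- s) \<le> decayC * \<theta> ^ i * cyl_meas (k + i) x powr (- s)" .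
qed (use decayC theta in auto)

lemma wn_antimono:
  assumes "wn m g a" "k \<le> m" shows "wn k g a"
proof -
  have "wn k g (1 * a)"
  proof (rule wn_level[OF assms(1)])
    fix x assume x: "x \<in> D"
    then show "cyl_meas k x powr (- s) \<le> 1 * cyl_meas m x powr (- s)"
      using cyl_meas_mono[OF x assms(2)] cyl_meas_pos[OF x] s_pos by (auto intro: powr_mono2')
  qed simp
  then show ?thesis by simp
qed

lemma wn_Suc:
  assumes "wn k g a" shows "wn (Suc k) g (growC * a)"
proof (rule wn_level[OF assms])
  fix x assume x: "x \<in> D"
  have "cyl_meas k x \<le> (distC\<^sup>2 / minU) * cyl_meas (Suc k) x"
    using cyl_meas_Suc_ge[OF x, of k] minU_pos by (simp add: field_simps)
  then show "cyl_meas (Suc k) x powr (- s) \<le> growC * cyl_meas k x powr (- s)"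
    unfolding growC_def using cyl_meas_pos[OF x] minU_pos distC(1) by (intro powr_neg_le) auto
qed (use growC in auto)

text \<open>The constant grows exponentially with the level, so this is applied only where the level
  is fixed before an error tends to 0 or where finitely many levels matter.\<close>

lemma wn_finer:
  assumes "wn 0 g a" shows "wn k g (growC ^ k * a)"
proof (induction k)
  case (Suc k)
  from wn_Suc[OF this] show ?case by (simp add: mult.assoc)
qed (use assms in simp)

lemma wn_closed:
  assumes "\<And>e. e > 0 \<Longrightarrow> wn k g (a + e)" "0 \<le> a"
  shows "wn k g a"
  using assms p_ge_1 Lp_le_closed[of M p "\<lambda>x. cyl_meas k x powr (- s) * cmod (g x)" a] assms(1)[of 1]
  by (simp add: wn_def)

lemma wn_integrable:
  assumes "wn k g a" shows "integrable M g"
proof -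
  have [measurable]: "g \<in> borel_measurable M" using assms by (rule wn_measurable)
  have "Lp_le M p (\<lambda>x. cmod (g x)) a" using wn_antimono[OF assms, of 0] by (simp add: wn_0)
  from Lp_le_nn_integral(2)[OF this p_ge_1] show ?thesis by (subst (asm) integrable_norm_iff) auto
qed

section \<open>Averages over cells and approximation by functions constant on cells\<close>

lemma integrable_indicator_mult:
  fixes g :: "'a \<Rightarrow> complex"
  assumes "integrable M g" "Q \<in> sets M" shows "integrable M (\<lambda>x. indicator Q x * g x)"
proof -
  have "(\<lambda>x. indicator Q x *\<^sub>R g x) = (\<lambda>x. indicator Q x * g x)" by (auto split: split_indicator)
  then show ?thesis using integrable_mult_indicator[OF assms(2,1)] by simp
qed

lemma measure_grid_pos: "Q \<in> grid k \<Longrightarrow> 0 < measure M Q"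
  using cyl_meas_pos by (auto simp: grid_eq cyl_meas_def)

lemma avg_diff:
  assumes "integrable M g" "integrable M g'" "Q \<in> sets M"
  shows "avg (\<lambda>x. g x - g' x) Q = avg g Q - avg g' Q"
  unfolding avg_def using assms by (simp add: right_diff_distrib integrable_indicator_mult diff_divide_distrib)

lemma avg_lincomb:
  assumes "integrable M g" "integrable M g'" "Q \<in> sets M"
  shows "avg (\<lambda>x. a * g x + b * g' x) Q = a * avg g Q + b * avg g' Q"
proof -
  have "(\<lambda>x. indicator Q x * (a * g x + b * g' x)) = (\<lambda>x. a * (indicator Q x * g x) + b * (indicator Q x * g' x))"
    by (auto simp: algebra_simps)
  then show ?thesis unfolding avg_def using assms by (simp add: integrable_indicator_mult add_divide_distrib)
qed

lemma avg_cell_sum: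
  assumes "Q \<in> grid k" shows "avg (cell_sum k v) Q = v Q"
proof -
  have [measurable]: "Q \<in> sets M" using assms by (rule sets_grid)
  have "(\<integral>x. indicator Q x * cell_sum k v x \<partial>M) = (\<integral>x. indicator Q x * v Q \<partial>M)"
    by (intro integral_cong_AE eventually_mono[OF AE_D])
      (use grid_member[OF assms] in \<open>auto simp: cell_sum_eq split: split_indicator\<close>)
  also have "\<dots> = of_real (measure M Q) * v Q"
  proof -
    have eq: "(\<lambda>x. indicator Q x * v Q) = (\<lambda>x. indicat_real Q x *\<^sub>R v Q)" by (auto split: split_indicator)
    have "integrable M (indicat_real Q)" by (simp add: integrable_indicator_iff emeasure_eq_measure)
    then show ?thesis unfolding eq by (subst integral_scaleR_left) (auto simp: scaleR_conv_of_real)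
  qed
  finally show ?thesis using measure_grid_pos[OF assms] by (simp add: avg_def)
qed

lemma cell_sum_integrable: "integrable M (cell_sum k v)"
proof -
  have "integrable M (\<lambda>x. indicator Q x * v Q)" if "Q \<in> grid k" for Q
    using integrable_indicator_mult[of "\<lambda>_. v Q"] sets_grid[OF that] by simp
  then show ?thesis unfolding cell_sum_def[abs_def] by (intro Bochner_Integration.integrable_sum)
qed

text \<open>The weight is constant on each cell of level k, so it commutes with averaging there and
  Jensen's inequality applies cell by cell without loss.\<close>

lemma wn_cexp:
  assumes "wn k g a" shows "wn k (cexp k g) a"
proof -
  have [measurable]: "g \<in> borel_measurable M" using assms by (rule wn_measurable)
  have int: "integrable M g" using assms by (rule wn_integrable)
  have loc: "(\<integral>\<^sup>+x. indicator Q x * ennreal (\<bar>cyl_meas k x powr (- s) * cmod (cexp k g x)\<bar> powr p) \<partial>M)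
     \<le> (\<integral>\<^sup>+x. indicator Q x * ennreal (\<bar>cyl_meas k x powr (- s) * cmod (g x)\<bar> powr p) \<partial>M)"
    if Q: "Q \<in> grid k" for Q
  proof -
    have [measurable]: "Q \<in> sets M" using Q by (rule sets_grid)
    have Qp: "0 < measure M Q" using Q by (rule measure_grid_pos)
    define c where "c = (measure M Q powr (- s)) powr p"
    have c0: "c \<ge> 0" by (simp add: c_def)
    have pt: "indicator Q x * ennreal (\<bar>cyl_meas k x powr (- s) * r\<bar> powr p) = ennreal c * (indicator Q x * ennreal (r powr p))"
      if "x \<in> D" "r \<ge> 0" for x and r :: real
      using grid_member[OF Q _ that(1)] that(2)
      by (auto simp: cyl_meas_def c_def powr_mult ennreal_mult abs_mult split: split_indicator)
    have intn: "integrable M (\<lambda>x. indicator Q x * cmod (g x))"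
    proof -
      have "(\<lambda>x. indicator Q x * cmod (g x)) = (\<lambda>x. cmod (indicator Q x * g x))" by (auto split: split_indicator)
      then show ?thesis using integrable_norm[OF integrable_indicator_mult[OF int]] by simp
    qed
    have "cmod (avg g Q) \<le> (\<integral>x. indicator Q x * cmod (g x) \<partial>M) / measure M Q"
    proof -
      have "cmod (\<integral>x. indicator Q x * g x \<partial>M) \<le> (\<integral>x. cmod (indicator Q x * g x) \<partial>M)" by (rule integral_norm_bound)
      also have "(\<lambda>x. cmod (indicator Q x * g x)) = (\<lambda>x. indicator Q x * cmod (g x))" by (auto split: split_indicator)
      finally show ?thesis unfolding avg_def using Qp by (simp add: norm_divide divide_right_mono)
    qed
    then have jen: "ennreal (measure M Q * cmod (avg g Q) powr p) \<le> (\<integral>\<^sup>+x. indicator Q x * ennreal (cmod (g x) powr p) \<partial>M)"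
      using p_ge_1 Qp
      by (intro order_trans[OF _ jensen_powr_set[OF p_ge_1 _ _ _ Qp intn]] ennreal_leI mult_left_mono powr_mono2) auto
    have "(\<integral>\<^sup>+x. indicator Q x * ennreal (\<bar>cyl_meas k x powr (- s) * cmod (cexp k g x)\<bar> powr p) \<partial>M)
       = (\<integral>\<^sup>+x. ennreal c * ennreal (cmod (avg g Q) powr p) * indicator Q x \<partial>M)"
    proof (intro nn_integral_cong_AE eventually_mono[OF AE_D])
      fix x assume x: "x \<in> D"
      show "indicator Q x * ennreal (\<bar>cyl_meas k x powr (- s) * cmod (cexp k g x)\<bar> powr p)
        = ennreal c * ennreal (cmod (avg g Q) powr p) * indicator Q x"
        unfolding pt[OF x norm_ge_zero]
        using grid_member[OF Q _ x] by (auto simp: cexp_def cell_sum_eq[OF x] split: split_indicator)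
    qed
    also have "\<dots> = ennreal c * (ennreal (cmod (avg g Q) powr p) * ennreal (measure M Q))"
      by (subst nn_integral_cmult_indicator) (auto simp: emeasure_eq_measure mult.assoc)
    also have "ennreal (cmod (avg g Q) powr p) * ennreal (measure M Q) = ennreal (measure M Q * cmod (avg g Q) powr p)"
      by (simp add: ennreal_mult mult.commute)
    also have "ennreal c * \<dots> \<le> ennreal c * (\<integral>\<^sup>+x. indicator Q x * ennreal (cmod (g x) powr p) \<partial>M)"
      using jen by (rule mult_left_mono) simp
    also have "\<dots> = (\<integral>\<^sup>+x. ennreal c * (indicator Q x * ennreal (cmod (g x) powr p)) \<partial>M)"
      by (rule nn_integral_cmult[symmetric]) simp
    also have "\<dots> = (\<integral>\<^sup>+x. indicator Q x * ennreal (\<bar>cyl_meas k x powr (- s) * cmod (g x)\<bar> powr p) \<partial>M)"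
      by (intro nn_integral_cong_AE eventually_mono[OF AE_D]) (rule pt[OF _ norm_ge_zero, symmetric])
    finally show ?thesis .
  qed
  have "(\<integral>\<^sup>+x. ennreal (\<bar>cyl_meas k x powr (- s) * cmod (cexp k g x)\<bar> powr p) \<partial>M)
      \<le> (\<integral>\<^sup>+x. ennreal (\<bar>cyl_meas k x powr (- s) * cmod (g x)\<bar> powr p) \<partial>M)"
    using loc by (subst (1 2) nn_integral_grid[of _ k]) (auto intro!: sum_mono)
  also have "\<dots> \<le> ennreal (a powr p)" using assms by (simp add: wn_def Lp_le_def)
  finally show ?thesis using wn_nonneg[OF assms] by (simp add: wn_def Lp_le_def)
qed

text \<open>Averaging reproduces a function constant on the cells, so psi - E_k psi is the
  difference of (psi - v) and its average. Up to the factor 2, any convenient cell function may thus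
  replace the average.\<close>

lemma wn_osc_le:
  assumes "wn k (\<lambda>x. \<psi> x - cell_sum k v x) a" "integrable M \<psi>"
  shows "wn k (\<lambda>x. \<psi> x - cexp k \<psi> x) (2 * a)"
proof -
  have [measurable]: "\<psi> \<in> borel_measurable M" using assms(2) by simp
  have "wn k (\<lambda>x. \<psi> x - cexp k \<psi> x) (a + a)"
  proof (rule wn_add_le[OF assms(1) wn_cexp[OF assms(1)]])
    fix x assume x: "x \<in> D"
    have "cexp k (\<lambda>x. \<psi> x - cell_sum k v x) x = cexp k \<psi> x - cell_sum k v x"
      unfolding cexp_def cell_sum_eq[OF x]
      using assms(2) cell_sum_integrable sets_cyl[OF x] avg_cell_sum grid_cyl[OF x] by (subst avg_diff) auto
    moreover have "cmod (\<psi> x - cexp k \<psi> x) \<le> cmod (\<psi> x - cell_sum k v x) + cmod (cexp k \<psi> x - cell_sum k v x)"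
      using norm_triangle_ineq4[of "\<psi> x - cell_sum k v x" "cexp k \<psi> x - cell_sum k v x"] by simp
    ultimately show "cmod (\<psi> x - cexp k \<psi> x) \<le> cmod (\<psi> x - cell_sum k v x) + cmod (cexp k (\<lambda>x. \<psi> x - cell_sum k v x) x)"
      by simp
  qed measurable
  then show ?thesis by simp
qed

section \<open>The iterated operator and weighted oscillations\<close>

abbreviation T :: "('a \<Rightarrow> complex) \<Rightarrow> 'a \<Rightarrow> complex" where
  "T \<equiv> transfer_operator n U f w"

text \<open>A representative of the cell in \<open>D\<close>. It lets a function that is constant on
  cells be rewritten as a \<open>cell_sum\<close> of a chosen level.\<close>

definition cell_point :: "'a set \<Rightarrow> 'a" where
  "cell_point W = (SOME x. x \<in> D \<and> x \<in> W)"

lemma cell_point: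
  assumes "x \<in> D"
  shows "cell_point (cyl k x) \<in> D" "same k x (cell_point (cyl k x))"
proof -
  have "\<exists>y. y \<in> D \<and> y \<in> cyl k x" using assms cyl_self by blast
  from someI_ex[OF this] show "cell_point (cyl k x) \<in> D" "same k x (cell_point (cyl k x))"
    by (auto simp: cell_point_def cyl_def)
qed

text \<open>
  Up to a factor independent of \<open>j\<close>, the constant \<open>\<tau>\<close> bounds the norm of \<open>\<Phi>\<^sup>j (1 - E\<^sub>j)\<close>. Hoelder's
  inequality on the fibre provides the value that appears in the theorem.
\<close>

definition fib_hoelder :: "nat \<Rightarrow> real \<Rightarrow> bool" where
  "fib_hoelder j \<tau> \<longleftrightarrow> 0 \<le> \<tau> \<and> (\<forall>x\<in>D. \<forall>a. (\<forall>y. 0 \<le> a y) \<longrightarrow>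
     (\<Sum>y\<in>fib j x. G j y * cyl_meas j y powr s * a y) powr p \<le> \<tau> powr p * (\<Sum>y\<in>fib j x. G j y * a y powr p))"

lemma fib_sum_ennreal:
  assumes "\<And>y. 0 \<le> H y"
  shows "(\<Sum>y\<in>fib j x. ennreal (G j y) * ennreal (H y)) = ennreal (\<Sum>y\<in>fib j x. G j y * H y)"
proof -
  have G0: "0 \<le> G j y" if "y \<in> fib j x" for y using that G_pos by (auto simp: fib_def less_imp_le)
  have "(\<Sum>y\<in>fib j x. ennreal (G j y) * ennreal (H y)) = (\<Sum>y\<in>fib j x. ennreal (G j y * H y))"
    using assms G0 by (intro sum.cong) (auto simp: ennreal_mult)
  then show ?thesis using assms G0 by (subst (asm) sum_ennreal) auto
qed

lemma fib_sum_nonneg: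
  assumes "\<And>y. 0 \<le> H y" shows "0 \<le> (\<Sum>y\<in>fib j x. G j y * H y)"
  using assms G_pos by (intro sum_nonneg) (auto simp: fib_def less_imp_le)

lemma fib_sum_measurable:
  assumes "H \<in> borel_measurable M" "\<And>y. 0 \<le> H y"
  shows "(\<lambda>x. \<Sum>y\<in>fib j x. G j y * H y) \<in> borel_measurable M"
proof -
  have "(\<lambda>x. enn2real (\<Sum>y\<in>fib j x. ennreal (G j y) * ennreal (H y))) \<in> borel_measurable M"
    using assms(1) by (intro borel_measurable_enn2real fib_sum_nn(1)) measurable
  then show ?thesis using assms(2) by (simp add: fib_sum_ennreal fib_sum_nonneg)
qed

text \<open>For f^j y = x quasi-multiplicativity bounds |Q_k(x)|^(-s) by \<open>decayC\<close>
  |Q_j(y)|^s |Q_{j+k}(y)|^(-s). The factor |Q_j(y)|^s is what \<open>fib_hoelder\<close> absorbs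
  into \<tau>, and preservation of the integral then moves the estimate from x to y at level j +
  k.\<close>

lemma fib_sum_bound:
  assumes "fib_hoelder j \<tau>" "H \<in> borel_measurable M" "\<And>y. 0 \<le> H y"
    "Lp_le M p (\<lambda>x. cyl_meas (j + k) x powr (- s) * H x) a"
  shows "Lp_le M p (\<lambda>x. cyl_meas k x powr (- s) * (\<Sum>y\<in>fib j x. G j y * H y)) (decayC * \<tau> * a)"
proof -
  note [measurable] = assms(2) fib_sum_measurable[OF assms(2,3)]
  have a: "0 \<le> a" and \<tau>: "0 \<le> \<tau>" using assms by (auto simp: Lp_le_def fib_hoelder_def)
  define g where "g y = cyl_meas (j + k) y powr (- s) * H y" for y
  have g0: "0 \<le> g y" for y using assms(3) by (simp add: g_def)
  have [measurable]: "g \<in> borel_measurable M" unfolding g_def[abs_def] by measurable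
  let ?c = "decayC * \<tau>"
  have c: "0 \<le> ?c" using decayC \<tau> by auto
  have pt: "(cyl_meas k x powr (- s) * (\<Sum>y\<in>fib j x. G j y * H y)) powr p
      \<le> ?c powr p * (\<Sum>y\<in>fib j x. G j y * g y powr p)" if x: "x \<in> D" for x
  proof -
    have "cyl_meas k x powr (- s) * (\<Sum>y\<in>fib j x. G j y * H y)
       \<le> (\<Sum>y\<in>fib j x. decayC * (G j y * cyl_meas j y powr s * g y))"
      unfolding sum_distrib_left
    proof (rule sum_mono)
      fix y assume "y \<in> fib j x"
      then have y: "y \<in> D" "(f ^^ j) y = x" by (auto simp: fib_def)
      have "cyl_meas (j + k) y \<le> (distC\<^sup>2 * cyl_meas j y) * cyl_meas k x"
        using cyl_meas_add_le[OF y(1), of j k] y(2) by (simp add: mult.assoc)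
      then have "cyl_meas k x powr (- s) \<le> (distC\<^sup>2 * cyl_meas j y) powr s * cyl_meas (j + k) y powr (- s)"
        using cyl_meas_pos[OF x] cyl_meas_pos[OF y(1)] distC(1) by (intro powr_neg_le) auto
      also have "\<dots> = decayC * cyl_meas j y powr s * cyl_meas (j + k) y powr (- s)"
        by (simp add: decayC_def powr_mult)
      finally have "cyl_meas k x powr (- s) * (G j y * H y)
          \<le> (decayC * cyl_meas j y powr s * cyl_meas (j + k) y powr (- s)) * (G j y * H y)"
        using assms(3) G_pos[OF y(1), of j] by (intro mult_right_mono) auto
      then show "cyl_meas k x powr (- s) * (G j y * H y) \<le> decayC * (G j y * cyl_meas j y powr s * g y)"
        by (simp add: g_def mult_ac)
    qed
    also have "\<dots> = decayC * (\<Sum>y\<in>fib j x. G j y * cyl_meas j y powr s * g y)"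
      by (simp add: sum_distrib_left)
    finally have "(cyl_meas k x powr (- s) * (\<Sum>y\<in>fib j x. G j y * H y)) powr p
       \<le> (decayC * (\<Sum>y\<in>fib j x. G j y * cyl_meas j y powr s * g y)) powr p"
      using fib_sum_nonneg[OF assms(3)] p_ge_1 by (intro powr_mono2) auto
    also have "\<dots> = decayC powr p * (\<Sum>y\<in>fib j x. G j y * cyl_meas j y powr s * g y) powr p"
      by (simp add: powr_mult)
    also have "\<dots> \<le> decayC powr p * (\<tau> powr p * (\<Sum>y\<in>fib j x. G j y * g y powr p))"
      using assms(1) x g0 by (intro mult_left_mono) (auto simp: fib_hoelder_def)
    also have "\<dots> = ?c powr p * (\<Sum>y\<in>fib j x. G j y * g y powr p)"
      by (simp add: powr_mult mult.assoc)
    finally show ?thesis .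
  qed
  have "(\<integral>\<^sup>+x. ennreal (\<bar>cyl_meas k x powr (- s) * (\<Sum>y\<in>fib j x. G j y * H y)\<bar> powr p) \<partial>M)
     \<le> (\<integral>\<^sup>+x. ennreal (?c powr p) * (\<Sum>y\<in>fib j x. ennreal (G j y) * ennreal (g y powr p)) \<partial>M)"
  proof (intro nn_integral_mono_AE eventually_mono[OF AE_D])
    fix x assume x: "x \<in> D"
    have "ennreal (\<bar>cyl_meas k x powr (- s) * (\<Sum>y\<in>fib j x. G j y * H y)\<bar> powr p)
        \<le> ennreal (?c powr p * (\<Sum>y\<in>fib j x. G j y * g y powr p))"
      using pt[OF x] fib_sum_nonneg[OF assms(3)] by (intro ennreal_leI) (simp add: abs_mult)
    also have "\<dots> = ennreal (?c powr p) * (\<Sum>y\<in>fib j x. ennreal (G j y) * ennreal (g y powr p))"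
      by (subst fib_sum_ennreal) (auto intro!: ennreal_mult fib_sum_nonneg)
    finally show "ennreal (\<bar>cyl_meas k x powr (- s) * (\<Sum>y\<in>fib j x. G j y * H y)\<bar> powr p)
        \<le> ennreal (?c powr p) * (\<Sum>y\<in>fib j x. ennreal (G j y) * ennreal (g y powr p))" .
  qed
  also have "\<dots> = ennreal (?c powr p) * (\<integral>\<^sup>+x. (\<Sum>y\<in>fib j x. ennreal (G j y) * ennreal (g y powr p)) \<partial>M)"
    by (intro nn_integral_cmult fib_sum_nn(1)) measurable
  also have "\<dots> = ennreal (?c powr p) * (\<integral>\<^sup>+x. ennreal (g x powr p) \<partial>M)"
    by (subst fib_sum_nn(2)) auto
  also have "\<dots> \<le> ennreal (?c powr p) * ennreal (a powr p)"
    using assms(4) g0 by (intro mult_left_mono) (auto simp: Lp_le_def g_def[symmetric])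
  also have "\<dots> = ennreal ((?c * a) powr p)"
    using c a by (simp add: powr_mult ennreal_mult)
  finally show ?thesis using c a by (auto simp: Lp_le_def)
qed

lemma transfer_pow_bound:
  assumes "fib_hoelder j \<tau>" "wn j \<psi> b"
  shows "wn 0 ((T ^^ j) \<psi>) (decayC * \<tau> * b)"
proof -
  have [measurable]: "\<psi> \<in> borel_measurable M" using assms by (simp add: wn_def)
  note [measurable] = transfer_pow_measurable[OF this]
  have "Lp_le M p (\<lambda>x. cyl_meas 0 x powr (- s) * (\<Sum>y\<in>fib j x. G j y * cmod (\<psi> y))) (decayC * \<tau> * b)"
    using assms by (intro fib_sum_bound) (auto simp: wn_def)
  then have "Lp_le M p (\<lambda>x. cmod ((T ^^ j) \<psi> x)) (decayC * \<tau> * b)"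
  proof (rule Lp_le_mono)
    show "AE x in M. \<bar>cmod ((T ^^ j) \<psi> x)\<bar> \<le> \<bar>cyl_meas 0 x powr (- s) * (\<Sum>y\<in>fib j x. G j y * cmod (\<psi> y))\<bar>"
    proof (rule eventually_mono[OF AE_D])
      fix x assume "x \<in> D"
      then have "cmod ((T ^^ j) \<psi> x) \<le> (\<Sum>y\<in>fib j x. cmod (complex_of_real (G j y) * \<psi> y))"
        by (simp add: transfer_pow norm_sum)
      also have "\<dots> = (\<Sum>y\<in>fib j x. G j y * cmod (\<psi> y))"
        using G_pos by (intro sum.cong) (auto simp: fib_def norm_mult less_imp_le)
      finally show "\<bar>cmod ((T ^^ j) \<psi> x)\<bar> \<le> \<bar>cyl_meas 0 x powr (- s) * (\<Sum>y\<in>fib j x. G j y * cmod (\<psi> y))\<bar>"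
        by (simp add: cyl_meas_0)
    qed
  qed (use p_ge_1 in auto)
  then show ?thesis by (simp add: wn_0)
qed

text \<open>On a cell Q of level k the weights G_j vary by a relative amount of order |Q|^(\<beta> +
  \<epsilon>). Measured against |Q|^(-s) this leaves the exponent \<beta> + \<epsilon> - s, and |Q|
  is at most contr^k.\<close>

definition \<kappa> :: real where "\<kappa> = contr powr (\<beta> + \<epsilon> - s)"

lemma kappa: "0 < \<kappa>" "\<kappa> < 1"
  using contr_bounds s_less exponents_pos powr_less_mono2[of "\<beta> + \<epsilon> - s" contr 1] by (auto simp: \<kappa>_def)

text \<open>The 2 comes from replacing the average by another cell function, \<open>decayC\<close>
  from \<open>fib_sum_bound\<close>, and 1 + \<open>holdC\<close> from the error in psi together
  with the variation of the weight.\<close>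

definition mainC :: real where "mainC = 2 * decayC * (1 + holdC)"

lemma mainC: "0 < mainC"
  using decayC holdC(1) by (auto simp: mainC_def)

text \<open>On a cell of level k the iterate is compared with its value at the representative point,
  computed with a cell function \<eta> of level j + k in place of psi. The fibres over two points of
  the cell correspond bijectively and \<eta> agrees at corresponding points, so only psi - \<eta>
  and the variation of G_j remain.\<close>

lemma transfer_osc:
  assumes \<tau>: "fib_hoelder j \<tau>" and a: "wn (j + k) (\<lambda>x. \<psi> x - cell_sum (j + k) u x) a" and b: "wn j \<psi> b"
  shows "wn k (\<lambda>x. (T ^^ j) \<psi> x - cexp k ((T ^^ j) \<psi>) x) (mainC * \<tau> * (a + \<kappa> ^ k * b))"
proof -
  have [measurable]: "\<psi> \<in> borel_measurable M" using b by (simp add: wn_def)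
  note [measurable] = transfer_pow_measurable[OF this]
  have \<tau>0: "0 \<le> \<tau>" using \<tau> by (simp add: fib_hoelder_def)
  have ab: "0 \<le> a" "0 \<le> b" using wn_nonneg a b by auto
  have int: "integrable M ((T ^^ j) \<psi>)" using wn_integrable[OF transfer_pow_bound[OF \<tau> b]] .
  have ineq: "2 * (decayC * \<tau> * a + holdC * \<kappa> ^ k * (decayC * \<tau> * (a + b))) \<le> mainC * \<tau> * (a + \<kappa> ^ k * b)"
  proof -
    have "\<kappa> ^ k * a \<le> a" using kappa ab by (intro mult_left_le_one_le) (auto simp: power_le_one)
    then have "holdC * (\<kappa> ^ k * (a + b)) \<le> holdC * (a + \<kappa> ^ k * b)"
      using holdC(1) by (intro mult_left_mono) (auto simp: distrib_left)
    moreover have "0 \<le> \<kappa> ^ k * b" using kappa ab by auto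
    ultimately have "a + holdC * (\<kappa> ^ k * (a + b)) \<le> (1 + holdC) * (a + \<kappa> ^ k * b)"
      by (simp add: distrib_right)
    then have "2 * decayC * \<tau> * (a + holdC * (\<kappa> ^ k * (a + b))) \<le> 2 * decayC * \<tau> * ((1 + holdC) * (a + \<kappa> ^ k * b))"
      using decayC \<tau>0 by (intro mult_left_mono) auto
    then show ?thesis by (simp add: mainC_def algebra_simps)
  qed
  have "\<exists>v c. wn k (\<lambda>x. (T ^^ j) \<psi> x - cell_sum k v x) c \<and> 2 * c \<le> mainC * \<tau> * (a + \<kappa> ^ k * b)"
  \<comment> \<open>At level 0 the fibres need not correspond; the comparison function is zero and
    the L^p bound of the iterate is used, with b entering through \<kappa>^0 = 1.\<close>
  proof (cases k)
    case 0
    have "cell_sum k (\<lambda>_. 0) = (\<lambda>x. 0)" by (intro ext) (simp add: cell_sum_def)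
    then have "wn k (\<lambda>x. (T ^^ j) \<psi> x - cell_sum k (\<lambda>_. 0) x) (decayC * \<tau> * b)"
      using transfer_pow_bound[OF \<tau> b] 0 by simp
    moreover have "2 * (decayC * \<tau> * b) \<le> mainC * \<tau> * (a + \<kappa> ^ k * b)"
    proof -
      have "2 * decayC * \<tau> * (1 * b) \<le> 2 * decayC * \<tau> * ((1 + holdC) * (a + b))"
        using decayC \<tau>0 ab holdC(1) by (intro mult_left_mono mult_mono) auto
      then show ?thesis using 0 by (simp add: mainC_def mult_ac)
    qed
    ultimately show ?thesis by blast
  next
    case (Suc l)
    define \<eta> where "\<eta> = cell_sum (j + k) u"
    define v where "v W = (\<Sum>y\<in>fib j (cell_point W). complex_of_real (G j y) * \<eta> y)" for W
    have [measurable]: "\<eta> \<in> borel_measurable M" by (simp add: \<eta>_def)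
    define K1 where "K1 x = (\<Sum>y\<in>fib j x. G j y * cmod (\<psi> y - \<eta> y))" for x
    define K2 where "K2 x = (\<Sum>y\<in>fib j x. G j y * cmod (\<eta> y))" for x
    have K0: "0 \<le> K1 x" "0 \<le> K2 x" for x by (auto simp: K1_def K2_def intro: fib_sum_nonneg)
    have [measurable]: "K1 \<in> borel_measurable M" "K2 \<in> borel_measurable M"
      unfolding K1_def[abs_def] K2_def[abs_def] by (auto intro!: fib_sum_measurable)
    have L1: "Lp_le M p (\<lambda>x. cyl_meas k x powr (- s) * K1 x) (decayC * \<tau> * a)"
      unfolding K1_def using a by (intro fib_sum_bound[OF \<tau>]) (auto simp: wn_def \<eta>_def)
    \<comment> \<open>The variation of the weight multiplies \<eta> rather than psi, so \<eta>
      itself needs a bound at level j.\<close>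
    have "wn j \<eta> (a + b)"
    proof (rule wn_add_le[OF wn_antimono[OF a] b])
      show "cmod (\<eta> x) \<le> cmod (\<psi> x - cell_sum (j + k) u x) + cmod (\<psi> x)" for x
        unfolding \<eta>_def using norm_triangle_ineq4[of "\<psi> x" "\<psi> x - cell_sum (j + k) u x"] by simp
    qed auto
    then have L2: "Lp_le M p (\<lambda>x. cyl_meas 0 x powr (- s) * K2 x) (decayC * \<tau> * (a + b))"
      unfolding K2_def by (intro fib_sum_bound[OF \<tau>]) (auto simp: wn_def)
    define \<delta> where "\<delta> = \<beta> + \<epsilon>"
    have pt: "cmod ((T ^^ j) \<psi> x - cell_sum k v x) \<le> K1 x + holdC * cyl_meas k x powr \<delta> * K2 x"
      if x: "x \<in> D" for x
    proof -
      define x' where "x' = cell_point (cyl k x)"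
      have x': "x' \<in> D" "same k x x'" using cell_point[OF x] by (auto simp: x'_def)
      have "same (Suc 0) x x'" using same_mono[OF x'(2)] Suc by simp
      from sum_fib_same[OF this] obtain \<sigma> where \<sigma>: "bij_betw \<sigma> (fib j x) (fib j x')"
        "\<And>y. y \<in> fib j x \<Longrightarrow> same j y (\<sigma> y)" by blast
      have in': "\<sigma> y \<in> fib j x'" if "y \<in> fib j x" for y using \<sigma>(1) that by (auto simp: bij_betw_def)
      have sm: "same (j + k) y (\<sigma> y)" if "y \<in> fib j x" for y
        using \<sigma>(2)[OF that] that in'[OF that] x'(2) by (subst same_add) (auto simp: fib_def)
      have \<eta>eq: "\<eta> (\<sigma> y) = \<eta> y" if "y \<in> fib j x" for y
        using that in'[OF that] cyl_eq[OF sm[OF that]] by (simp add: \<eta>_def cell_sum_eq fib_def)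
      have "cell_sum k v x = (\<Sum>y\<in>fib j x'. complex_of_real (G j y) * \<eta> y)"
        by (simp add: cell_sum_eq[OF x] v_def x'_def)
      also have "\<dots> = (\<Sum>y\<in>fib j x. complex_of_real (G j (\<sigma> y)) * \<eta> (\<sigma> y))"
        by (rule sum.reindex_bij_betw[OF \<sigma>(1), symmetric])
      also have "\<dots> = (\<Sum>y\<in>fib j x. complex_of_real (G j (\<sigma> y)) * \<eta> y)"
        by (intro sum.cong) (auto simp: \<eta>eq)
      \<comment> \<open>The common value of \<eta> at y and at its partner allows the split: the
        first summand carries the approximation error, the second the difference of the two
        weights.\<close>
      finally have "(T ^^ j) \<psi> x - cell_sum k v x
          = (\<Sum>y\<in>fib j x. complex_of_real (G j y) * (\<psi> y - \<eta> y) + complex_of_real (G j y - G j (\<sigma> y)) * \<eta> y)"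
        unfolding transfer_pow[OF x] by (simp only: sum_subtractf[symmetric]) (intro sum.cong refl, simp add: algebra_simps)
      then have "cmod ((T ^^ j) \<psi> x - cell_sum k v x)
          \<le> (\<Sum>y\<in>fib j x. cmod (complex_of_real (G j y) * (\<psi> y - \<eta> y) + complex_of_real (G j y - G j (\<sigma> y)) * \<eta> y))"
        by (simp only: norm_sum)
      also have "\<dots> \<le> (\<Sum>y\<in>fib j x. G j y * cmod (\<psi> y - \<eta> y)
          + holdC * cyl_meas k x powr \<delta> * (G j y * cmod (\<eta> y)))"
      proof (rule sum_mono)
        fix y assume yf: "y \<in> fib j x"
        then have y: "y \<in> D" "(f ^^ j) y = x" by (auto simp: fib_def)
        have \<sigma>D: "\<sigma> y \<in> D" using in'[OF yf] by (simp add: fib_def)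
        have "\<bar>G j y - G j (\<sigma> y)\<bar> \<le> holdC * G j y * cyl_meas k x powr \<delta>"
          using holdC(2)[OF y(1) \<sigma>D, of j l] sm[OF yf] Suc y(2) by (simp add: \<delta>_def)
        then have "cmod (complex_of_real (G j y - G j (\<sigma> y)) * \<eta> y) \<le> holdC * G j y * cyl_meas k x powr \<delta> * cmod (\<eta> y)"
          unfolding norm_mult norm_of_real by (rule mult_right_mono) simp
        moreover have "cmod (complex_of_real (G j y) * (\<psi> y - \<eta> y)) = G j y * cmod (\<psi> y - \<eta> y)"
          using G_pos[OF y(1), of j] by (simp add: norm_mult)
        ultimately show "cmod (complex_of_real (G j y) * (\<psi> y - \<eta> y) + complex_of_real (G j y - G j (\<sigma> y)) * \<eta> y)
          \<le> G j y * cmod (\<psi> y - \<eta> y) + holdC * cyl_meas k x powr \<delta> * (G j y * cmod (\<eta> y))"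
          by (intro order_trans[OF norm_triangle_ineq] add_mono) (auto simp: mult_ac)
      qed
      also have "\<dots> = K1 x + holdC * cyl_meas k x powr \<delta> * K2 x"
        by (simp add: K1_def K2_def sum.distrib sum_distrib_left)
      finally show ?thesis .
    qed
    define c where "c = decayC * \<tau> * a + holdC * \<kappa> ^ k * (decayC * \<tau> * (a + b))"
    have "Lp_le M p (\<lambda>x. cyl_meas k x powr (- s) * cmod ((T ^^ j) \<psi> x - cell_sum k v x)) c"
    proof (rule Lp_le_mono)
      show "Lp_le M p (\<lambda>x. \<bar>cyl_meas k x powr (- s) * K1 x\<bar> + \<bar>holdC * \<kappa> ^ k * (cyl_meas 0 x powr (- s) * K2 x)\<bar>)
         (decayC * \<tau> * a + \<bar>holdC * \<kappa> ^ k\<bar> * (decayC * \<tau> * (a + b)))"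
        by (intro Lp_le_add L1 Lp_le_cmult L2 p_ge_1)
      show "decayC * \<tau> * a + \<bar>holdC * \<kappa> ^ k\<bar> * (decayC * \<tau> * (a + b)) \<le> c"
        using holdC(1) kappa by (simp add: c_def)
      show "AE x in M. \<bar>cyl_meas k x powr (- s) * cmod ((T ^^ j) \<psi> x - cell_sum k v x)\<bar>
         \<le> \<bar>\<bar>cyl_meas k x powr (- s) * K1 x\<bar> + \<bar>holdC * \<kappa> ^ k * (cyl_meas 0 x powr (- s) * K2 x)\<bar>\<bar>"
      proof (rule eventually_mono[OF AE_D])
        fix x assume x: "x \<in> D"
        have e: "cyl_meas k x powr (- s) * cyl_meas k x powr \<delta> \<le> \<kappa> ^ k"
        proof -
          have "cyl_meas k x powr (- s) * cyl_meas k x powr \<delta> = cyl_meas k x powr (\<delta> - s)"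
            by (simp add: powr_add[symmetric])
          also have "\<dots> \<le> (contr ^ k) powr (\<delta> - s)"
            using cyl_meas_le_power[OF x] s_less exponents_pos by (intro powr_mono2) (auto simp: \<delta>_def)
          finally show ?thesis by (simp add: contr_power_powr \<kappa>_def \<delta>_def)
        qed
        have "cyl_meas k x powr (- s) * cmod ((T ^^ j) \<psi> x - cell_sum k v x)
           \<le> cyl_meas k x powr (- s) * (K1 x + holdC * cyl_meas k x powr \<delta> * K2 x)"
          using pt[OF x] by (rule mult_left_mono) simp
        also have "\<dots> = cyl_meas k x powr (- s) * K1 x
            + (cyl_meas k x powr (- s) * cyl_meas k x powr \<delta>) * (holdC * K2 x)"
          by (simp add: algebra_simps)
        also have "\<dots> \<le> cyl_meas k x powr (- s) * K1 x + \<kappa> ^ k * (holdC * K2 x)"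
          using e holdC(1) K0 by (intro add_left_mono mult_right_mono) auto
        finally show "\<bar>cyl_meas k x powr (- s) * cmod ((T ^^ j) \<psi> x - cell_sum k v x)\<bar>
         \<le> \<bar>\<bar>cyl_meas k x powr (- s) * K1 x\<bar> + \<bar>holdC * \<kappa> ^ k * (cyl_meas 0 x powr (- s) * K2 x)\<bar>\<bar>"
          using K0[of x] holdC(1) kappa by (simp add: abs_mult cyl_meas_0 mult_ac)
      qed
    qed (use p_ge_1 in auto)
    then have "wn k (\<lambda>x. (T ^^ j) \<psi> x - cell_sum k v x) c" by (simp add: wn_def)
    then show ?thesis using ineq unfolding c_def by blast
  qed
  then obtain v c where v: "wn k (\<lambda>x. (T ^^ j) \<psi> x - cell_sum k v x) c"
    and c: "2 * c \<le> mainC * \<tau> * (a + \<kappa> ^ k * b)" by blast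
  show ?thesis by (rule wn_mono[OF wn_osc_le[OF v int]]) (use c in auto)
qed

section \<open>Functions whose weighted oscillations form an l^q sequence\<close>

definition Bes :: "('a \<Rightarrow> complex) \<Rightarrow> real \<Rightarrow> bool" where
  "Bes \<psi> A \<longleftrightarrow> wn 0 \<psi> A \<and> (\<exists>a. lq_le q a A \<and> (\<forall>k. wn k (\<lambda>x. \<psi> x - cexp k \<psi> x) (a k)))"

lemma Bes_measurable: "Bes \<psi> A \<Longrightarrow> \<psi> \<in> borel_measurable M"
  by (auto simp: Bes_def intro: wn_measurable)

lemma Bes_integrable: "Bes \<psi> A \<Longrightarrow> integrable M \<psi>"
  by (auto simp: Bes_def intro: wn_integrable)

lemma Bes_nonneg: "Bes \<psi> A \<Longrightarrow> 0 \<le> A"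
  by (auto simp: Bes_def intro: wn_nonneg)

lemma cexp_cong_AE:
  assumes "AE x in M. \<psi> x = \<phi> x" "\<psi> \<in> borel_measurable M" "\<phi> \<in> borel_measurable M"
  shows "cexp k \<psi> = cexp k \<phi>"
proof -
  have "avg \<psi> Q = avg \<phi> Q" if "Q \<in> grid k" for Q
  proof -
    have [measurable]: "Q \<in> sets M" using that by (rule sets_grid)
    have "(\<integral>x. indicator Q x * \<psi> x \<partial>M) = (\<integral>x. indicator Q x * \<phi> x \<partial>M)"
      using assms by (intro integral_cong_AE) (auto elim: eventually_mono)
    then show ?thesis by (simp add: avg_def)
  qed
  then show ?thesis by (auto simp: cexp_def cell_sum_def intro!: sum.cong)
qed

lemma cexp_lincomb:
  assumes "integrable M g" "integrable M g'"
  shows "cexp k (\<lambda>x. a * g x + b * g' x) x = a * cexp k g x + b * cexp k g' x"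
  unfolding cexp_def cell_sum_def sum_distrib_left sum.distrib[symmetric]
  using assms sets_grid by (intro sum.cong) (auto simp: avg_lincomb algebra_simps)

lemma Bes_cong_AE:
  assumes "Bes \<psi> A" "\<phi> \<in> borel_measurable M" "AE x in M. \<phi> x = \<psi> x"
  shows "Bes \<phi> A"
proof -
  note [measurable] = assms(2) Bes_measurable[OF assms(1)]
  obtain a where a: "wn 0 \<psi> A" "lq_le q a A" "\<And>k. wn k (\<lambda>x. \<psi> x - cexp k \<psi> x) (a k)"
      using \<open>Bes \<psi> A\<close> unfolding Bes_def by blast
  have "wn k (\<lambda>x. \<phi> x - cexp k \<phi> x) (a k)" for k
    using assms(3) cexp_cong_AE[OF assms(3)] by (intro wn_cong_AE[OF a(3)]) auto
  then show ?thesis using a wn_cong_AE[OF a(1) assms(2,3)] by (auto simp: Bes_def)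
qed

lemma Bes_mono: "Bes \<psi> A \<Longrightarrow> A \<le> B \<Longrightarrow> Bes \<psi> B"
  unfolding Bes_def by (meson lq_le_mono lq_le_nonneg(1) order_refl q_ge_1 wn_measurable wn_mono)

lemma Bes_lincomb:
  assumes "Bes \<psi> A" "Bes \<phi> B"
  shows "Bes (\<lambda>x. c * \<psi> x + d * \<phi> x) (cmod c * A + cmod d * B)"
proof -
  note int = Bes_integrable[OF assms(1)] Bes_integrable[OF assms(2)]
  obtain a where a: "wn 0 \<psi> A" "lq_le q a A" "\<And>k. wn k (\<lambda>x. \<psi> x - cexp k \<psi> x) (a k)"
      using \<open>Bes \<psi> A\<close> unfolding Bes_def by blast
  obtain b where b: "wn 0 \<phi> B" "lq_le q b B" "\<And>k. wn k (\<lambda>x. \<phi> x - cexp k \<phi> x) (b k)"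
      using \<open>Bes \<phi> B\<close> unfolding Bes_def by blast
  have "wn k (\<lambda>x. (c * \<psi> x + d * \<phi> x) - cexp k (\<lambda>x. c * \<psi> x + d * \<phi> x) x) (cmod c * a k + cmod d * b k)" for k
    using wn_add[OF wn_cmult[OF a(3)[of k], of c] wn_cmult[OF b(3)[of k], of d]]
    by (simp add: cexp_lincomb[OF int] algebra_simps)
  moreover have "lq_le q (\<lambda>k. cmod c * a k + cmod d * b k) (cmod c * A + cmod d * B)"
    using a b q_ge_1 by (intro lq_le_add lq_le_cmult) auto
  moreover have "wn 0 (\<lambda>x. c * \<psi> x + d * \<phi> x) (cmod c * A + cmod d * B)"
    by (intro wn_add wn_cmult a b)
  ultimately show ?thesis by (auto simp: Bes_def)
qed

lemma Bes_cmult: "Bes \<psi> A \<Longrightarrow> Bes (\<lambda>x. c * \<psi> x) (cmod c * A)"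
  using Bes_lincomb[of \<psi> A \<psi> A c 0] by simp

lemma Bes_zero: "Bes (\<lambda>x. 0) 0"
  unfolding Bes_def
proof (intro conjI exI[of _ "\<lambda>_. 0"] allI)
  show "lq_le q (\<lambda>_. 0) 0" by (rule lq_le_zero)
  have "cexp k (\<lambda>x. 0) = (\<lambda>x. 0)" for k by (intro ext) (simp add: cexp_def cell_sum_def avg_def)
  then show "wn k (\<lambda>x. 0 - cexp k (\<lambda>x. 0) x) 0" "wn 0 (\<lambda>x. 0) 0" for k by (auto simp: wn_def Lp_le_zero)
qed

lemma Bes_sum:
  assumes "finite S" "\<And>i. i \<in> S \<Longrightarrow> Bes (g i) (A i)"
  shows "Bes (\<lambda>x. \<Sum>i\<in>S. c i * g i x) (\<Sum>i\<in>S. cmod (c i) * A i)"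
  using assms
proof (induction S)
  case (insert i S)
  then have "Bes (\<lambda>x. c i * g i x + 1 * (\<Sum>i\<in>S. c i * g i x)) (cmod (c i) * A i + cmod 1 * (\<Sum>i\<in>S. cmod (c i) * A i))"
    by (intro Bes_lincomb) auto
  then show ?case using insert by simp
qed (simp add: Bes_zero)

text \<open>From level k on the function is constant on cells and does not oscillate. The finitely
  many coarser levels are bounded crudely, since only membership matters for the finite-rank
  part.\<close>

lemma Bes_cell_sum: "\<exists>A. Bes (cell_sum k v) A"
proof -
  obtain B where B: "B \<ge> 0" "\<And>Q. Q \<in> grid k \<Longrightarrow> cmod (v Q) \<le> B"
    using finite_grid[of k] by (intro that[of "\<Sum>Q\<in>grid k. cmod (v Q)"]) (auto intro!: sum_nonneg member_le_sum)
  have w: "wn 0 (cell_sum k v) B"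
  proof -
    have "Lp_le M p (\<lambda>x. B) B" using B prob_space by (simp add: Lp_le_def emeasure_space_1)
    then have "Lp_le M p (\<lambda>x. cmod (cell_sum k v x)) B"
      by (rule Lp_le_mono) (use B p_ge_1 grid_cyl in \<open>auto intro!: eventually_mono[OF AE_D] simp: cell_sum_eq\<close>)
    then show ?thesis by (simp add: wn_0)
  qed
  define a where "a m = (if m < k then 2 * (growC ^ m * B) else 0)" for m
  have "wn m (\<lambda>x. cell_sum k v x - cexp m (cell_sum k v) x) (a m)" for m
  proof (cases "m < k")
    case True
    have "cell_sum m (\<lambda>_. 0) = (\<lambda>x. 0)" by (intro ext) (simp add: cell_sum_def)
    then have "wn m (\<lambda>x. cell_sum k v x - cell_sum m (\<lambda>_. 0) x) (growC ^ m * B)"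
      using wn_finer[OF w] by simp
    from wn_osc_le[OF this cell_sum_integrable] show ?thesis using True by (simp add: a_def)
  next
    case False
    have "cell_sum k v x = cell_sum m (\<lambda>W. v (cyl k (cell_point W))) x" if x: "x \<in> D" for x
    proof -
      have "same k x (cell_point (cyl m x))" using same_mono[OF cell_point(2)[OF x]] False by simp
      then show ?thesis using cyl_eq by (simp add: cell_sum_eq[OF x])
    qed
    then have "wn m (\<lambda>x. cell_sum k v x - cell_sum m (\<lambda>W. v (cyl k (cell_point W))) x) 0"
      using wn_mono[of m "\<lambda>x. 0" 0] by (auto simp: wn_def Lp_le_zero)
    from wn_osc_le[OF this cell_sum_integrable] show ?thesis using False by (simp add: a_def)
  qed
  moreover have lq: "lq_le q a (\<Sum>m<k. 2 * (growC ^ m * B))"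
  proof -
    have "lq_le q (\<lambda>i. \<Sum>m<k. if i = m then 2 * (growC ^ m * B) else 0) (\<Sum>m<k. 2 * (growC ^ m * B))"
      using B growC by (intro lq_le_sum lq_le_delta q_ge_1) auto
    moreover have "(\<Sum>m<k. if i = m then 2 * (growC ^ m * B) else 0) = a i" for i
      by (simp add: a_def)
    ultimately show ?thesis by simp
  qed
  ultimately have "Bes (cell_sum k v) (B + (\<Sum>m<k. 2 * (growC ^ m * B)))"
    unfolding Bes_def
  proof (intro conjI exI[of _ a] allI)
    have S: "0 \<le> (\<Sum>m<k. 2 * (growC ^ m * B))" using B growC by (intro sum_nonneg) auto
    show "wn 0 (cell_sum k v) (B + (\<Sum>m<k. 2 * (growC ^ m * B)))" using S by (intro wn_mono[OF w]) auto
    from lq_le_mono[OF lq] show "lq_le q a (B + (\<Sum>m<k. 2 * (growC ^ m * B)))"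
      using lq_le_nonneg[OF lq] B q_ge_1 by auto
  qed
  then show ?thesis ..
qed

text \<open>Boundedness of the operator itself, without subtracting an average; it puts the
  finite-rank functions and the partial sums used for the range into the space.\<close>

lemma Bes_transfer:
  assumes "fib_hoelder (Suc 0) \<tau>"
  shows "\<exists>C\<ge>0. \<forall>\<psi> A. Bes \<psi> A \<longrightarrow> Bes (T \<psi>) (C * A)"
proof -
  have \<tau>: "0 \<le> \<tau>" using assms by (simp add: fib_hoelder_def)
  define C where "C = mainC * \<tau> * (1 + growC / (1 - \<kappa>)) + decayC * \<tau> * growC"
  have C0: "0 \<le> mainC * \<tau> * (1 + growC / (1 - \<kappa>))" "0 \<le> decayC * \<tau> * growC"
    using mainC \<tau> growC kappa decayC by auto
  have "Bes (T \<psi>) (C * A)" if "Bes \<psi> A" for \<psi> A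
  proof -
    obtain a where a: "wn 0 \<psi> A" "lq_le q a A" "\<And>k. wn k (\<lambda>x. \<psi> x - cexp k \<psi> x) (a k)"
      using \<open>Bes \<psi> A\<close> unfolding Bes_def by blast
    have A: "0 \<le> A" using Bes_nonneg[OF that] .
    \<comment> \<open>The weight of level 1 is inserted by hand at the price \<open>growC\<close>,
      which is harmless for the single iterate j = 1.\<close>
    have w1: "wn (Suc 0) \<psi> (growC * A)" using wn_Suc[OF a(1)] .
    have w: "wn k (\<lambda>x. T \<psi> x - cexp k (T \<psi>) x) (mainC * \<tau> * (a (k + 1) + \<kappa> ^ k * (growC * A)))" for k
      using transfer_osc[OF assms _ w1, of k "avg \<psi>"] a(3)[of "Suc k"] by (simp add: cexp_def)
    have "lq_le q (\<lambda>k. mainC * \<tau> * (a (k + 1) + (growC * A) * \<kappa> ^ k)) (mainC * \<tau> * (A + (growC * A) * (1 / (1 - \<kappa>))))"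
      using a(2) mainC \<tau> growC A kappa
      by (intro lq_le_cmult lq_le_add lq_le_shift lq_le_geometric q_ge_1) auto
    then have "lq_le q (\<lambda>k. mainC * \<tau> * (a (k + 1) + \<kappa> ^ k * (growC * A))) (C * A)"
    proof (rule lq_le_mono)
      show "0 \<le> mainC * \<tau> * (a (k + 1) + \<kappa> ^ k * (growC * A))" for k
        using lq_le_nonneg[OF a(2)] mainC \<tau> growC A kappa by auto
      have e: "mainC * \<tau> * (A + growC * A * (1 / (1 - \<kappa>))) = mainC * \<tau> * (1 + growC / (1 - \<kappa>)) * A"
        by (simp add: algebra_simps)
      have "mainC * \<tau> * (1 + growC / (1 - \<kappa>)) * A \<le> C * A"
        unfolding C_def using C0 A by (intro mult_right_mono) auto
      then show "mainC * \<tau> * (A + growC * A * (1 / (1 - \<kappa>))) \<le> C * A" unfolding e .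
    qed (use q_ge_1 in \<open>auto simp: mult_ac\<close>)
    moreover have "wn 0 (T \<psi>) (C * A)"
    proof (rule wn_mono)
      show "wn 0 (T \<psi>) (decayC * \<tau> * (growC * A))" using transfer_pow_bound[OF assms w1] by simp
      then show "T \<psi> \<in> borel_measurable M" by (rule wn_measurable)
      show "decayC * \<tau> * (growC * A) \<le> C * A" using C0 A by (simp add: C_def distrib_right)
    qed auto
    ultimately show ?thesis using w by (auto simp: Bes_def)
  qed
  then show ?thesis using C0 by (intro exI[of _ C]) (auto simp: C_def)
qed

text \<open>The factor 1 + 1 / (1 - \<kappa>) adds the oscillation inherited from psi and the l^q
  norm of the geometric sequence \<kappa>^k; j does not occur.\<close>

definition essC :: real where "essC = mainC * (1 + 1 / (1 - \<kappa>))"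

lemma essC: "0 < essC" "decayC \<le> essC"
proof -
  have m: "decayC \<le> mainC" using decayC holdC(1) mult_left_mono[of 1 "1 + holdC" decayC] by (simp add: mainC_def)
  have "mainC * 1 \<le> essC" unfolding essC_def using mainC kappa by (intro mult_left_mono) auto
  then show "decayC \<le> essC" "0 < essC" using m decayC by auto
qed

text \<open>The input b of \<open>transfer_osc\<close> is here the oscillation bound a_j of psi
  itself, hence at most A. So the weight of level j is available without the factor
  \<open>growC\<close>^j.\<close>

lemma Bes_transfer_pow_osc:
  assumes \<tau>: "fib_hoelder j \<tau>" and "Bes \<psi> A"
  shows "Bes ((T ^^ j) (\<lambda>x. \<psi> x - cexp j \<psi> x)) (essC * \<tau> * A)"
proof -
  have \<tau>0: "0 \<le> \<tau>" using \<tau> by (simp add: fib_hoelder_def)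
  obtain a where a: "wn 0 \<psi> A" "lq_le q a A" "\<And>k. wn k (\<lambda>x. \<psi> x - cexp k \<psi> x) (a k)"
      using \<open>Bes \<psi> A\<close> unfolding Bes_def by blast
  have A: "0 \<le> A" using Bes_nonneg[OF assms(2)] .
  have aA: "a k \<le> A" for k by (rule lq_le_single[OF a(2) q_ge_1])
  let ?\<psi> = "\<lambda>x. \<psi> x - cexp j \<psi> x"
  let ?R = "(T ^^ j) ?\<psi>"
  \<comment> \<open>E_j psi is also constant on cells of level j + k. Removing it from the average
    of that level gives the cell function for which the error is exactly psi - E_{j+k} psi.\<close>
  define u where "u k W = avg \<psi> W - avg \<psi> (cyl j (cell_point W))" for k :: nat and W
  have eq: "?\<psi> x - cell_sum (j + k) (u k) x = \<psi> x - cexp (j + k) \<psi> x" if x: "x \<in> D" for x k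
  proof -
    let ?W = "cyl (j + k) x"
    have "same j x (cell_point ?W)" using same_mono[OF cell_point(2)[OF x]] by simp
    then show ?thesis using cyl_eq by (simp add: cell_sum_eq[OF x] cexp_def u_def)
  qed
  have [measurable]: "\<psi> \<in> borel_measurable M" using Bes_measurable[OF assms(2)] .
  have w1: "wn (j + k) (\<lambda>x. ?\<psi> x - cell_sum (j + k) (u k) x) (a (j + k))" for k
    by (rule wn_mono[OF a(3)]) (auto simp: eq)
  have w: "wn k (\<lambda>x. ?R x - cexp k ?R x) (mainC * \<tau> * (a (k + j) + A * \<kappa> ^ k))" for k
  proof (rule wn_mono[OF transfer_osc[OF \<tau> w1 a(3)]])
    have "a (j + k) + \<kappa> ^ k * a j \<le> a (k + j) + A * \<kappa> ^ k"
      using kappa aA by (simp add: add.commute mult.commute mult_right_mono)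
    then show "mainC * \<tau> * (a (j + k) + \<kappa> ^ k * a j) \<le> mainC * \<tau> * (a (k + j) + A * \<kappa> ^ k)"
      using mainC \<tau>0 by (intro mult_left_mono) auto
    have "?R \<in> borel_measurable M" by (intro transfer_pow_measurable) measurable
    then show "(\<lambda>x. ?R x - cexp k ?R x) \<in> borel_measurable M" by measurable
  qed auto
  have lq: "lq_le q (\<lambda>k. mainC * \<tau> * (a (k + j) + A * \<kappa> ^ k)) (mainC * \<tau> * (A + A * (1 / (1 - \<kappa>))))"
    using a(2) mainC \<tau>0 A kappa
    by (intro lq_le_cmult lq_le_add lq_le_shift lq_le_geometric q_ge_1) auto
  have e: "mainC * \<tau> * (A + A * (1 / (1 - \<kappa>))) = essC * \<tau> * A"
    by (simp add: essC_def algebra_simps)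
  have "wn 0 ?R (essC * \<tau> * A)"
  proof (rule wn_mono[OF transfer_pow_bound[OF \<tau> a(3)]])
    show "decayC * \<tau> * a j \<le> essC * \<tau> * A"
      using aA[of j] lq_le_nonneg[OF a(2)] essC decayC \<tau>0 by (intro mult_mono) auto
    show "?R \<in> borel_measurable M" by (intro transfer_pow_measurable) measurable
  qed auto
  then show ?thesis using w lq[unfolded e] unfolding Bes_def by blast
qed

section \<open>Fredholm property\<close>

lemma T_pow_lincomb:
  "(T ^^ j) (\<lambda>y. a * u y + b * v y) = (\<lambda>x. a * (T ^^ j) u x + b * (T ^^ j) v x)"
proof (induction j)
  case (Suc j)
  have "T (\<lambda>y. a * u y + b * v y) = (\<lambda>x. a * T u x + b * T v x)" for u v
    by (simp add: fun_eq_iff transfer_operator_def sum_distrib_left sum.distrib[symmetric] algebra_simps)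
  then show ?case by (simp only: funpow.simps comp_apply Suc)
qed simp

lemma T_pow_diff: "(T ^^ j) (\<lambda>y. u y - v y) = (\<lambda>x. (T ^^ j) u x - (T ^^ j) v x)"
  using T_pow_lincomb[of j 1 u "-1" v] by simp

lemma T_pow_cmult: "(T ^^ j) (\<lambda>y. a * u y) = (\<lambda>x. a * (T ^^ j) u x)"
  using T_pow_lincomb[of j a u 0 u] by simp

lemma T_pow_sum:
  assumes "finite S"
  shows "(T ^^ j) (\<lambda>y. \<Sum>i\<in>S. c i * g i y) = (\<lambda>x. \<Sum>i\<in>S. c i * (T ^^ j) (g i) x)"
  using assms
proof (induction S)
  case empty
  show ?case using T_pow_cmult[of j 0 "\<lambda>_. 0"] by simp
next
  case (insert i S)
  have "(T ^^ j) (\<lambda>y. c i * g i y + 1 * (\<Sum>i\<in>S. c i * g i y)) = (\<lambda>x. c i * (T ^^ j) (g i) x + 1 * (T ^^ j) (\<lambda>y. \<Sum>i\<in>S. c i * g i y) x)"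
    by (rule T_pow_lincomb)
  then show ?case using insert by simp
qed

lemma T_pow_cong_AE:
  assumes "AE y in M. u y = v y"
  shows "AE x in M. (T ^^ j) u x = (T ^^ j) v x"
  using AE_D AE_fib[OF assms, of j]
  by eventually_elim (auto simp: transfer_pow intro!: sum.cong)

text \<open>Serves as completeness of the space. Bounds in L^1 give absolute convergence almost
  everywhere and termwise integration on each cell; averages are numbers, so \<open>cexp\<close>
  converges at every point. Fatou's lemma carries over the weighted bounds.\<close>

lemma Bes_series:
  assumes B: "\<And>m::nat. Bes (u m) (A m)" and A: "summable A"
  defines "S \<equiv> \<lambda>x. \<Sum>m. u m x"
  shows "Bes S (\<Sum>m. A m)"
    and "AE x in M. (\<lambda>m. u m x) sums S x"
    and "\<And>k x. (\<lambda>m. cexp k (u m) x) sums cexp k S x"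
proof -
  have [measurable]: "u m \<in> borel_measurable M" for m using Bes_measurable[OF B] .
  have Sm [measurable]: "S \<in> borel_measurable M" unfolding S_def by measurable
  have A0: "0 \<le> A m" for m using Bes_nonneg[OF B] .
  have int: "integrable M (u m)" for m using Bes_integrable[OF B] .
  have L1: "(\<integral>\<^sup>+x. ennreal (cmod (u m x)) \<partial>M) \<le> ennreal (A m)" for m
    using B[of m] Lp_le_nn_integral(1)[OF _ p_ge_1, of "\<lambda>x. cmod (u m x)" "A m"] by (auto simp: Bes_def wn_0)
  have "(\<integral>\<^sup>+x. (\<Sum>m. ennreal (cmod (u m x))) \<partial>M) = (\<Sum>m. \<integral>\<^sup>+x. ennreal (cmod (u m x)) \<partial>M)"
    by (intro nn_integral_suminf) auto
  also have "\<dots> \<le> (\<Sum>m. ennreal (A m))" by (intro suminf_le L1) auto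
  also have "\<dots> = ennreal (\<Sum>m. A m)" using A A0 by (intro suminf_ennreal2) auto
  finally have "(\<integral>\<^sup>+x. (\<Sum>m. ennreal (cmod (u m x))) \<partial>M) \<noteq> \<infinity>" by (auto simp: top_unique)
  then have "AE x in M. (\<Sum>m. ennreal (cmod (u m x))) \<noteq> \<infinity>" by (intro nn_integral_noteq_infinite) auto
  then have sm: "AE x in M. summable (\<lambda>m. cmod (u m x))"
    by eventually_elim (auto intro: summable_suminf_not_top)
  then show sums: "AE x in M. (\<lambda>m. u m x) sums S x"
    unfolding S_def by eventually_elim (auto intro: summable_sums summable_norm_cancel)
  have sumint: "summable (\<lambda>m. \<integral>x. cmod (u m x) \<partial>M)"
  proof (rule summable_comparison_test[OF _ A], intro exI[of _ 0] allI impI)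
    fix m
    have "ennreal (\<integral>x. cmod (u m x) \<partial>M) \<le> ennreal (A m)"
      using L1[of m] int by (subst (asm) nn_integral_eq_integral) auto
    then show "norm (\<integral>x. cmod (u m x) \<partial>M) \<le> A m" using A0 by (simp add: ennreal_le_iff)
  qed
  have avg: "(\<lambda>m. avg (u m) Q) sums avg S Q" if Q: "Q \<in> sets M" for Q
  proof -
    have i: "integrable M (\<lambda>x. indicator Q x * u m x)" for m using int Q by (rule integrable_indicator_mult)
    have ae: "AE x in M. summable (\<lambda>m. norm (indicator Q x * u m x))"
      using sm by eventually_elim (auto simp: norm_mult split: split_indicator)
    have sn: "summable (\<lambda>m. \<integral>x. norm (indicator Q x * u m x) \<partial>M)"
    proof (rule summable_comparison_test[OF _ sumint], intro exI[of _ 0] allI impI)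
      fix m
      have "(\<integral>x. norm (indicator Q x * u m x) \<partial>M) \<le> (\<integral>x. cmod (u m x) \<partial>M)"
        using i int by (intro integral_mono) (auto split: split_indicator)
      then show "norm (\<integral>x. norm (indicator Q x * u m x) \<partial>M) \<le> (\<integral>x. cmod (u m x) \<partial>M)" by simp
    qed
    have "(\<lambda>m. \<integral>x. indicator Q x * u m x \<partial>M) sums (\<integral>x. (\<Sum>m. indicator Q x * u m x) \<partial>M)"
      using summable_integral[OF i ae sn] integral_suminf[OF i ae sn] by (simp add: sums_iff)
    moreover have "(\<Sum>m. indicator Q x * u m x) = indicator Q x * S x" for x
      by (simp add: S_def split: split_indicator)
    ultimately show ?thesis unfolding avg_def by (simp add: sums_divide)
  qed
  show ce: "(\<lambda>m. cexp k (u m) x) sums cexp k S x" for k x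
    unfolding cexp_def cell_sum_def using sets_grid by (intro sums_sum sums_mult avg)
  define a where "a m = (SOME a. lq_le q a (A m) \<and> (\<forall>k. wn k (\<lambda>x. u m x - cexp k (u m) x) (a k)))" for m
  have a: "lq_le q (a m) (A m)" "\<And>k. wn k (\<lambda>x. u m x - cexp k (u m) x) (a m k)" for m
    using B[of m] someI_ex[of "\<lambda>a. lq_le q a (A m) \<and> (\<forall>k. wn k (\<lambda>x. u m x - cexp k (u m) x) (a k))"]
    unfolding Bes_def a_def by blast+
  note lq = lq_le_suminf[OF a(1) A q_ge_1]
  have lim: "wn k r (\<Sum>m. b m)"
    if "\<And>m. wn k (g m) (b m)" "summable b" "AE x in M. (\<lambda>m. g m x) sums r x" "r \<in> borel_measurable M"
    for k g b r
  proof -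
    have [measurable]: "r \<in> borel_measurable M" "g m \<in> borel_measurable M" for m
      using that(4) wn_measurable[OF that(1)] by auto
    have "wn k (\<lambda>x. \<Sum>m<N. g m x) (\<Sum>m<N. b m)" for N
    proof (induction N)
      case 0
      then show ?case by (simp add: wn_def Lp_le_zero)
    next
      case (Suc N)
      then show ?case using wn_add[OF Suc that(1)[of N]] by simp
    qed
    then have "wn k (\<lambda>x. \<Sum>m<N. g m x) (\<Sum>m. b m)" for N
      by (rule wn_mono) (use wn_nonneg[OF that(1)] that(2) in \<open>auto intro!: sum_le_suminf\<close>)
    then have le: "Lp_le M p (\<lambda>x. cyl_meas k x powr (- s) * cmod (\<Sum>m<N. g m x)) (\<Sum>m. b m)" for N
      by (simp add: wn_def)
    have "AE x in M. (\<lambda>N. cyl_meas k x powr (- s) * cmod (\<Sum>m<N. g m x))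
        \<longlonglongrightarrow> cyl_meas k x powr (- s) * cmod (r x)"
      using that(3)
    proof eventually_elim
      case (elim x)
      then show ?case unfolding sums_def by (intro tendsto_mult tendsto_const tendsto_norm)
    qed
    from Lp_le_lim[OF le this] have "Lp_le M p (\<lambda>x. cyl_meas k x powr (- s) * cmod (r x)) (\<Sum>m. b m)"
      using p_ge_1 by simp
    then show ?thesis by (simp add: wn_def)
  qed
  have "wn 0 S (\<Sum>m. A m)"
    using B sums by (intro lim[OF _ A]) (auto simp: Bes_def)
  moreover have "wn k (\<lambda>x. S x - cexp k S x) (\<Sum>m. a m k)" for k
  proof (rule lim[OF a(2) lq(2)])
    show "AE x in M. (\<lambda>m. u m x - cexp k (u m) x) sums (S x - cexp k S x)"
      using sums by eventually_elim (intro sums_diff ce)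
  qed measurable
  ultimately show "Bes S (\<Sum>m. A m)" using lq(1) unfolding Bes_def by blast
qed

section \<open>Neumann series and the two finite-dimensional exceptional spaces\<close>

definition R :: "complex \<Rightarrow> nat \<Rightarrow> ('a \<Rightarrow> complex) \<Rightarrow> 'a \<Rightarrow> complex" where
  "R z j \<psi> x = (1 / z ^ j) * (T ^^ j) (\<lambda>y. \<psi> y - cexp j \<psi> y) x"

lemma R_Bes:
  assumes "fib_hoelder j \<tau>" "Bes \<psi> A"
  shows "Bes (R z j \<psi>) (essC * \<tau> / cmod z ^ j * A)"
  using Bes_cmult[OF Bes_transfer_pow_osc[OF assms], of "1 / z ^ j"]
  by (simp add: R_def[abs_def] norm_divide norm_power)

lemma R_lincomb:
  assumes "integrable M g" "integrable M g'"
  shows "R z j (\<lambda>x. a * g x + b * g' x) = (\<lambda>x. a * R z j g x + b * R z j g' x)"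
proof -
  have "(\<lambda>y. (a * g y + b * g' y) - cexp j (\<lambda>x. a * g x + b * g' x) y)
     = (\<lambda>y. a * (g y - cexp j g y) + b * (g' y - cexp j g' y))"
    by (simp add: cexp_lincomb[OF assms] algebra_simps)
  then have "R z j (\<lambda>x. a * g x + b * g' x) x
     = 1 / z ^ j * (a * (T ^^ j) (\<lambda>y. g y - cexp j g y) x + b * (T ^^ j) (\<lambda>y. g' y - cexp j g' y) x)" for x
    by (simp only: R_def T_pow_lincomb)
  then show ?thesis by (simp add: fun_eq_iff R_def distrib_left mult_ac)
qed

definition cellfun :: "nat \<Rightarrow> 'a set \<Rightarrow> 'a \<Rightarrow> complex" where
  "cellfun j Q = cell_sum j (\<lambda>Q'. if Q' = Q then 1 else 0)"

lemma cexp_eq_cellfun: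
  assumes "x \<in> D" shows "cexp j \<psi> x = (\<Sum>Q\<in>grid j. avg \<psi> Q * cellfun j Q x)"
proof -
  have "(\<Sum>Q\<in>grid j. avg \<psi> Q * cellfun j Q x) = (\<Sum>Q\<in>grid j. if Q = cyl j x then avg \<psi> Q else 0)"
    by (intro sum.cong) (auto simp: cellfun_def cell_sum_eq[OF assms])
  then show ?thesis using finite_grid grid_cyl[OF assms] by (simp add: cexp_def cell_sum_eq[OF assms])
qed

lemma transfer_pow_Bes:
  assumes "\<exists>C\<ge>0. \<forall>\<psi> A. Bes \<psi> A \<longrightarrow> Bes (T \<psi>) (C * A)" "Bes \<psi> A"
  shows "\<exists>B. Bes ((T ^^ i) \<psi>) B"
  using assms by (induction i) auto

context
  fixes z :: complex and j :: nat and \<tau> :: real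
  assumes hoelder: "fib_hoelder j \<tau>" and contraction: "essC * \<tau> < cmod z ^ j" and j_pos: "0 < j"
begin

lemma z_nonzero: "z \<noteq> 0"
proof
  assume "z = 0"
  then have "essC * \<tau> < 0" using contraction j_pos by (simp add: power_0_left)
  then show False using essC hoelder by (simp add: fib_hoelder_def mult_less_0_iff)
qed

definition \<rho> :: real where "\<rho> = essC * \<tau> / cmod z ^ j"

lemma rho: "0 \<le> \<rho>" "\<rho> < 1"
  using essC hoelder contraction z_nonzero by (auto simp: \<rho>_def fib_hoelder_def divide_less_eq)

lemma R_pow_Bes: "Bes v A \<Longrightarrow> Bes ((R z j ^^ m) v) (\<rho> ^ m * A)"
proof (induction m)
  case (Suc m)
  from R_Bes[OF hoelder Suc.IH[OF Suc.prems], of z] show ?case by (simp add: \<rho>_def mult.assoc)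
qed simp

text \<open>The series of the iterates of R applied to v is geometric with ratio \<rho>. That R may
  be applied term by term rests on its being a finite fibre sum of differences between values and
  averages.\<close>

lemma neumann:
  assumes v: "Bes v A"
  obtains u B where "Bes u B" "AE x in M. u x - R z j u x = v x"
proof -
  define g where "g m = (R z j ^^ m) v" for m
  have B: "Bes (g m) (\<rho> ^ m * A)" for m using R_pow_Bes[OF v] by (simp add: g_def)
  have A: "summable (\<lambda>m. \<rho> ^ m * A)" using rho by (intro summable_mult2 summable_geometric) auto
  define u where "u x = (\<Sum>m. g m x)" for x
  note S = Bes_series[OF B A, folded u_def]
  have "AE x in M. u x - R z j u x = v x"
  proof -
    \<comment> \<open>Convergence is known at almost every y but is needed on the whole fibre over
      almost every x, which \<open>AE_fib\<close> supplies.\<close>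
    have "AE y in M. (\<lambda>m. g m y - cexp j (g m) y) sums (u y - cexp j u y)"
      using S(2) by eventually_elim (intro sums_diff S(3))
    from AE_fib[OF this, of j] S(2) AE_D show ?thesis
    proof eventually_elim
      case (elim x)
      have "(\<lambda>m. R z j (g m) x) sums R z j u x"
        unfolding R_def transfer_pow[OF elim(3)] using elim(1) by (intro sums_mult sums_sum) auto
      then have "(\<lambda>m. g (Suc m) x) sums R z j u x" by (simp add: g_def)
      then have "(\<lambda>m. g m x) sums (R z j u x + g 0 x)" by (subst (asm) sums_Suc_iff) simp
      with elim(2) have "u x = R z j u x + g 0 x" by (rule sums_unique2)
      then show ?case by (simp add: g_def)
    qed
  qed
  then show thesis using that S(1) by blast
qed

text \<open>A fixed point inherits the bound \<rho>^m A for every m, so its L^p norm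
  vanishes.\<close>

lemma R_fixed_zero:
  assumes d: "Bes d A" and fx: "AE x in M. d x = R z j d x"
  shows "AE x in M. d x = 0"
proof -
  have Bm: "Bes d (\<rho> ^ m * A)" for m
  proof (induction m)
    case (Suc m)
    have "Bes (R z j d) (\<rho> ^ Suc m * A)" using R_Bes[OF hoelder Suc, of z] by (simp add: \<rho>_def mult.assoc)
    from Bes_cong_AE[OF this Bes_measurable[OF d] fx] show ?case .
  qed (use d in simp)
  have "Lp_le M p (\<lambda>x. cmod (d x)) 0"
  proof (rule Lp_le_closed)
    fix e :: real assume e: "e > 0"
    have "(\<lambda>m. \<rho> ^ m * A) \<longlonglongrightarrow> 0 * A" using rho by (intro tendsto_mult_right LIMSEQ_power_zero) auto
    then have "eventually (\<lambda>m. \<rho> ^ m * A < e) sequentially" using e by (intro order_tendstoD) auto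
    then obtain m where "\<rho> ^ m * A < e" by (auto simp: eventually_sequentially)
    moreover have w: "wn 0 d (\<rho> ^ m * A)" using Bm[of m] by (simp add: Bes_def)
    ultimately have "wn 0 d (0 + e)" by (intro wn_mono[OF w wn_measurable[OF w]]) auto
    then show "Lp_le M p (\<lambda>x. cmod (d x)) (0 + e)" by (simp add: wn_0)
  qed (use p_ge_1 in auto)
  from Lp_le_0_AE[OF this] p_ge_1 show ?thesis by simp
qed

lemma R_eq:
  assumes "x \<in> D"
  shows "R z j \<psi> x = (T ^^ j) \<psi> x / z ^ j - (\<Sum>Q\<in>grid j. avg \<psi> Q / z ^ j * (T ^^ j) (cellfun j Q) x)"
proof -
  have "(T ^^ j) (cexp j \<psi>) x = (T ^^ j) (\<lambda>y. \<Sum>Q\<in>grid j. avg \<psi> Q * cellfun j Q y) x"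
    unfolding transfer_pow[OF assms] by (intro sum.cong) (auto simp: fib_def cexp_eq_cellfun)
  also have "\<dots> = (\<Sum>Q\<in>grid j. avg \<psi> Q * (T ^^ j) (cellfun j Q) x)"
    by (simp add: T_pow_sum[OF finite_grid])
  finally show ?thesis
    by (simp add: R_def T_pow_diff diff_divide_distrib sum_divide_distrib)
qed

text \<open>In the kernel of z - T the iterate z^(-j) T^j fixes u, so by \<open>R_eq\<close> (1 - R)
  u is a combination of the functions z^(-j) T^j \<open>cellfun j Q\<close>, with the averages of u
  as coefficients. Solving (1 - R) g_Q = z^(-j) T^j \<open>cellfun j Q\<close> once for each cell
  gives a spanning family that does not depend on u.\<close>

lemma fredholm_kernel:
  assumes T1: "\<exists>C\<ge>0. \<forall>\<psi> A. Bes \<psi> A \<longrightarrow> Bes (T \<psi>) (C * A)"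
  shows "\<exists>g B. (\<forall>Q. Bes (g Q) (B Q)) \<and> (\<forall>u A. Bes u A \<longrightarrow> (AE x in M. z * u x - T u x = 0) \<longrightarrow>
    (AE x in M. u x = (\<Sum>Q\<in>grid j. avg u Q * g Q x)))"
proof -
  have "\<exists>g B. Bes g B \<and> (AE x in M. g x - R z j g x = (T ^^ j) (cellfun j Q) x / z ^ j)" for Q
  proof -
    obtain A where "Bes (cellfun j Q) A" using Bes_cell_sum unfolding cellfun_def by blast
    from transfer_pow_Bes[OF T1 this] obtain B where "Bes ((T ^^ j) (cellfun j Q)) B" by blast
    from neumann[OF Bes_cmult[OF this, of "1 / z ^ j"]] obtain g B' where
      "Bes g B'" "AE x in M. g x - R z j g x = 1 / z ^ j * (T ^^ j) (cellfun j Q) x" by blast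
    then show ?thesis by (intro exI[of _ g] exI[of _ B'] conjI) simp_all
  qed
  then have "\<forall>Q. \<exists>gB. Bes (fst gB) (snd gB) \<and>
      (AE x in M. fst gB x - R z j (fst gB) x = (T ^^ j) (cellfun j Q) x / z ^ j)" by simp
  from choice[OF this] obtain gB where gB: "\<forall>Q. Bes (fst (gB Q)) (snd (gB Q)) \<and>
      (AE x in M. fst (gB Q) x - R z j (fst (gB Q)) x = (T ^^ j) (cellfun j Q) x / z ^ j)" ..
  define g B where "g Q = fst (gB Q)" and "B Q = snd (gB Q)" for Q
  have g: "\<And>Q. Bes (g Q) (B Q)"
    "\<And>Q. AE x in M. g Q x - R z j (g Q) x = (T ^^ j) (cellfun j Q) x / z ^ j"
    using gB by (simp_all add: g_def B_def)
  have "AE x in M. u x = (\<Sum>Q\<in>grid j. avg u Q * g Q x)"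
    if u: "Bes u A" and ker: "AE x in M. z * u x - T u x = 0" for u A
  proof -
    have pw: "AE x in M. (T ^^ i) u x = z ^ i * u x" for i
    proof (induction i)
      case (Suc i)
      from T_pow_cong_AE[OF this, of 1] ker show ?case
        by eventually_elim (use T_pow_cmult[of 1 "z ^ i" u] in auto)
    qed simp
    define G where "G x = (\<Sum>Q\<in>grid j. avg u Q * g Q x)" for x
    \<comment> \<open>Both u and the combination of the g_Q solve the same equation for 1 - R, so
      their difference is fixed by R.\<close>
    define d where "d x = 1 * u x + (-1) * G x" for x
    have GB: "Bes G (\<Sum>Q\<in>grid j. cmod (avg u Q) * B Q)"
      unfolding G_def using g(1) by (intro Bes_sum finite_grid)
    have dB: "Bes d (cmod 1 * A + cmod (-1) * (\<Sum>Q\<in>grid j. cmod (avg u Q) * B Q))"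
      unfolding d_def by (intro Bes_lincomb u GB)
    have RG: "R z j (\<lambda>x. \<Sum>Q\<in>S. avg u Q * g Q x) = (\<lambda>x. \<Sum>Q\<in>S. avg u Q * R z j (g Q) x)" if "finite S" for S
      using that
    proof (induction S)
      case empty
      show ?case using R_lincomb[OF integrable_zero integrable_zero, of z j 0 0] by simp
    next
      case (insert Q S)
      have "integrable M (\<lambda>x. \<Sum>Q\<in>S. avg u Q * g Q x)"
        using Bes_integrable[OF g(1)] by auto
      from R_lincomb[OF Bes_integrable[OF g(1)[of Q]] this, of z j "avg u Q" 1] insert show ?case by simp
    qed
    have "AE x in M. \<forall>Q\<in>grid j. g Q x - R z j (g Q) x = (T ^^ j) (cellfun j Q) x / z ^ j"
      using finite_grid g(2) by (intro AE_finite_allI)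
    from this pw[of j] AE_D have "AE x in M. d x = R z j d x"
    proof eventually_elim
      case (elim x)
      have "R z j d x = R z j u x - R z j G x"
        using R_lincomb[OF Bes_integrable[OF u] Bes_integrable[OF GB], of z j 1 "-1"]
        by (simp add: d_def[abs_def])
      also have "R z j u x = u x - (\<Sum>Q\<in>grid j. avg u Q / z ^ j * (T ^^ j) (cellfun j Q) x)"
        using z_nonzero by (simp add: R_eq[OF elim(3)] elim(2))
      also have "R z j G x = (\<Sum>Q\<in>grid j. avg u Q * R z j (g Q) x)"
        unfolding G_def[abs_def] by (simp add: RG[OF finite_grid])
      also have "\<dots> = (\<Sum>Q\<in>grid j. avg u Q * g Q x - avg u Q / z ^ j * (T ^^ j) (cellfun j Q) x)"
      proof (intro sum.cong refl)
        fix Q assume "Q \<in> grid j"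
        then have "R z j (g Q) x = g Q x - (T ^^ j) (cellfun j Q) x / z ^ j" using elim(1) by (auto simp: algebra_simps)
        then show "avg u Q * R z j (g Q) x = avg u Q * g Q x - avg u Q / z ^ j * (T ^^ j) (cellfun j Q) x"
          by (simp add: right_diff_distrib)
      qed
      finally have "R z j d x = u x - (\<Sum>Q\<in>grid j. avg u Q * g Q x)" by (simp add: sum_subtractf)
      moreover have "d x = u x - (\<Sum>Q\<in>grid j. avg u Q * g Q x)" by (simp add: d_def G_def)
      ultimately show ?case by simp
    qed
    from R_fixed_zero[OF dB this] show ?thesis by eventually_elim (simp add: d_def G_def)
  qed
  then show ?thesis using g(1) by (intro exI[of _ g] exI[of _ B]) auto
qed

text \<open>For y with (1 - R) y = v, the difference between v and y - z^(-j) T^j y is a combination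
  of the finitely many T^j \<open>cellfun j Q\<close>. Since 1 - z^(-j) T^j is divisible by z - T,
  the rest lies in the range.\<close>

lemma fredholm_range:
  assumes T1: "\<exists>C\<ge>0. \<forall>\<psi> A. Bes \<psi> A \<longrightarrow> Bes (T \<psi>) (C * A)"
    and v: "Bes v A"
  obtains u B c where "Bes u B"
    "AE x in M. v x = (z * u x - T u x) + (\<Sum>Q\<in>grid j. c Q * (T ^^ j) (cellfun j Q) x)"
proof -
  obtain y B where y: "Bes y B" "AE x in M. y x - R z j y x = v x" using neumann[OF v] by blast
  \<comment> \<open>The quotient of 1 - z^(-j) T^j by z - T, applied to y; the sum
    telescopes.\<close>
  define u where "u x = (\<Sum>i<j. (1 / z ^ Suc i) * (T ^^ i) y x)" for x
  obtain C where C: "\<And>i. Bes ((T ^^ i) y) (C i)" using transfer_pow_Bes[OF T1 y(1)] by metis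
  have uB: "Bes u (\<Sum>i<j. cmod (1 / z ^ Suc i) * C i)"
    unfolding u_def by (intro Bes_sum C) auto
  have Tu: "T u x = (\<Sum>i<j. (1 / z ^ Suc i) * (T ^^ Suc i) y x)" for x
    using T_pow_sum[of "{..<j}" 1 "\<lambda>i. 1 / z ^ Suc i" "\<lambda>i. (T ^^ i) y"] by (simp add: u_def[abs_def])
  have tel: "z * u x - T u x = y x - (T ^^ j) y x / z ^ j" for x
  proof -
    have "z * u x - T u x = (\<Sum>i<j. (T ^^ i) y x / z ^ i - (T ^^ Suc i) y x / z ^ Suc i)"
      unfolding Tu unfolding u_def sum_distrib_left sum_subtractf[symmetric]
      using z_nonzero by (intro sum.cong) auto
    also have "\<dots> = (T ^^ 0) y x / z ^ 0 - (T ^^ j) y x / z ^ j"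
      by (rule sum_lessThan_telescope')
    finally show ?thesis by simp
  qed
  have "AE x in M. v x = (z * u x - T u x) + (\<Sum>Q\<in>grid j. avg y Q / z ^ j * (T ^^ j) (cellfun j Q) x)"
    using y(2) AE_D
  proof eventually_elim
    case (elim x)
    show ?case unfolding tel elim(1)[symmetric] R_eq[OF elim(2)] by simp
  qed
  from that[OF uB this] show thesis .
qed

end

section \<open>The Besov norm and the weighted oscillation norm\<close>

abbreviation lev :: "(nat \<Rightarrow> 'a set \<Rightarrow> complex) \<Rightarrow> nat \<Rightarrow> real" where
  "lev c k \<equiv> (\<Sum>Q\<in>grid k. cmod (c k Q) powr p) powr (1 / p)"

lemma lev_powr: "lev c k powr r = (\<Sum>Q\<in>grid k. cmod (c k Q) powr p) powr (r / p)"
  by (simp add: powr_powr)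

lemma lq_le_coeff_norm:
  assumes "coeff_finite grid p q c" shows "lq_le q (lev c) (coeff_norm grid p q c)"
proof (cases "q = \<infinity>")
  case True
  then have b: "bdd_above (range (lev c))" using assms by (simp add: coeff_finite_def)
  have "lev c k \<le> coeff_norm grid p q c" for k
    using cSUP_upper[OF _ b, of k] True by (simp add: coeff_norm_def)
  moreover from this[of 0] have "0 \<le> coeff_norm grid p q c"
    by (rule order_trans[rotated]) simp
  ultimately show ?thesis using True by (simp add: lq_le_def)
next
  case False
  define r where "r = real_of_ereal q"
  have r: "r \<ge> 1" unfolding r_def by (rule real_of_ereal_ge_1[OF q_ge_1 False])
  have sm: "summable (\<lambda>k. lev c k powr r)" using assms False by (simp add: coeff_finite_def lev_powr r_def)
  have cn: "coeff_norm grid p q c = (\<Sum>k. lev c k powr r) powr (1 / r)"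
    using False by (simp add: coeff_norm_def lev_powr r_def)
  have "(\<Sum>k<n. lev c k powr r) \<le> coeff_norm grid p q c powr r" for n
  proof -
    have "(\<Sum>k<n. lev c k powr r) \<le> (\<Sum>k. lev c k powr r)" by (intro sum_le_suminf sm) auto
    also have "\<dots> = coeff_norm grid p q c powr r"
      unfolding cn using r suminf_nonneg[OF sm] by (simp add: powr_powr)
    finally show ?thesis .
  qed
  then show ?thesis using False cn by (simp add: lq_le_def r_def)
qed

lemma coeff_norm_le:
  assumes "lq_le q (lev c) A" shows "coeff_finite grid p q c" "coeff_norm grid p q c \<le> A"
proof -
  have "coeff_finite grid p q c \<and> coeff_norm grid p q c \<le> A"
  proof (cases "q = \<infinity>")
    case True
    have le: "lev c k \<le> A" for k using assms q_ge_1 by (rule lq_le_single)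
    then have "bdd_above (range (lev c))" by (intro bdd_aboveI[of _ A]) auto
    moreover have "(SUP k. lev c k) \<le> A" by (intro cSUP_least le) auto
    ultimately show ?thesis using True by (simp add: coeff_finite_def coeff_norm_def)
  next
    case False
    define r where "r = real_of_ereal q"
    have r: "r \<ge> 1" unfolding r_def by (rule real_of_ereal_ge_1[OF q_ge_1 False])
    have b: "(\<Sum>k<n. lev c k powr r) \<le> A powr r" for n using assms False by (simp add: lq_le_def r_def)
    have A: "0 \<le> A" using assms by (simp add: lq_le_def)
    have sm: "summable (\<lambda>k. lev c k powr r)" by (rule summableI_nonneg_bounded[OF _ b]) simp
    have "(\<Sum>k. lev c k powr r) \<le> A powr r" by (intro suminf_le_const sm b)
    then have "(\<Sum>k. lev c k powr r) powr (1 / r) \<le> (A powr r) powr (1 / r)"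
      using r suminf_nonneg[OF sm] by (intro powr_mono2) auto
    also have "\<dots> = A" using r A by (simp add: powr_powr)
    finally show ?thesis using False sm by (simp add: coeff_finite_def coeff_norm_def lev_powr r_def)
  qed
  then show "coeff_finite grid p q c" "coeff_norm grid p q c \<le> A" by auto
qed

definition block :: "(nat \<Rightarrow> 'a set \<Rightarrow> complex) \<Rightarrow> nat \<Rightarrow> 'a \<Rightarrow> complex" where
  "block c k x = (\<Sum>Q\<in>grid k. c k Q * atom M s p Q x)"

lemma block_eq_cell_sum: "block c k = cell_sum k (\<lambda>Q. c k Q * of_real (measure M Q powr (s - 1 / p)))"
  unfolding block_def[abs_def] cell_sum_def[abs_def]
  by (intro ext sum.cong) (auto simp: atom_def split: split_indicator)

lemma block_measurable [measurable]: "block c k \<in> borel_measurable M"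
  unfolding block_eq_cell_sum by (rule cell_sum_measurable)

text \<open>The height |Q|^(s - 1/p) of an atom is chosen for this identity: after weighting by
  |Q|^(-s) and integrating over Q, the measure cancels and only the coefficient is left.\<close>

lemma block_norm:
  "(\<integral>\<^sup>+x. ennreal (\<bar>cyl_meas k x powr (- s) * cmod (block c k x)\<bar> powr p) \<partial>M) = ennreal (lev c k powr p)"
proof -
  have "(\<integral>\<^sup>+x. ennreal (\<bar>cyl_meas k x powr (- s) * cmod (block c k x)\<bar> powr p) \<partial>M)
     = (\<Sum>Q\<in>grid k. \<integral>\<^sup>+x. indicator Q x * ennreal (\<bar>cyl_meas k x powr (- s) * cmod (block c k x)\<bar> powr p) \<partial>M)"
    by (intro nn_integral_grid) measurable
  also have "\<dots> = (\<Sum>Q\<in>grid k. ennreal (cmod (c k Q) powr p))"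
  proof (intro sum.cong refl)
    fix Q assume Q: "Q \<in> grid k"
    have [measurable]: "Q \<in> sets M" using Q by (rule sets_grid)
    let ?m = "measure M Q"
    have m: "0 < ?m" using Q by (rule measure_grid_pos)
    have val: "(?m powr (- s) * cmod (c k Q * of_real (?m powr (s - 1 / p)))) powr p = cmod (c k Q) powr p / ?m"
    proof -
      have "?m powr (- s) * cmod (c k Q * of_real (?m powr (s - 1 / p)))
          = cmod (c k Q) * (?m powr (- s) * ?m powr (s - 1 / p))"
        by (simp add: norm_mult mult_ac)
      also have "?m powr (- s) * ?m powr (s - 1 / p) = ?m powr (- (1 / p))"
        by (simp add: powr_add[symmetric])
      finally have "(?m powr (- s) * cmod (c k Q * of_real (?m powr (s - 1 / p)))) powr p
          = cmod (c k Q) powr p * ?m powr (- 1)"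
        using p_ge_1 by (simp add: powr_mult powr_powr)
      then show ?thesis using m by (simp add: powr_minus_divide)
    qed
    have "(\<integral>\<^sup>+x. indicator Q x * ennreal (\<bar>cyl_meas k x powr (- s) * cmod (block c k x)\<bar> powr p) \<partial>M)
      = (\<integral>\<^sup>+x. ennreal (cmod (c k Q) powr p / ?m) * indicator Q x \<partial>M)"
    proof (intro nn_integral_cong_AE eventually_mono[OF AE_D])
      fix x assume x: "x \<in> D"
      show "indicator Q x * ennreal (\<bar>cyl_meas k x powr (- s) * cmod (block c k x)\<bar> powr p)
        = ennreal (cmod (c k Q) powr p / ?m) * indicator Q x"
      proof (cases "x \<in> Q")
        case True
        then have "cyl k x = Q" using grid_member[OF Q _ x] by simp
        then have "cyl_meas k x powr (- s) * cmod (block c k x)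
            = ?m powr (- s) * cmod (c k Q * of_real (?m powr (s - 1 / p)))"
          by (simp add: block_eq_cell_sum cell_sum_eq[OF x] cyl_meas_def)
        then show ?thesis using True val by (simp add: abs_mult)
      qed simp
    qed
    also have "\<dots> = ennreal (cmod (c k Q) powr p / ?m) * ennreal ?m"
      by (subst nn_integral_cmult_indicator) (auto simp: emeasure_eq_measure)
    also have "\<dots> = ennreal (cmod (c k Q) powr p)"
      using m by (subst ennreal_mult[symmetric]) auto
    finally show "(\<integral>\<^sup>+x. indicator Q x * ennreal (\<bar>cyl_meas k x powr (- s) * cmod (block c k x)\<bar> powr p) \<partial>M)
       = ennreal (cmod (c k Q) powr p)" .
  qed
  also have "\<dots> = ennreal (\<Sum>Q\<in>grid k. cmod (c k Q) powr p)" by (rule sum_ennreal) simp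
  also have "(\<Sum>Q\<in>grid k. cmod (c k Q) powr p) = lev c k powr p"
    using p_ge_1 by (simp add: lev_powr sum_nonneg)
  finally show ?thesis .
qed

lemma wn_block: "wn k (block c k) (lev c k)"
  unfolding wn_def Lp_le_def block_norm by auto

lemma lev_le:
  assumes "wn k (block c k) b" shows "lev c k \<le> b"
proof -
  have "ennreal (lev c k powr p) \<le> ennreal (b powr p)"
    using assms unfolding wn_def Lp_le_def block_norm by simp
  then have "lev c k powr p \<le> b powr p" by (simp add: ennreal_le_iff)
  then show ?thesis
    using wn_nonneg[OF assms] p_ge_1 powr_less_mono2[of p b "lev c k"]
    by (meson linorder_not_less less_le_trans zero_less_one)
qed

lemma besov_represents_eq:
  "besov_represents M grid s p c \<psi> \<longleftrightarrow>
     (\<lambda>N. \<integral>\<^sup>+x. ennreal (cmod (\<psi> x - (\<Sum>k<N. block c k x)) powr p) \<partial>M) \<longlonglongrightarrow> 0"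
  by (simp add: besov_represents_def block_def)

text \<open>The factor \<open>decayC\<close> / (1 - \<theta>) is the Hardy inequality for tails and
  2 the passage to averages. In \<open>haarC\<close> the 2 counts the first block and the
  oscillation of the same level, \<open>growC\<close> the one of the previous level.\<close>

definition repC :: real where "repC = 2 * decayC / (1 - \<theta>)"
definition haarC :: real where "haarC = 2 + growC"

lemma repC: "0 < repC" and haarC: "0 < haarC"
  using decayC theta growC by (auto simp: repC_def haarC_def)

text \<open>The blocks below level k are constant on cells of level k, so the oscillation there is
  bounded by the tail of the series. The block of level k + i, measured at level k, is damped by
  \<theta>^i.\<close>

lemma represents_imp_Bes:
  assumes meas [measurable]: "\<psi> \<in> borel_measurable M"
    and rep: "besov_represents M grid s p c \<psi>" and fin: "coeff_finite grid p q c"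
  shows "Bes \<psi> (repC * coeff_norm grid p q c)"
proof -
  define A where "A = coeff_norm grid p q c"
  have lq: "lq_le q (lev c) A" unfolding A_def by (rule lq_le_coeff_norm[OF fin])
  have A0: "0 \<le> A" using lq_le_nonneg(2)[OF lq] .
  define S where "S N x = (\<Sum>k<N. block c k x)" for N x
  have Sm [measurable]: "S N \<in> borel_measurable M" for N unfolding S_def[abs_def] by measurable
  \<comment> \<open>The representation converges only in unweighted L^p. The error is asked to be
    small relative to \<open>growC\<close>^k, and k is fixed when e tends to 0.\<close>
  have small: "\<exists>N\<ge>k. wn 0 (\<lambda>x. \<psi> x - S N x) e" if e: "e > 0" for e and k :: nat
  proof -
    have "eventually (\<lambda>N. (\<integral>\<^sup>+x. ennreal (cmod (\<psi> x - S N x) powr p) \<partial>M) < ennreal (e powr p)) sequentially"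
      using rep e unfolding besov_represents_eq S_def by (intro order_tendstoD) auto
    then obtain N where "N \<ge> k" "(\<integral>\<^sup>+x. ennreal (cmod (\<psi> x - S N x) powr p) \<partial>M) < ennreal (e powr p)"
      by (auto simp: eventually_sequentially) (meson nat_le_linear order_refl)
    then show ?thesis using e by (intro exI[of _ N]) (auto simp: wn_0 Lp_le_def)
  qed
  define b where "b k = decayC * (\<Sum>i. \<theta> ^ i * lev c (k + i))" for k
  note gs = lq_le_geometric_shifts[OF lq less_imp_le[OF theta(1)] theta(2) q_ge_1]
  have blq: "lq_le q b (decayC * (A / (1 - \<theta>)))"
    unfolding b_def using decayC by (intro lq_le_cmult gs(1) q_ge_1) auto
  have b0: "0 \<le> b k" for k using lq_le_nonneg(1)[OF blq] .
  have tail: "wn k (\<lambda>x. \<psi> x - S k x) (b k)" for k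
  proof (rule wn_closed[OF _ b0])
    fix e :: real assume e: "e > 0"
    have "e / growC ^ k > 0" using e growC by simp
    from small[OF this, of k] obtain N where N: "N \<ge> k" "wn 0 (\<lambda>x. \<psi> x - S N x) (e / growC ^ k)" by blast
    have w1: "wn k (\<lambda>x. \<psi> x - S N x) e" using wn_finer[OF N(2), of k] growC by simp
    have split: "(\<Sum>m<k + l. block c m x) = (\<Sum>m<k. block c m x) + (\<Sum>i<l. block c (k + i) x)" for l x
      by (induction l) auto
    have "wn k (\<lambda>x. \<Sum>i<l. block c (k + i) x) (\<Sum>i<l. decayC * \<theta> ^ i * lev c (k + i))" for l
    proof (induction l)
      case 0
      then show ?case by (simp add: wn_def Lp_le_zero)
    next
      case (Suc l)
      then show ?case using wn_add[OF Suc wn_coarser[OF wn_block[of "k + l" c]]] by simp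
    qed
    from wn_add[OF w1 this[of "N - k"]]
    have "wn k (\<lambda>x. \<psi> x - S N x + (\<Sum>i<N - k. block c (k + i) x)) (e + (\<Sum>i<N - k. decayC * \<theta> ^ i * lev c (k + i)))" .
    then show "wn k (\<lambda>x. \<psi> x - S k x) (b k + e)"
    proof (rule wn_mono)
      have "S N x = S k x + (\<Sum>i<N - k. block c (k + i) x)" for x
      proof -
        have "S N x = (\<Sum>m<k + (N - k). block c m x)" using N(1) by (simp add: S_def)
        also have "\<dots> = S k x + (\<Sum>i<N - k. block c (k + i) x)"
          unfolding S_def by (rule split)
        finally show ?thesis .
      qed
      then show "cmod (\<psi> x - S k x) \<le> cmod (\<psi> x - S N x + (\<Sum>i<N - k. block c (k + i) x))" for x by simp
      have "(\<Sum>i<N - k. \<theta> ^ i * lev c (k + i)) \<le> (\<Sum>i. \<theta> ^ i * lev c (k + i))"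
        using theta by (intro sum_le_suminf gs(2)) auto
      then have "decayC * (\<Sum>i<N - k. \<theta> ^ i * lev c (k + i)) \<le> b k"
        unfolding b_def using decayC by (intro mult_left_mono) auto
      then show "e + (\<Sum>i<N - k. decayC * \<theta> ^ i * lev c (k + i)) \<le> b k + e"
        by (simp add: sum_distrib_left mult.assoc)
    qed measurable
  qed
  have w0: "wn 0 \<psi> (b 0)" using tail[of 0] by (simp add: S_def)
  have int: "integrable M \<psi>" by (rule wn_integrable[OF w0])
  have osc: "wn k (\<lambda>x. \<psi> x - cexp k \<psi> x) (2 * b k)" for k
  proof (rule wn_osc_le[OF wn_mono[OF tail[of k]] int])
    fix x assume x: "x \<in> D"
    have "block c m (cell_point (cyl k x)) = block c m x" if "m < k" for m
      using cyl_eq[OF same_mono[OF cell_point(2)[OF x, of k], of m]] that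
      by (simp add: block_eq_cell_sum cell_sum_eq[OF x] cell_sum_eq[OF cell_point(1)[OF x]])
    then have "cell_sum k (\<lambda>W. S k (cell_point W)) x = S k x"
      unfolding cell_sum_eq[OF x] S_def by (intro sum.cong) auto
    then show "cmod (\<psi> x - cell_sum k (\<lambda>W. S k (cell_point W)) x) \<le> cmod (\<psi> x - S k x)" by simp
  qed auto
  have e: "2 * (decayC * (A / (1 - \<theta>))) = repC * A" by (simp add: repC_def)
  have l2: "lq_le q (\<lambda>k. 2 * b k) (repC * A)"
    using lq_le_cmult[OF blq _ q_ge_1, of 2] unfolding e by simp
  moreover have "wn 0 \<psi> (repC * A)"
    using lq_le_single[OF l2 q_ge_1, of 0] b0[of 0] by (intro wn_mono[OF w0]) auto
  ultimately show ?thesis using osc unfolding Bes_def A_def by blast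
qed

lemma Bes_Lp: "Bes \<psi> A \<Longrightarrow> \<psi> \<in> Lp_functions M p"
proof -
  assume B: "Bes \<psi> A"
  have [measurable]: "\<psi> \<in> borel_measurable M" using Bes_measurable[OF B] .
  have "(\<integral>\<^sup>+x. ennreal (cmod (\<psi> x) powr p) \<partial>M) \<le> ennreal (A powr p)"
    using B by (auto simp: Bes_def wn_0 Lp_le_def)
  also have "\<dots> < \<infinity>" by simp
  finally have "integrable M (\<lambda>x. cmod (\<psi> x) powr p)" by (intro integrableI_bounded) auto
  then show ?thesis by (simp add: Lp_functions_def)
qed

text \<open>The coefficients come from the differences E_k psi - E_{k-1} psi, with zero in place of
  E_{-1} psi; the partial sums are then exactly the averages.\<close>

lemma Bes_imp_represents:
  assumes "Bes \<psi> A"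
  obtains c where "besov_represents M grid s p c \<psi>" "coeff_finite grid p q c"
    "coeff_norm grid p q c \<le> haarC * A"
proof -
  obtain a where a: "wn 0 \<psi> A" "lq_le q a A" "\<And>k. wn k (\<lambda>x. \<psi> x - cexp k \<psi> x) (a k)"
    using assms unfolding Bes_def by blast
  have [measurable]: "\<psi> \<in> borel_measurable M" using Bes_measurable[OF assms] .
  have A: "0 \<le> A" using Bes_nonneg[OF assms] .
  define d where "d k x = cexp k \<psi> x - (case k of 0 \<Rightarrow> 0 | Suc m \<Rightarrow> cexp m \<psi> x)" for k x
  \<comment> \<open>The difference is constant on the cell, so the representative gives its value;
    the power cancels the height of the atom.\<close>
  define c where "c k Q = d k (cell_point Q) * of_real (measure M Q powr (1 / p - s))" for k Q
  have blk: "block c k x = d k x" if x: "x \<in> D" for k x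
  proof -
    have "cexp m \<psi> (cell_point (cyl k x)) = cexp m \<psi> x" if "m \<le> k" for m
      using cyl_eq[OF same_mono[OF cell_point(2)[OF x, of k] that]]
      by (simp add: cexp_def cell_sum_eq[OF x] cell_sum_eq[OF cell_point(1)[OF x]])
    then have "d k (cell_point (cyl k x)) = d k x" by (auto simp: d_def split: nat.split)
    moreover have "measure M (cyl k x) powr (1 / p - s) * measure M (cyl k x) powr (s - 1 / p) = 1"
      using cyl_meas_pos[OF x, of k] by (simp add: cyl_meas_def powr_add[symmetric])
    then have "complex_of_real (measure M (cyl k x) powr (1 / p - s)) * complex_of_real (measure M (cyl k x) powr (s - 1 / p)) = 1"
      by (metis of_real_1 of_real_mult)
    ultimately show ?thesis
      by (simp add: block_eq_cell_sum cell_sum_eq[OF x] c_def mult.assoc)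
  qed
  have tel: "(\<Sum>k<Suc m. block c k x) = cexp m \<psi> x" if "x \<in> D" for m x
    by (induction m) (simp_all add: blk[OF that] d_def)
  \<comment> \<open>An oscillation with bounded weighted norm at level m has L^p norm of order
    \<theta>^m.\<close>
  have "(\<lambda>m. \<integral>\<^sup>+x. ennreal (cmod (\<psi> x - (\<Sum>k<Suc m. block c k x)) powr p) \<partial>M) \<longlonglongrightarrow> 0"
  proof (rule tendsto_sandwich[OF always_eventually always_eventually tendsto_const])
    show "\<forall>m. (\<integral>\<^sup>+x. ennreal (cmod (\<psi> x - (\<Sum>k<Suc m. block c k x)) powr p) \<partial>M) \<le> ennreal ((decayC * \<theta> ^ m * A) powr p)"
    proof
      fix m
      have w: "wn 0 (\<lambda>x. \<psi> x - cexp m \<psi> x) (decayC * \<theta> ^ m * a m)"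
        using wn_coarser[of 0 m] a(3)[of m] by simp
      have "(\<integral>\<^sup>+x. ennreal (cmod (\<psi> x - (\<Sum>k<Suc m. block c k x)) powr p) \<partial>M)
          = (\<integral>\<^sup>+x. ennreal (cmod (\<psi> x - cexp m \<psi> x) powr p) \<partial>M)"
        by (intro nn_integral_cong_AE eventually_mono[OF AE_D]) (simp only: tel)
      also have "\<dots> \<le> ennreal ((decayC * \<theta> ^ m * a m) powr p)"
        using w by (simp add: wn_0 Lp_le_def)
      also have "\<dots> \<le> ennreal ((decayC * \<theta> ^ m * A) powr p)"
        using lq_le_single[OF a(2) q_ge_1, of m] lq_le_nonneg[OF a(2)] decayC theta p_ge_1
        by (intro ennreal_leI powr_mono2 mult_left_mono) auto
      finally show "(\<integral>\<^sup>+x. ennreal (cmod (\<psi> x - (\<Sum>k<Suc m. block c k x)) powr p) \<partial>M)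
          \<le> ennreal ((decayC * \<theta> ^ m * A) powr p)" .
    qed
    have "(\<lambda>m. decayC * \<theta> ^ m * A) \<longlonglongrightarrow> decayC * 0 * A"
      using theta by (intro tendsto_intros LIMSEQ_power_zero) auto
    then have "(\<lambda>m. (decayC * \<theta> ^ m * A) powr p) \<longlonglongrightarrow> (decayC * 0 * A) powr p"
      using p_ge_1 decayC theta A by (intro tendsto_powr2 tendsto_const always_eventually) auto
    then show "(\<lambda>m. ennreal ((decayC * \<theta> ^ m * A) powr p)) \<longlonglongrightarrow> 0"
      using tendsto_ennrealI by fastforce
  qed simp
  then have rep: "besov_represents M grid s p c \<psi>"
    unfolding besov_represents_eq by (rule LIMSEQ_imp_Suc)
  \<comment> \<open>The term A at k = 0 accounts for the first block, which is the average itself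
    and not an oscillation.\<close>
  define b where "b k = (if k = 0 then A else 0) + (a k + growC * (case k of 0 \<Rightarrow> 0 | Suc m \<Rightarrow> a m))" for k
  have levb: "lev c k \<le> b k" for k
  proof (rule lev_le)
    show "wn k (block c k) (b k)"
    proof (cases k)
      case 0
      show ?thesis
        by (rule wn_mono[OF wn_cexp[OF a(1), folded 0]])
          (use 0 lq_le_nonneg[OF a(2)] in \<open>auto simp: blk d_def b_def\<close>)
    next
      case (Suc m)
      have "wn k (block c k) (a k + growC * a m)"
        unfolding Suc
      proof (rule wn_add_le[OF a(3)[of "Suc m"] wn_Suc[OF a(3)[of m]]])
        fix x assume x: "x \<in> D"
        show "cmod (block c (Suc m) x) \<le> cmod (\<psi> x - cexp (Suc m) \<psi> x) + cmod (\<psi> x - cexp m \<psi> x)"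
          using norm_triangle_ineq4[of "\<psi> x - cexp m \<psi> x" "\<psi> x - cexp (Suc m) \<psi> x"]
          by (simp add: blk[OF x] d_def)
      qed measurable
      then show ?thesis by (simp add: b_def Suc)
    qed
  qed
  have "lq_le q b (A + (A + growC * A))"
    unfolding b_def using a(2) A growC by (intro lq_le_add lq_le_delta lq_le_cmult lq_le_cons q_ge_1) auto
  then have "lq_le q (lev c) (haarC * A)"
    by (rule lq_le_mono) (use levb q_ge_1 in \<open>auto simp: haarC_def algebra_simps\<close>)
  from that[OF rep coeff_norm_le[OF this]] show thesis .
qed

section \<open>Transfer of the Fredholm property to the Besov space\<close>

abbreviation V :: "('a \<Rightarrow> complex) set" where "V \<equiv> besov_space M grid s p q"
abbreviation N :: "('a \<Rightarrow> complex) \<Rightarrow> real" where "N \<equiv> besov_norm M grid s p q"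

lemma besov_space_iff: "\<psi> \<in> V \<longleftrightarrow> (\<exists>A. Bes \<psi> A)"
proof
  assume "\<psi> \<in> V"
  then show "\<exists>A. Bes \<psi> A"
    using represents_imp_Bes by (force simp: besov_space_def Lp_functions_def)
next
  assume "\<exists>A. Bes \<psi> A"
  then obtain A where A: "Bes \<psi> A" ..
  from Bes_imp_represents[OF A] Bes_Lp[OF A] show "\<psi> \<in> V" unfolding besov_space_def by blast
qed

lemma besov_norm_le:
  assumes "Bes \<psi> A" shows "N \<psi> \<le> haarC * A"
proof -
  obtain c where c: "besov_represents M grid s p c \<psi>" "coeff_finite grid p q c"
    "coeff_norm grid p q c \<le> haarC * A" by (rule Bes_imp_represents[OF assms])
  have "N \<psi> \<le> coeff_norm grid p q c"
    unfolding besov_norm_def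
  proof (rule cInf_lower)
    show "bdd_below {coeff_norm grid p q c |c. besov_represents M grid s p c \<psi> \<and> coeff_finite grid p q c}"
      by (rule bdd_belowI[of _ 0]) (auto intro: lq_le_nonneg(2)[OF lq_le_coeff_norm])
  qed (use c in auto)
  then show ?thesis using c by simp
qed

text \<open>The infimum over representations need not be attained, hence the additional e.\<close>

lemma Bes_besov_norm:
  assumes "\<psi> \<in> V" "0 < e" shows "Bes \<psi> (repC * (N \<psi> + e))"
proof -
  let ?S = "{coeff_norm grid p q c |c. besov_represents M grid s p c \<psi> \<and> coeff_finite grid p q c}"
  have ne: "?S \<noteq> {}" using assms(1) by (auto simp: besov_space_def)
  have "Inf ?S < N \<psi> + e" using assms(2) by (simp add: besov_norm_def)
  from cInf_lessD[OF ne this] obtain c where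
    c: "besov_represents M grid s p c \<psi>" "coeff_finite grid p q c" "coeff_norm grid p q c < N \<psi> + e" by auto
  have [measurable]: "\<psi> \<in> borel_measurable M" using assms(1) by (simp add: besov_space_def Lp_functions_def)
  show ?thesis
    by (rule Bes_mono[OF represents_imp_Bes[OF _ c(1,2)]]) (use c(3) repC in auto)
qed

lemma fredholm_transfer:
  assumes T1: "\<exists>C\<ge>0. \<forall>\<psi> A. Bes \<psi> A \<longrightarrow> Bes (T \<psi>) (C * A)"
    and hoelder: "fib_hoelder j \<tau>" and contraction: "essC * \<tau> < cmod z ^ j" and j: "0 < j"
  shows "fredholm_on M V N (\<lambda>u x. z * u x - T u x)"
proof -
  obtain C where C: "C \<ge> 0" "\<And>\<psi> A. Bes \<psi> A \<Longrightarrow> Bes (T \<psi>) (C * A)" using T1 by blast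
  define S where "S u x = z * u x - T u x" for u x
  have SB: "Bes (S u) ((cmod z + C) * A)" if "Bes u A" for u A
    using Bes_lincomb[OF that C(2)[OF that], of z "-1"] by (simp add: S_def[abs_def] distrib_right)
  have bounded: "bounded_operator_on M V N S"
    unfolding bounded_operator_on_def
  proof (intro conjI ballI allI impI)
    show "S u \<in> V" if "u \<in> V" for u using that SB unfolding besov_space_iff by blast
    show "AE x in M. S u x = S v x" if "AE x in M. u x = v x" for u v
      using that T_pow_cong_AE[OF that, of 1] by eventually_elim (simp add: S_def)
    show "AE x in M. S (\<lambda>y. a * u y + b * v y) x = a * S u x + b * S v x" for u v a b
      using T_pow_lincomb[of 1 a u b v] by (simp add: S_def algebra_simps)
    show "\<exists>K. \<forall>u\<in>V. N (S u) \<le> K * N u"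
    proof (intro exI ballI)
      fix u assume u: "u \<in> V"
      define K where "K = haarC * ((cmod z + C) * repC)"
      have K: "0 \<le> K" using haarC repC C by (auto simp: K_def)
      show "N (S u) \<le> haarC * ((cmod z + C) * repC) * N u"
        unfolding K_def[symmetric]
      proof (rule field_le_epsilon)
        fix e :: real assume e: "e > 0"
        \<comment> \<open>The slack of the infimum is multiplied by K, so it is chosen to contribute
          at most e; adding 1 avoids division by zero.\<close>
        define e' where "e' = e / (K + 1)"
        have e': "e' > 0" "K * e' \<le> e" using e K by (auto simp: e'_def field_simps)
        have "N (S u) \<le> K * (N u + e')"
          using besov_norm_le[OF SB[OF Bes_besov_norm[OF u e'(1)]]] by (simp add: K_def mult.assoc)
        then show "N (S u) \<le> K * N u + e" using e' by (simp add: distrib_left)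
      qed
    qed
  qed
  \<comment> \<open>The cells are numbered because \<open>fredholm_on\<close> asks for families
    indexed by an initial segment of the naturals.\<close>
  obtain h where "bij_betw h {0..<card (grid j)} (grid j)" using ex_bij_betw_nat_finite[OF finite_grid] by blast
  then have h: "bij_betw h {..<card (grid j)} (grid j)" by (simp add: atLeast0LessThan)
  have hin: "h i \<in> grid j" if "i < card (grid j)" for i using h that by (auto simp: bij_betw_def)
  have re: "(\<Sum>Q\<in>grid j. F Q) = (\<Sum>i<card (grid j). F (h i))" for F :: "'a set \<Rightarrow> complex"
    by (rule sum.reindex_bij_betw[OF h, symmetric])
  have ker: "\<exists>(d::nat) e. (\<forall>i<d. e i \<in> V) \<and>
        (\<forall>u\<in>V. (AE x in M. S u x = 0) \<longrightarrow> (\<exists>c. AE x in M. u x = (\<Sum>i<d. c i * e i x)))"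
  proof -
    from fredholm_kernel[OF hoelder contraction j T1] obtain g B where g: "\<forall>Q. Bes (g Q) (B Q)"
      "\<forall>u A. Bes u A \<longrightarrow> (AE x in M. z * u x - T u x = 0) \<longrightarrow> (AE x in M. u x = (\<Sum>Q\<in>grid j. avg u Q * g Q x))"
      by (elim exE conjE)
    show ?thesis
    proof (intro exI[of _ "card (grid j)"] exI[of _ "\<lambda>i. g (h i)"] conjI allI ballI impI)
      show "g (h i) \<in> V" if "i < card (grid j)" for i using g(1) besov_space_iff by blast
      fix u assume u: "u \<in> V" and k: "AE x in M. S u x = 0"
      obtain A where "Bes u A" using u besov_space_iff by blast
      with g(2) k[unfolded S_def] have "AE x in M. u x = (\<Sum>Q\<in>grid j. avg u Q * g Q x)" by blast
      then have "AE x in M. u x = (\<Sum>i<card (grid j). avg u (h i) * g (h i) x)"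
        by (simp add: re)
      then show "\<exists>c. AE x in M. u x = (\<Sum>i<card (grid j). c i * g (h i) x)"
        by (intro exI[of _ "\<lambda>i. avg u (h i)"])
    qed
  qed
  have ran: "\<exists>(d::nat) e. (\<forall>i<d. e i \<in> V) \<and>
        (\<forall>v\<in>V. \<exists>u\<in>V. \<exists>c. AE x in M. v x = S u x + (\<Sum>i<d. c i * e i x))"
  proof (intro exI[of _ "card (grid j)"] exI[of _ "\<lambda>i. (T ^^ j) (cellfun j (h i))"] conjI allI ballI impI)
    show "(T ^^ j) (cellfun j (h i)) \<in> V" for i
      using transfer_pow_Bes[OF T1] Bes_cell_sum unfolding besov_space_iff cellfun_def by blast
    fix v assume "v \<in> V"
    then obtain A where "Bes v A" using besov_space_iff by blast
    from fredholm_range[OF hoelder contraction j T1 this]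
    obtain u B c where u: "Bes u B"
      "AE x in M. v x = (z * u x - T u x) + (\<Sum>Q\<in>grid j. c Q * (T ^^ j) (cellfun j Q) x)" by blast
    have "u \<in> V" using u(1) besov_space_iff by blast
    moreover have "AE x in M. v x = S u x + (\<Sum>i<card (grid j). c (h i) * (T ^^ j) (cellfun j (h i)) x)"
      using u(2) by (simp add: S_def re)
    ultimately show "\<exists>u\<in>V. \<exists>c. AE x in M. v x = S u x + (\<Sum>i<card (grid j). c i * (T ^^ j) (cellfun j (h i)) x)"
      by (intro bexI[of _ u] exI[of _ "\<lambda>i. c (h i)"])
  qed
  have "fredholm_on M V N S" unfolding fredholm_on_def using bounded ker ran by blast
  then show ?thesis by (simp add: S_def[abs_def])
qed

section \<open>The essential spectral radius\<close>

lemma sum_grid_measure: "(\<Sum>Q\<in>grid j. measure M Q) = 1"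
proof -
  have "(\<integral>\<^sup>+x. 1 \<partial>M) = (\<Sum>Q\<in>grid j. \<integral>\<^sup>+x. indicator Q x * 1 \<partial>M)" by (rule nn_integral_grid) simp
  also have "\<dots> = (\<Sum>Q\<in>grid j. ennreal (measure M Q))"
    using sets_grid by (intro sum.cong) (auto simp: emeasure_eq_measure)
  also have "\<dots> = ennreal (\<Sum>Q\<in>grid j. measure M Q)" by (rule sum_ennreal) simp
  finally have "ennreal (\<Sum>Q\<in>grid j. measure M Q) = ennreal 1" by (simp add: emeasure_space_1)
  then show ?thesis by (subst (asm) ennreal_inj) (auto intro: sum_nonneg)
qed

lemma grid_measure_le: "Q \<in> grid j \<Longrightarrow> measure M Q \<le> contr ^ j"
  using cyl_meas_le_power by (auto simp: grid_eq cyl_meas_def)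

text \<open>One factor |Q| sums to 1 over the partition, and the remaining power is at most that of
  the largest cell. This yields the explicit bound (inf w)^(-s).\<close>

lemma sum_grid_powr_le:
  assumes "0 \<le> a" shows "(\<Sum>Q\<in>grid j. measure M Q powr (1 + a)) \<le> (contr ^ j) powr a"
proof -
  have "(\<Sum>Q\<in>grid j. measure M Q powr (1 + a)) \<le> (\<Sum>Q\<in>grid j. measure M Q * (contr ^ j) powr a)"
  proof (rule sum_mono)
    fix Q assume Q: "Q \<in> grid j"
    have "measure M Q powr a \<le> (contr ^ j) powr a"
      using grid_measure_le[OF Q] assms by (intro powr_mono2) auto
    then show "measure M Q powr (1 + a) \<le> measure M Q * (contr ^ j) powr a"
      using measure_grid_pos[OF Q] by (simp add: powr_add)
  qed
  also have "\<dots> = (contr ^ j) powr a" by (simp add: sum_distrib_right[symmetric] sum_grid_measure)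
  finally show ?thesis .
qed

text \<open>Hoelder's inequality with respect to the weights G_j on the fibre. The conjugate factor
  is the fibre sum of G_j |Q_j|^(s p'), and G_j is at most \<open>distC\<close> |Q_j|, which
  produces the sum of |Q|^(1 + s p').\<close>

lemma fib_hoelder_conjugate:
  assumes p: "1 < p" and p': "1 / p + 1 / p' = 1"
  shows "fib_hoelder j ((distC * (\<Sum>Q\<in>grid j. measure M Q powr (1 + s * p'))) powr (1 / p'))"
  unfolding fib_hoelder_def
proof (intro conjI ballI allI impI)
  define \<sigma> where "\<sigma> = (\<Sum>Q\<in>grid j. measure M Q powr (1 + s * p'))"
  have \<sigma>: "0 \<le> \<sigma>" unfolding \<sigma>_def by (intro sum_nonneg) auto
  have p'0: "p' \<noteq> 0" using p' p by auto
  have pp: "p + p' = p * p'" using p' p p'0 by (simp add: field_simps)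
  fix x and a :: "'a \<Rightarrow> real" assume x: "x \<in> D" and a: "\<forall>y. 0 \<le> a y"
  define Z where "Z = (\<Sum>y\<in>fib j x. G j y * cyl_meas j y powr (s * p'))"
  have pos: "0 < G j y" "0 < cyl_meas j y" if "y \<in> fib j x" for y
    using that G_pos cyl_meas_pos by (auto simp: fib_def)
  show "(\<Sum>y\<in>fib j x. G j y * cyl_meas j y powr s * a y) powr p
      \<le> ((distC * (\<Sum>Q\<in>grid j. measure M Q powr (1 + s * p'))) powr (1 / p')) powr p * (\<Sum>y\<in>fib j x. G j y * a y powr p)"
  proof (cases "fib j x = {}")
    case True
    then show ?thesis using p by simp
  next
    case False
    have "0 < G j y * cyl_meas j y powr (s * p')" if "y \<in> fib j x" for y using pos[OF that] by simp
    then have Z: "0 < Z" unfolding Z_def using False by (intro sum_pos finite_fib)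
    \<comment> \<open>The normalised weights t realise the equality case of Hoelder's inequality,
      and b is what remains of the summand after division by Z t.\<close>
    define t b where "t y = G j y * cyl_meas j y powr (s * p') / Z" and "b y = a y * cyl_meas j y powr (s - s * p')" for y
    have tb: "Z * (t y * b y) = G j y * cyl_meas j y powr s * a y" if "y \<in> fib j x" for y
      using Z pos[OF that] by (simp add: t_def b_def powr_diff)
    have tbp: "t y * b y powr p = G j y * a y powr p / Z" if "y \<in> fib j x" for y
    proof -
      \<comment> \<open>This is p + p' = p p': the powers of the cell measure cancel in t
        b^p.\<close>
      have e: "s * p' + (s - s * p') * p = 0"
        using arg_cong[OF pp, of "\<lambda>r. s * r"] by (simp add: algebra_simps)
      have "cyl_meas j y powr (s * p') * (cyl_meas j y powr (s - s * p')) powr p = 1"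
        using pos[OF that] e by (simp add: powr_powr powr_add[symmetric])
      then have "G j y * (cyl_meas j y powr (s * p') * (cyl_meas j y powr (s - s * p')) powr p) * a y powr p / Z = G j y * a y powr p / Z"
        by simp
      then show ?thesis using a by (simp add: t_def b_def powr_mult mult_ac)
    qed
    have "(\<Sum>y\<in>fib j x. G j y * cyl_meas j y powr s * a y) = Z * (\<Sum>y\<in>fib j x. t y * b y)"
      by (simp add: sum_distrib_left tb)
    then have "(\<Sum>y\<in>fib j x. G j y * cyl_meas j y powr s * a y) powr p = Z powr p * (\<Sum>y\<in>fib j x. t y * b y) powr p"
      by (simp add: powr_mult)
    also have "\<dots> \<le> Z powr p * (\<Sum>y\<in>fib j x. t y * b y powr p)"
    proof (intro mult_left_mono powr_sum_le_weighted)
      show "sum t (fib j x) = 1" using Z by (simp add: t_def sum_divide_distrib[symmetric] Z_def[symmetric])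
    qed (use p a Z pos finite_fib in \<open>auto simp: t_def b_def less_imp_le\<close>)
    also have "(\<Sum>y\<in>fib j x. t y * b y powr p) = (\<Sum>y\<in>fib j x. G j y * a y powr p) / Z"
      by (simp add: tbp sum_divide_distrib)
    also have "Z powr p * ((\<Sum>y\<in>fib j x. G j y * a y powr p) / Z) = Z powr (p - 1) * (\<Sum>y\<in>fib j x. G j y * a y powr p)"
      using Z by (simp add: powr_diff)
    also have "\<dots> \<le> (distC * \<sigma>) powr (p - 1) * (\<Sum>y\<in>fib j x. G j y * a y powr p)"
    proof (intro mult_right_mono powr_mono2)
      have "Z \<le> (\<Sum>y\<in>fib j x. distC * cyl_meas j y powr (1 + s * p'))"
        unfolding Z_def
      proof (rule sum_mono)
        fix y assume y: "y \<in> fib j x"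
        have "G j y * cyl_meas j y powr (s * p') \<le> distC * cyl_meas j y * cyl_meas j y powr (s * p')"
          using G_le y by (intro mult_right_mono) (auto simp: fib_def)
        then show "G j y * cyl_meas j y powr (s * p') \<le> distC * cyl_meas j y powr (1 + s * p')"
          using pos[OF y] by (simp add: powr_add)
      qed
      also have "\<dots> \<le> distC * \<sigma>"
        unfolding sum_distrib_left[symmetric] \<sigma>_def using distC(1)
        by (intro mult_left_mono sum_fib_cyl_meas_le) auto
      finally show "Z \<le> distC * \<sigma>" .
      show "0 \<le> (\<Sum>y\<in>fib j x. G j y * a y powr p)" by (rule fib_sum_nonneg) simp
    qed (use Z p in auto)
    also have "(distC * \<sigma>) powr (p - 1) = ((distC * \<sigma>) powr (1 / p')) powr p"
    proof -
      have "p - 1 = 1 / p' * p" using pp p'0 by (simp add: field_simps)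
      then show ?thesis by (simp add: powr_powr)
    qed
    finally show ?thesis unfolding \<sigma>_def .
  qed
qed simp

text \<open>For p = 1 the conjugate sum degenerates to a maximum, which is taken out of the fibre
  sum.\<close>

lemma fib_hoelder_1:
  assumes p: "p = 1"
  shows "fib_hoelder j (Max ((\<lambda>Q. measure M Q powr s) ` grid j))"
proof -
  define m where "m = Max ((\<lambda>Q. measure M Q powr s) ` grid j)"
  have le: "measure M Q powr s \<le> m" if "Q \<in> grid j" for Q
    unfolding m_def using that finite_grid by (intro Max_ge) auto
  obtain x0 where "x0 \<in> D" using D_nonempty by blast
  then have m0: "0 \<le> m" using le[OF grid_cyl] by (meson order_trans powr_ge_zero)
  show ?thesis
    unfolding fib_hoelder_def m_def[symmetric]
  proof (intro conjI ballI allI impI m0)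
    fix x and a :: "'a \<Rightarrow> real" assume x: "x \<in> D" and a: "\<forall>y. 0 \<le> a y"
    have "(\<Sum>y\<in>fib j x. G j y * cyl_meas j y powr s * a y) \<le> (\<Sum>y\<in>fib j x. m * (G j y * a y))"
    proof (rule sum_mono)
      fix y assume "y \<in> fib j x"
      then have y: "y \<in> D" by (simp add: fib_def)
      have "cyl_meas j y powr s * (G j y * a y) \<le> m * (G j y * a y)"
        using le[OF grid_cyl[OF y]] G_pos[OF y, of j] a by (intro mult_right_mono) (auto simp: cyl_meas_def)
      then show "G j y * cyl_meas j y powr s * a y \<le> m * (G j y * a y)" by (simp add: mult_ac)
    qed
    moreover have "0 \<le> (\<Sum>y\<in>fib j x. G j y * cyl_meas j y powr s * a y)"
      using fib_sum_nonneg[of "\<lambda>y. cyl_meas j y powr s * a y" j x] a by (simp add: mult.assoc)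
    moreover have "0 \<le> (\<Sum>y\<in>fib j x. G j y * a y)" using a by (intro fib_sum_nonneg) auto
    ultimately show "(\<Sum>y\<in>fib j x. G j y * cyl_meas j y powr s * a y) powr p \<le> m powr p * (\<Sum>y\<in>fib j x. G j y * a y powr p)"
      using p a m0 by (simp add: sum_distrib_left)
  qed
qed

text \<open>A constant K is harmless because (r / |z|)^j tends to 0, and a bound for infinitely many
  j suffices because one exponent decides about z.\<close>

lemma essential_radius_le:
  assumes "\<And>z. B < ennreal (cmod z) \<Longrightarrow>
      \<exists>K r. 0 \<le> K \<and> 0 \<le> r \<and> r < cmod z \<and> (\<exists>\<^sub>F j in sequentially. \<exists>\<tau>. fib_hoelder j \<tau> \<and> \<tau> \<le> K * r ^ j)"
    and T1: "\<exists>\<tau>. fib_hoelder (Suc 0) \<tau>"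
  shows "essential_spectral_radius M V N T \<le> B"
  unfolding essential_spectral_radius_def
proof (rule SUP_least, rule ccontr)
  fix z assume z: "z \<in> essential_spectrum M V N T" and "\<not> ennreal (cmod z) \<le> B"
  then have "B < ennreal (cmod z)" by simp
  from assms(1)[OF this] obtain K r where K: "0 \<le> K" and r: "0 \<le> r" "r < cmod z"
    and freq: "\<exists>\<^sub>F j in sequentially. \<exists>\<tau>. fib_hoelder j \<tau> \<and> \<tau> \<le> K * r ^ j" by blast
  have z0: "0 < cmod z" using r by linarith
  have "(\<lambda>j. essC * K * (r / cmod z) ^ j) \<longlonglongrightarrow> essC * K * 0"
    using r z0 by (intro tendsto_intros LIMSEQ_power_zero) auto
  then have "eventually (\<lambda>j. essC * K * (r / cmod z) ^ j < 1) sequentially"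
    by (intro order_tendstoD) auto
  moreover have "eventually (\<lambda>j. 0 < j) sequentially" by (rule eventually_gt_at_top)
  ultimately have "eventually (\<lambda>j. essC * K * (r / cmod z) ^ j < 1 \<and> 0 < j) sequentially"
    by (rule eventually_conj)
  from frequently_eventually_frequently[OF freq this] obtain j \<tau> where j: "fib_hoelder j \<tau>" "\<tau> \<le> K * r ^ j"
    "essC * K * (r / cmod z) ^ j < 1" "0 < j" by (auto dest!: frequently_ex)
  have "essC * \<tau> \<le> essC * (K * r ^ j)" using j(2) essC(1) by (intro mult_left_mono) auto
  also have "\<dots> = essC * K * (r / cmod z) ^ j * cmod z ^ j" using z0 by (simp add: power_divide)
  also have "\<dots> < 1 * cmod z ^ j" using j(3) z0 by (intro mult_strict_right_mono) auto
  finally have "essC * \<tau> < cmod z ^ j" by simp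
  moreover have "\<exists>C\<ge>0. \<forall>\<psi> A. Bes \<psi> A \<longrightarrow> Bes (T \<psi>) (C * A)" using T1 Bes_transfer by blast
  ultimately have "fredholm_on M V N (\<lambda>u x. z * u x - T u x)"
    using j by (intro fredholm_transfer)
  then show False using z by (simp add: essential_spectrum_def)
qed

lemma theta_eq: "\<theta> = infw powr (- s)"
  using infw_gt_1 by (simp add: \<theta>_def contr_def powr_divide powr_minus_divide)

lemma essential_radius_conjugate:
  assumes p: "1 < p" and p': "1 / p + 1 / p' = 1"
  shows "essential_spectral_radius M V N T \<le> ennreal (enn2real (liminf (\<lambda>j. ennreal
           ((\<Sum>Q\<in>grid j. measure M Q powr (1 + s * p')) powr (1 / real j)))) powr (1 / p'))" (is "?r \<le> ?B")
    and "essential_spectral_radius M V N T \<le> ennreal \<theta>"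
proof -
  define \<sigma> where "\<sigma> j = (\<Sum>Q\<in>grid j. measure M Q powr (1 + s * p'))" for j
  have \<sigma>0: "0 \<le> \<sigma> j" for j unfolding \<sigma>_def by (intro sum_nonneg) auto
  have "1 / p' = 1 - 1 / p" using p' by linarith
  moreover have "1 / p < 1" using p by simp
  ultimately have "1 / p' > 0" by linarith
  then have p'0: "p' > 0" by simp
  have T1: "\<exists>\<tau>. fib_hoelder (Suc 0) \<tau>" using fib_hoelder_conjugate[OF p p'] by blast
  have fh: "\<exists>\<tau>. fib_hoelder j \<tau> \<and> \<tau> \<le> distC powr (1 / p') * (r powr (1 / p')) ^ j"
    if "\<sigma> j \<le> r ^ j" "0 < r" for j r
  proof (intro exI conjI)
    show "fib_hoelder j ((distC * \<sigma> j) powr (1 / p'))" unfolding \<sigma>_def by (rule fib_hoelder_conjugate[OF p p'])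
    have "(distC * \<sigma> j) powr (1 / p') \<le> (distC * r ^ j) powr (1 / p')"
      using that \<sigma>0 distC(1) p'0 by (intro powr_mono2 mult_left_mono) auto
    also have "\<dots> = distC powr (1 / p') * (r powr (1 / p')) ^ j"
    proof -
      have "(r ^ j) powr (1 / p') = (r powr real j) powr (1 / p')" using that by (simp add: powr_realpow)
      also have "\<dots> = (r powr (1 / p')) powr real j" by (simp add: powr_powr mult.commute)
      also have "\<dots> = (r powr (1 / p')) ^ j" using that by (simp add: powr_realpow)
      finally show ?thesis by (simp add: powr_mult)
    qed
    finally show "(distC * \<sigma> j) powr (1 / p') \<le> distC powr (1 / p') * (r powr (1 / p')) ^ j" .
  qed
  have \<sigma>c: "\<sigma> j \<le> (contr powr (s * p')) ^ j" for j
    using sum_grid_powr_le[of "s * p'" j] s_pos p'0 by (simp add: \<sigma>_def contr_power_powr)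
  show "?r \<le> ennreal \<theta>"
  proof (rule essential_radius_le[OF _ T1])
    fix z assume "ennreal \<theta> < ennreal (cmod z)"
    then have z: "\<theta> < cmod z" using theta by (simp add: ennreal_less_iff)
    have e: "(contr powr (s * p')) powr (1 / p') = \<theta>" using p'0 by (simp add: powr_powr \<theta>_def)
    have "\<exists>\<tau>. fib_hoelder j \<tau> \<and> \<tau> \<le> distC powr (1 / p') * \<theta> ^ j" for j
      using fh[OF \<sigma>c] contr_bounds unfolding e by simp
    then show "\<exists>K r. 0 \<le> K \<and> 0 \<le> r \<and> r < cmod z \<and> (\<exists>\<^sub>F j in sequentially. \<exists>\<tau>. fib_hoelder j \<tau> \<and> \<tau> \<le> K * r ^ j)"
      using theta z by (intro exI[of _ "distC powr (1 / p')"] exI[of _ \<theta>]) auto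
  qed
  show "?r \<le> ?B"
  proof (rule essential_radius_le[OF _ T1])
    fix z assume B: "?B < ennreal (cmod z)"
    define L where "L = liminf (\<lambda>j. ennreal (\<sigma> j powr (1 / real j)))"
    \<comment> \<open>Finiteness must be checked, since \<open>enn2real\<close> would send an
      infinite lower limit to 0 and make the bound meaningless.\<close>
    have "L \<le> liminf (\<lambda>j::nat. (1::ennreal))"
      unfolding L_def
    proof (intro Liminf_mono always_eventually allI)
      fix j
      have "\<sigma> j \<le> (contr ^ j) powr (s * p')"
        unfolding \<sigma>_def using s_pos p'0 by (intro sum_grid_powr_le) auto
      also have "\<dots> \<le> 1" using contr_bounds s_pos p'0 by (intro powr_le1) (auto simp: power_le_one)
      finally have "\<sigma> j powr (1 / real j) \<le> 1" using \<sigma>0 by (intro powr_le1) auto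
      then show "ennreal (\<sigma> j powr (1 / real j)) \<le> 1" by simp
    qed
    then have Lfin: "L = ennreal (enn2real L)"
      by (simp add: Liminf_const) (metis ennreal_enn2real ennreal_one_less_top order_le_less_trans)
    have "enn2real L powr (1 / p') < cmod z"
      using B unfolding \<sigma>_def[symmetric] L_def[symmetric] by (simp add: ennreal_less_iff)
    then have "(enn2real L powr (1 / p')) powr p' < cmod z powr p'"
      using p'0 by (intro powr_less_mono2) auto
    then have "enn2real L < cmod z powr p'" using p'0 by (simp add: powr_powr)
    then have "L < ennreal (cmod z powr p')" by (subst Lfin) (simp add: ennreal_less_iff)
    then obtain r where r: "0 \<le> r" "r < cmod z powr p'" "\<exists>\<^sub>F j in sequentially. \<sigma> j \<le> r ^ j"
      using exponent_less_of_liminf_less[of \<sigma> "cmod z powr p'"] \<sigma>0 unfolding L_def by blast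
    \<comment> \<open>The value r may be 0, while \<open>fh\<close> rewrites powers of its base by
      real exponents and needs a positive one; the midpoint still lies below |z|^p'.\<close>
    define r' where "r' = (r + cmod z powr p') / 2"
    have r': "0 < r'" "r \<le> r'" "r' < cmod z powr p'" using r by (auto simp: r'_def)
    have "\<exists>\<^sub>F j in sequentially. \<exists>\<tau>. fib_hoelder j \<tau> \<and> \<tau> \<le> distC powr (1 / p') * (r' powr (1 / p')) ^ j"
      using r(3)
    proof (rule frequently_elim1)
      fix j assume "\<sigma> j \<le> r ^ j"
      also have "\<dots> \<le> r' ^ j" using r r' by (intro power_mono) auto
      finally show "\<exists>\<tau>. fib_hoelder j \<tau> \<and> \<tau> \<le> distC powr (1 / p') * (r' powr (1 / p')) ^ j"
        using r' by (intro fh)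
    qed
    moreover have "r' powr (1 / p') < cmod z"
    proof -
      have "r' powr (1 / p') < (cmod z powr p') powr (1 / p')" using r' p'0 by (intro powr_less_mono2) auto
      then show ?thesis using p'0 by (simp add: powr_powr)
    qed
    ultimately show "\<exists>K r. 0 \<le> K \<and> 0 \<le> r \<and> r < cmod z \<and> (\<exists>\<^sub>F j in sequentially. \<exists>\<tau>. fib_hoelder j \<tau> \<and> \<tau> \<le> K * r ^ j)"
      by (intro exI[of _ "distC powr (1 / p')"] exI[of _ "r' powr (1 / p')"]) auto
  qed
qed

lemma essential_radius_1:
  assumes p: "p = 1"
  shows "essential_spectral_radius M V N T \<le> liminf (\<lambda>j. ennreal
           (Max ((\<lambda>Q. measure M Q powr s) ` grid j) powr (1 / real j)))" (is "?r \<le> ?B")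
    and "essential_spectral_radius M V N T \<le> ennreal \<theta>"
proof -
  define m where "m j = Max ((\<lambda>Q. measure M Q powr s) ` grid j)" for j
  have fh: "fib_hoelder j (m j)" for j unfolding m_def by (rule fib_hoelder_1[OF p])
  then have T1: "\<exists>\<tau>. fib_hoelder (Suc 0) \<tau>" by blast
  have m0: "0 \<le> m j" for j using fh[of j] by (simp add: fib_hoelder_def)
  have m\<theta>: "m j \<le> \<theta> ^ j" for j
  proof -
    have "grid j \<noteq> {}" using D_nonempty by (simp add: grid_eq)
    moreover have "measure M Q powr s \<le> \<theta> ^ j" if "Q \<in> grid j" for Q
      using powr_mono2[OF less_imp_le[OF s_pos] _ grid_measure_le[OF that]] by (simp add: contr_power_powr \<theta>_def)
    ultimately show ?thesis unfolding m_def using finite_grid by (subst Max_le_iff) auto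
  qed
  show "?r \<le> ennreal \<theta>"
  proof (rule essential_radius_le[OF _ T1])
    fix z assume "ennreal \<theta> < ennreal (cmod z)"
    then have z: "\<theta> < cmod z" using theta by (simp add: ennreal_less_iff)
    have "\<exists>\<tau>. fib_hoelder j \<tau> \<and> \<tau> \<le> 1 * \<theta> ^ j" for j using fh m\<theta> by auto
    then show "\<exists>K r. 0 \<le> K \<and> 0 \<le> r \<and> r < cmod z \<and> (\<exists>\<^sub>F j in sequentially. \<exists>\<tau>. fib_hoelder j \<tau> \<and> \<tau> \<le> K * r ^ j)"
      using theta z by (intro exI[of _ 1] exI[of _ \<theta>]) auto
  qed
  show "?r \<le> ?B"
  proof (rule essential_radius_le[OF _ T1])
    fix z assume "?B < ennreal (cmod z)"
    then obtain r where r: "0 \<le> r" "r < cmod z" "\<exists>\<^sub>F j in sequentially. m j \<le> r ^ j"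
      using exponent_less_of_liminf_less[of m "cmod z"] m0 unfolding m_def by blast
    have "\<exists>\<^sub>F j in sequentially. \<exists>\<tau>. fib_hoelder j \<tau> \<and> \<tau> \<le> 1 * r ^ j"
      using r(3) by (rule frequently_elim1) (use fh in auto)
    then show "\<exists>K r. 0 \<le> K \<and> 0 \<le> r \<and> r < cmod z \<and> (\<exists>\<^sub>F j in sequentially. \<exists>\<tau>. fib_hoelder j \<tau> \<and> \<tau> \<le> K * r ^ j)"
      using r by (intro exI[of _ 1] exI[of _ r]) auto
  qed
qed

end

theorem theorem5p1:
  fixes M :: "'a measure" and n :: nat and U :: "nat \<Rightarrow> 'a set"
    and f :: "'a \<Rightarrow> 'a" and w :: "'a \<Rightarrow> real"
    and \<beta> \<epsilon> s p p' :: real and q :: ereal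
  assumes "markovian_expanding_map M n U f w \<beta> \<epsilon>"
    and "1 \<le> p" and "1 \<le> q"
    and "0 < s" and "s < \<beta>" and "\<beta> < 1 / p"
    and "p > 1 \<Longrightarrow> 1 / p + 1 / p' = 1"
  shows "let P = dynamical_grid M n U f;
             r_ess = essential_spectral_radius M (besov_space M P s p q) (besov_norm M P s p q)
                       (transfer_operator n U f w);
             inf_w = (INF x\<in>(\<Union>i\<in>{1..n}. U i). w x)
         in (p > 1 \<longrightarrow>
               r_ess \<le> ennreal (enn2real (liminf (\<lambda>j. ennreal
                 ((\<Sum>Q\<in>P j. measure M Q powr (1 + s * p')) powr (1 / real j)))) powr (1 / p'))) \<and>
            (p = 1 \<longrightarrow>
               r_ess \<le> liminf (\<lambda>j. ennreal
                 (Max ((\<lambda>Q. measure M Q powr s) ` P j) powr (1 / real j)))) \<and>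
            r_ess \<le> ennreal (inf_w powr (- s)) \<and> inf_w powr (- s) < 1"
proof -
  interpret markovian_expanding_map M n U f w \<beta> \<epsilon> by (rule assms(1))
  interpret besov_map M n U f w \<beta> \<epsilon> s p q
    by unfold_locales (use assms in auto)
  have i: "(INF x\<in>(\<Union>i\<in>{1..n}. U i). w x) powr (- s) = \<theta>"
    by (simp add: theta_eq infw_def D_def)
  have r: "essential_spectral_radius M V N T \<le> ennreal \<theta>"
    using assms(2,7) essential_radius_conjugate(2)[of p'] essential_radius_1(2) by (cases "p = 1") auto
  show ?thesis
    unfolding Let_def i
  proof (intro conjI impI r theta(2))
    assume "1 < p"
    then show "essential_spectral_radius M V N T \<le> ennreal (enn2real (liminf (\<lambda>j. ennreal
           ((\<Sum>Q\<in>grid j. measure M Q powr (1 + s * p')) powr (1 / real j)))) powr (1 / p'))"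
      by (intro essential_radius_conjugate(1) assms(7))
  next
    assume "p = 1"
    then show "essential_spectral_radius M V N T \<le> liminf (\<lambda>j. ennreal
           (Max ((\<lambda>Q. measure M Q powr s) ` grid j) powr (1 / real j)))"
      by (rule essential_radius_1(1))
  qed
qed

end
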